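(* Let $\Bbbk$ be a field with $\Bbbk\ne\mathbb{Z}/(2)$. For each fixed integer $n\ge2$, let $\mathcal{C}_n$ be the class consisting of the groups $\operatorname{Aut}(\Bbbk_q[x_1,\dots,x_n]^{(v)})$ for all roots of unity $q\in\Bbbk^\times$ and all positive integers $v$. (1) If $n$ is odd, then the Tits alternative holds for $\mathcal{C}_n$. (2) The Tits alternative holds for $\mathcal{C}_2$.
   Context: $\operatorname{Aut}(A)$ is the group of $\Bbbk$-algebra automorphisms of $A$. $\Bbbk_q[x_1,\dots,x_n]$ is the $\Bbbk$-algebra generated by $x_1,\dots,x_n$ subject to $x_jx_i=q\,x_ix_j$ for all $1\le i<j\le n$; it is $\mathbb{N}$-graded with $\deg x_i=1$. For a $\mathbb{Z}$-graded algebra $C=\bigoplus_i C_i$ and a positive integer $v$, the $v$th Veronese subring is $C^{(v)}=\bigoplus_i C_{vi}$. A group $G$ is virtually solvable if it has a normal solvable subgroup $N$ with $G/N$ finite. A class $\mathcal{C}$ of groups satisfies the Tits alternative if every $G\in\mathcal{C}$ is either virtually solvable or contains a free subgroup of rank $2$. *)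

theory Defs
  imports "HOL-Algebra.Module" "HOL-Algebra.QuotRing" "HOL-Algebra.Bij" "HOL-Algebra.Solvable_Groups"
begin

section \<open>Algebras over a field\<close>

text \<open>
  The base field is a type \<open>'k\<close> of class \<open>field\<close>. A (not necessarily commutative)
  \<open>'k\<close>-algebra is an HOL-Algebra \<^type>\<open>module\<close> record: a ring record together with a
  scalar multiplication \<open>\<odot>\<close> by elements of \<open>'k\<close>.
\<close>

definition alg_hom :: "('k::field, 'a) module \<Rightarrow> ('k, 'b) module \<Rightarrow> ('a \<Rightarrow> 'b) set" where
  "alg_hom A B = {h \<in> ring_hom A B. \<forall>c. \<forall>x \<in> carrier A. h (c \<odot>\<^bsub>A\<^esub> x) = c \<odot>\<^bsub>B\<^esub> h x}"

text \<open>The analogue of the library's \<^const>\<open>AutoGroup\<close>, for algebras.\<close>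

definition alg_Aut :: "('k::field, 'a) module \<Rightarrow> ('a \<Rightarrow> 'a) monoid" where
  "alg_Aut A = BijGroup (carrier A) \<lparr>carrier := alg_hom A A \<inter> Bij (carrier A)\<rparr>"

text \<open>The quotient of an algebra by a two-sided ideal: the quotient ring \<open>A Quot I\<close>, in which
  \<open>c\<close> times the coset of \<open>y\<close> is the coset of \<open>c \<odot> y\<close>.\<close>

definition quot_alg :: "('k::field, 'a) module \<Rightarrow> 'a set \<Rightarrow> ('k, 'a set) module" where
  "quot_alg A I =
     ring.extend (A Quot I) (module.fields (\<lambda>c Y. \<Union>y\<in>Y. I +>\<^bsub>A\<^esub> (c \<odot>\<^bsub>A\<^esub> y)))"

text \<open>\<open>D i\<close> is the homogeneous component of degree \<open>i\<close> of the graded algebra \<open>A\<close>.\<close>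

definition veronese :: "('k::field, 'a) module \<Rightarrow> (int \<Rightarrow> 'a set) \<Rightarrow> nat \<Rightarrow> ('k, 'a) module" where
  "veronese A D v =
     A \<lparr>carrier := {finsum A a S | a S. finite S \<and> (\<forall>i\<in>S. a i \<in> D (int v * i))}\<rparr>"


section \<open>Free algebras\<close>

text \<open>
  The free algebra on \<open>B\<close> has the words over \<open>B\<close> as a basis. An element is given by its
  finitely supported coefficient function, and the product is induced by concatenation of
  words: the coefficient of \<open>w\<close> in a product is a sum over the ways of cutting \<open>w\<close> in two.
\<close>

definition free_alg :: "'x set \<Rightarrow> ('k::field, 'x list \<Rightarrow> 'k) module" where
  "free_alg B =
     \<lparr>carrier = {f. finite {w. f w \<noteq> 0} \<and> {w. f w \<noteq> 0} \<subseteq> lists B},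
      mult = \<lambda>f g w. \<Sum>i\<le>length w. f (take i w) * g (drop i w),
      one = \<lambda>w. if w = [] then 1 else 0,
      zero = \<lambda>w. 0,
      add = \<lambda>f g w. f w + g w,
      smult = \<lambda>c f w. c * f w\<rparr>"

definition free_gen :: "'x \<Rightarrow> 'x list \<Rightarrow> 'k::field" where
  "free_gen x = (\<lambda>w. if w = [x] then 1 else 0)"

text \<open>
  The locale \<^locale>\<open>ideal\<close> includes the ring axioms of the ambient structure, so the ideals
  generated in \<^const>\<open>free_alg\<close> below are meaningful only because it is a ring.
\<close>

lemma free_alg_carrierI:
  assumes "{w. f w \<noteq> 0} \<subseteq> S" "finite S" "S \<subseteq> lists B"
  shows "f \<in> carrier (free_alg B)"
  using finite_subset[OF assms(1,2)] subset_trans[OF assms(1,3)] by (simp add: free_alg_def)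

lemma free_alg_mult_assoc:
  fixes f g h :: "'x list \<Rightarrow> 'k::field"
  shows "(\<Sum>i\<le>length w. (\<Sum>j\<le>length (take i w). f (take j (take i w)) * g (drop j (take i w)))
            * h (drop i w)) =
         (\<Sum>j\<le>length w. f (take j w)
            * (\<Sum>k\<le>length (drop j w). g (take k (drop j w)) * h (drop k (drop j w))))"
    (is "?L = ?R")
proof -
  let ?F = "\<lambda>i j. f (take j w) * g (drop j (take i w)) * h (drop i w)"
  have "?L = (\<Sum>i\<le>length w. \<Sum>j\<le>i. ?F i j)"
    by (intro sum.cong refl) (auto simp: sum_distrib_right min_def intro!: sum.cong)
  also have "\<dots> = (\<Sum>(i,j)\<in>(SIGMA i:{..length w}. {..i}). ?F i j)"
    by (simp add: sum.Sigma)
  also have "\<dots> = (\<Sum>(j,k)\<in>(SIGMA j:{..length w}. {..length w - j}). ?F (j + k) j)"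
    by (rule sum.reindex_bij_witness[of _ "\<lambda>(j,k). (j + k, j)" "\<lambda>(i,j). (j, i - j)"]) auto
  also have "\<dots> = (\<Sum>j\<le>length w. \<Sum>k\<le>length w - j. ?F (j + k) j)"
    by (simp add: sum.Sigma)
  also have "\<dots> = ?R"
    by (intro sum.cong refl)
       (auto simp: sum_distrib_left drop_take mult.assoc add.commute intro!: sum.cong)
  finally show ?thesis .
qed

lemma free_alg_mult_closed:
  fixes f g :: "'x list \<Rightarrow> 'k::field"
  assumes "f \<in> carrier (free_alg B)" "g \<in> carrier (free_alg B)"
  shows "f \<otimes>\<^bsub>free_alg B\<^esub> g \<in> carrier (free_alg B)"
proof -
  let ?S = "(\<lambda>(u,v). u @ v) ` ({w. f w \<noteq> 0} \<times> {w. g w \<noteq> 0})"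
  have "{w. (f \<otimes>\<^bsub>free_alg B\<^esub> g) w \<noteq> 0} \<subseteq> ?S"
  proof
    fix w assume "w \<in> {w. (f \<otimes>\<^bsub>free_alg B\<^esub> g) w \<noteq> 0}"
    then have "(\<Sum>i\<le>length w. f (take i w) * g (drop i w)) \<noteq> 0"
      by (simp add: free_alg_def)
    then obtain i where "f (take i w) * g (drop i w) \<noteq> 0"
      by (meson sum.not_neutral_contains_not_neutral)
    then show "w \<in> ?S"
      by (intro image_eqI[of _ _ "(take i w, drop i w)"]) auto
  qed
  moreover have "finite ?S" "?S \<subseteq> lists B"
    using assms by (auto simp: free_alg_def subset_eq)
  ultimately show ?thesis
    by (intro free_alg_carrierI[of _ ?S])
qed

lemma ring_free_alg: "ring (free_alg B :: ('k::field, 'x list \<Rightarrow> 'k) module)"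
proof (rule ringI)
  let ?F = "free_alg B :: ('k, 'x list \<Rightarrow> 'k) module"
  have add: "f \<oplus>\<^bsub>?F\<^esub> g \<in> carrier ?F" if "f \<in> carrier ?F" "g \<in> carrier ?F" for f g
  proof -
    let ?S = "{w. f w \<noteq> 0} \<union> {w. g w \<noteq> 0}"
    have "{w. f w + g w \<noteq> 0} \<subseteq> ?S" by auto
    moreover have "finite ?S" "?S \<subseteq> lists B" using that by (auto simp: free_alg_def)
    ultimately show ?thesis
      by (intro free_alg_carrierI[of _ ?S]) (simp_all add: free_alg_def)
  qed
  show "abelian_group ?F"
  proof (rule abelian_groupI)
    fix f assume f: "f \<in> carrier ?F"
    show "\<exists>g\<in>carrier ?F. g \<oplus>\<^bsub>?F\<^esub> f = \<zero>\<^bsub>?F\<^esub>"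
      by (rule bexI[of _ "\<lambda>w. - f w"]) (use f in \<open>auto simp: free_alg_def\<close>)
  qed (use add in \<open>auto simp: free_alg_def add_ac\<close>)
  show "Group.monoid ?F"
  proof (rule monoidI)
    fix f :: "'x list \<Rightarrow> 'k" assume "f \<in> carrier ?F"
    show "\<one>\<^bsub>?F\<^esub> \<otimes>\<^bsub>?F\<^esub> f = f"
    proof
      fix w
      have "(\<one>\<^bsub>?F\<^esub> \<otimes>\<^bsub>?F\<^esub> f) w = (\<Sum>i\<le>length w. if i = 0 then f w else 0)"
        by (auto simp: free_alg_def simp del: sum.delta sum.delta' intro!: sum.cong)
      then show "(\<one>\<^bsub>?F\<^esub> \<otimes>\<^bsub>?F\<^esub> f) w = f w" by simp
    qed
    show "f \<otimes>\<^bsub>?F\<^esub> \<one>\<^bsub>?F\<^esub> = f"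
    proof
      fix w
      have "(f \<otimes>\<^bsub>?F\<^esub> \<one>\<^bsub>?F\<^esub>) w = (\<Sum>i\<le>length w. if i = length w then f w else 0)"
        by (auto simp: free_alg_def simp del: sum.delta sum.delta' intro!: sum.cong)
      then show "(f \<otimes>\<^bsub>?F\<^esub> \<one>\<^bsub>?F\<^esub>) w = f w" by simp
    qed
  next
    fix f g h :: "'x list \<Rightarrow> 'k"
    show "f \<otimes>\<^bsub>?F\<^esub> g \<otimes>\<^bsub>?F\<^esub> h = f \<otimes>\<^bsub>?F\<^esub> (g \<otimes>\<^bsub>?F\<^esub> h)"
      using free_alg_mult_assoc[where f = f and g = g and h = h] by (simp add: free_alg_def fun_eq_iff)
  qed (simp_all add: free_alg_mult_closed, simp add: free_alg_def)
qed (auto simp: free_alg_def distrib_left distrib_right sum.distrib)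


section \<open>Quantum polynomial algebras\<close>

definition quantum_rels :: "nat \<Rightarrow> 'k::field \<Rightarrow> (nat list \<Rightarrow> 'k) set" where
  "quantum_rels n q =
     {free_gen j \<otimes>\<^bsub>free_alg {1..n}\<^esub> free_gen i \<ominus>\<^bsub>free_alg {1..n}\<^esub>
        q \<odot>\<^bsub>free_alg {1..n}\<^esub> (free_gen i \<otimes>\<^bsub>free_alg {1..n}\<^esub> free_gen j) | i j.
      1 \<le> i \<and> i < j \<and> j \<le> n}"

definition quantum_ideal :: "nat \<Rightarrow> 'k::field \<Rightarrow> (nat list \<Rightarrow> 'k) set" where
  "quantum_ideal n q = Idl\<^bsub>free_alg {1..n}\<^esub> (quantum_rels n q)"

definition quantum_poly :: "nat \<Rightarrow> 'k::field \<Rightarrow> ('k, (nat list \<Rightarrow> 'k) set) module" where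
  "quantum_poly n q = quot_alg (free_alg {1..n}) (quantum_ideal n q)"

text \<open>All generators have degree 1, so the component of degree \<open>d\<close> consists of the classes of
  the linear combinations of words of length \<open>d\<close>; it is zero for \<open>d < 0\<close>.\<close>

definition quantum_deg :: "nat \<Rightarrow> 'k::field \<Rightarrow> int \<Rightarrow> (nat list \<Rightarrow> 'k) set set" where
  "quantum_deg n q d =
     {quantum_ideal n q +>\<^bsub>free_alg {1..n}\<^esub> f | f.
        f \<in> carrier (free_alg {1..n}) \<and> (\<forall>w. f w \<noteq> 0 \<longrightarrow> int (length w) = d)}"

definition quantum_veronese :: "nat \<Rightarrow> 'k::field \<Rightarrow> nat \<Rightarrow> ('k, (nat list \<Rightarrow> 'k) set) module" where
  "quantum_veronese n q v = veronese (quantum_poly n q) (quantum_deg n q) v"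


section \<open>The Tits alternative\<close>

definition virtually_solvable :: "('g, 'm) monoid_scheme \<Rightarrow> bool" where
  "virtually_solvable G \<longleftrightarrow>
     (\<exists>N. N \<lhd> G \<and> solvable (G\<lparr>carrier := N\<rparr>) \<and> finite (carrier (G Mod N)))"

text \<open>Group words: the letter \<open>(x, True)\<close> stands for \<open>x\<close> and \<open>(x, False)\<close> for its inverse.\<close>

fun word_eval :: "('g, 'm) monoid_scheme \<Rightarrow> ('g \<times> bool) list \<Rightarrow> 'g" where
  "word_eval G [] = \<one>\<^bsub>G\<^esub>"
| "word_eval G ((x, e) # w) = (if e then x else inv\<^bsub>G\<^esub> x) \<otimes>\<^bsub>G\<^esub> word_eval G w"

definition reduced_words :: "'g set \<Rightarrow> ('g \<times> bool) list set" where
  "reduced_words B =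
     {w. fst ` set w \<subseteq> B \<and>
         (\<forall>i. Suc i < length w \<longrightarrow> \<not> (fst (w ! i) = fst (w ! Suc i) \<and> snd (w ! i) \<noteq> snd (w ! Suc i)))}"

text \<open>\<open>G\<close> is free with basis \<open>B\<close>: every element is the value of exactly one reduced word in \<open>B\<close>.\<close>

definition free_basis :: "('g, 'm) monoid_scheme \<Rightarrow> 'g set \<Rightarrow> bool" where
  "free_basis G B \<longleftrightarrow>
     B \<subseteq> carrier G \<and> bij_betw (word_eval G) (reduced_words B) (carrier G)"

definition contains_free_rank_2 :: "('g, 'm) monoid_scheme \<Rightarrow> bool" where
  "contains_free_rank_2 G \<longleftrightarrow>
     (\<exists>H B. subgroup H G \<and> free_basis (G\<lparr>carrier := H\<rparr>) B \<and> card B = 2)"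

definition tits_alternative :: "('g, 'm) monoid_scheme set \<Rightarrow> bool" where
  "tits_alternative \<C> \<longleftrightarrow> (\<forall>G\<in>\<C>. virtually_solvable G \<or> contains_free_rank_2 G)"

definition root_of_unity :: "'k::field \<Rightarrow> bool" where
  "root_of_unity q \<longleftrightarrow> (\<exists>m>0. q ^ m = 1)"

definition veronese_Aut_class ::
    "'k::field itself \<Rightarrow> nat \<Rightarrow> ((nat list \<Rightarrow> 'k) set \<Rightarrow> (nat list \<Rightarrow> 'k) set) monoid set" where
  "veronese_Aut_class _ n =
     {alg_Aut (quantum_veronese n q v) | (q::'k) v. root_of_unity q \<and> v > 0}"

end

theory Submission
  imports Defs "HOL-Library.Poly_Mapping"
begin

text \<open>
  The \<open>v\<close>-th Veronese subring \<open>B\<close> of the quantum polynomial algebra has a basis of monomials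
  \<open>x\<^sup>a\<close>, where \<open>a\<close> runs over the exponent vectors in a cone \<open>C\<close> (nonnegative entries, total degree
  divisible by \<open>v\<close>), and \<open>x\<^sup>a x\<^sup>b\<close> is a power of \<open>q\<close> times \<open>x\<^sup>a\<^sup>+\<^sup>b\<close>. So \<open>B\<close> sits inside a twisted
  group algebra of the lattice \<open>\<Lambda>\<close> generated by \<open>C\<close>, where monomials can be inverted. Write \<open>R\<close>
  for the radical of the commutation pairing on \<open>\<Lambda>\<close>; the centre of \<open>B\<close> is spanned by the monomials
  with exponents in \<open>R \<inter> C\<close>. For each \<open>i\<close> the \<open>i\<close>-th coordinates of the elements of \<open>R\<close> form a
  subgroup \<open>d\<^sub>i\<int>\<close> with \<open>d\<^sub>i > 0\<close>, as \<open>q\<close> is a root of unity. The proof is a dichotomy on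
  the \<open>d\<^sub>i\<close>, for every \<open>n \<ge> 2\<close>.

  Suppose some \<open>d\<^sub>i\<close> is \<open>1\<close>. Along an element of \<open>R\<close> the values \<open>q\<close> to the power of the
  coordinates are alternately inverse to each other (\<open>radical_adjacent\<close>), and this forces every
  \<open>d\<^sub>j\<close> to be \<open>1\<close> (\<open>radical_unit_coordinate\<close>). If \<open>e \<in> R\<close> has \<open>j\<close>-th entry \<open>-1\<close> and otherwise
  nonnegative entries, then \<open>x\<^sup>a \<mapsto> x\<^sup>a (1 + l x\<^sup>e)\<close> to the power \<open>a\<^sub>j\<close> is an automorphism of
  \<open>B\<close>, because \<open>x\<^sup>e\<close> is central; for \<open>B\<close> a polynomial ring it adds a multiple of a monomial in the
  other variables to \<open>x\<^sub>j\<close>. Two such one-parameter groups, for \<open>j = 1\<close> and \<open>j = 2\<close>, play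
  ping-pong with the degrees of the images of monomials, and they contain a free group of rank 2 as
  soon as the field has an element besides \<open>0\<close> and \<open>1\<close> (\<open>contains_free_rank_2_Aut\<close>).

  Suppose every \<open>d\<^sub>i\<close> is at least \<open>2\<close>: the variables ramify over the centre. The projection of \<open>B\<close>
  onto its centre is compatible with all automorphisms (\<open>E_Aut\<close>), so they also preserve the dual
  of \<open>B\<close> for the corresponding trace form, an inverse different. It is spanned by the
  monomials whose exponents satisfy \<open>b\<^sub>i \<ge> -(d\<^sub>i - 1)\<close>. A suitable power of the different is the
  principal ideal of a central monomial \<open>X\<close>, and by ramification \<open>X\<close> involves every variable. Hence
  automorphisms fix \<open>X\<close> up to a scalar (\<open>Aut_X\<close>). As every monomial divides a power of \<open>X\<close> and the
  factors of a monomial are monomials, automorphisms permute the monomials up to scalars. The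
  permutations that occur are finite in number, and the automorphisms inducing the trivial
  one are diagonal, so they commute: the automorphism group is virtually solvable
  (\<open>virtually_solvable_Aut\<close>).
\<close>

section \<open>Twisted group algebras\<close>

abbreviation keys :: "('a \<Rightarrow>\<^sub>0 'b::zero) \<Rightarrow> 'a set" where
  "keys \<equiv> Poly_Mapping.keys"

abbreviation lookup :: "('a \<Rightarrow>\<^sub>0 'b::zero) \<Rightarrow> 'a \<Rightarrow> 'b" where
  "lookup \<equiv> Poly_Mapping.lookup"

abbreviation single :: "'a \<Rightarrow> 'b::zero \<Rightarrow> ('a \<Rightarrow>\<^sub>0 'b)" where
  "single \<equiv> Poly_Mapping.single"

lemma single_eq_0_iff [simp]: "single a c = 0 \<longleftrightarrow> c = 0"
  by (metis lookup_single_eq lookup_zero single_zero)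

text \<open>The bicharacter \<open>chi\<close> twists the product of the group algebra: with \<open>x\<^sup>a\<close> for
  \<open>single a 1\<close>, the product \<open>x\<^sup>a x\<^sup>b\<close> is \<open>chi a b x\<^sup>a\<^sup>+\<^sup>b\<close>. Scalars are the elements \<open>single 0 c\<close>.
  The order on the exponents serves to isolate extreme terms of products.\<close>

locale twisted_group_algebra =
  fixes chi :: "'e::linordered_ab_group_add \<Rightarrow> 'e \<Rightarrow> 'k::field"
  assumes chi_add_left: "chi (a + b) c = chi a c * chi b c"
    and chi_add_right: "chi a (b + c) = chi a b * chi a c"
    and chi_nonzero: "chi a b \<noteq> 0"
begin

definition tmul :: "('e \<Rightarrow>\<^sub>0 'k) \<Rightarrow> ('e \<Rightarrow>\<^sub>0 'k) \<Rightarrow> ('e \<Rightarrow>\<^sub>0 'k)" (infixl \<open>\<star>\<close> 70) where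
  "f \<star> g = (\<Sum>a\<in>keys f. \<Sum>b\<in>keys g. single (a + b) (chi a b * (lookup f a * lookup g b)))"

lemma chi_zero [simp]: "chi 0 a = 1" "chi a 0 = 1"
proof -
  show "chi 0 a = 1" "chi a 0 = 1"
    using chi_add_left[of 0 0 a] chi_add_right[of a 0 0] chi_nonzero by simp_all
qed

lemma tmul_superset:
  assumes "finite A" "keys f \<subseteq> A" "finite B" "keys g \<subseteq> B"
  shows "f \<star> g = (\<Sum>a\<in>A. \<Sum>b\<in>B. single (a + b) (chi a b * (lookup f a * lookup g b)))"
proof -
  have "f \<star> g = (\<Sum>a\<in>keys f. \<Sum>b\<in>B. single (a + b) (chi a b * (lookup f a * lookup g b)))"
    unfolding tmul_def using assms
    by (intro sum.cong refl sum.mono_neutral_left) (auto simp: in_keys_iff)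
  also have "\<dots> = (\<Sum>a\<in>A. \<Sum>b\<in>B. single (a + b) (chi a b * (lookup f a * lookup g b)))"
    using assms by (intro sum.mono_neutral_left) (auto simp: in_keys_iff)
  finally show ?thesis .
qed

lemma tmul_add_left: "(f + g) \<star> h = f \<star> h + g \<star> h"
proof -
  let ?A = "keys f \<union> keys g"
  have "keys (f + g) \<subseteq> ?A" by (rule keys_add)
  then show ?thesis
    by (simp add: tmul_superset[of ?A _ "keys h"] lookup_add algebra_simps single_add sum.distrib)
qed

lemma tmul_add_right: "h \<star> (f + g) = h \<star> f + h \<star> g"
proof -
  let ?A = "keys f \<union> keys g"
  have "keys (f + g) \<subseteq> ?A" by (rule keys_add)
  then show ?thesis
    by (simp add: tmul_superset[of "keys h" _ ?A] lookup_add algebra_simps single_add sum.distrib)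
qed

lemma tmul_zero [simp]: "0 \<star> f = 0" "f \<star> 0 = 0"
  by (simp_all add: tmul_def)

lemma tmul_single: "single a c \<star> single b d = single (a + b) (chi a b * (c * d))"
  by (subst tmul_superset[of "{a}" _ "{b}"]) auto

lemma tmul_uminus: "(- f) \<star> g = - (f \<star> g)" "f \<star> (- g) = - (f \<star> g)"
  by (metis add_eq_0_iff tmul_add_left tmul_zero(1), metis add_eq_0_iff tmul_add_right tmul_zero(2))

lemma tmul_diff_left: "(f - g) \<star> h = f \<star> h - g \<star> h"
  using tmul_add_left[of f "- g" h] by (simp add: tmul_uminus)

lemma tmul_diff_right: "h \<star> (f - g) = h \<star> f - h \<star> g"
  using tmul_add_right[of h f "- g"] by (simp add: tmul_uminus)

lemma tmul_sum_left: "sum f I \<star> g = (\<Sum>i\<in>I. f i \<star> g)"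
  by (induction I rule: infinite_finite_induct) (auto simp: tmul_add_left)

lemma tmul_sum_right: "g \<star> sum f I = (\<Sum>i\<in>I. g \<star> f i)"
  by (induction I rule: infinite_finite_induct) (auto simp: tmul_add_right)

lemma sum_single_keys: "(\<Sum>a\<in>keys f. single a (lookup f a)) = f"
  by (intro poly_mapping_eqI)
     (auto simp: lookup_sum lookup_single when_def in_keys_iff)

lemma single_sum_induct [case_names zero single add]:
  fixes f :: "'e \<Rightarrow>\<^sub>0 'k"
  assumes "P 0" "\<And>a c. a \<in> keys f \<Longrightarrow> P (single a c)" "\<And>g h. P g \<Longrightarrow> P h \<Longrightarrow> P (g + h)"
  shows "P f"
proof -
  have "P (\<Sum>a\<in>A. single a (lookup f a))" if "finite A" "A \<subseteq> keys f" for A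
    using that by (induction A rule: finite_induct) (auto intro: assms)
  from this[of "keys f"] show ?thesis by (simp add: sum_single_keys)
qed

lemma tmul_assoc: "f \<star> g \<star> h = f \<star> (g \<star> h)"
proof (induction f rule: single_sum_induct)
  case (single a c)
  show ?case
  proof (induction g rule: single_sum_induct)
    case (single b d)
    show ?case
      by (induction h rule: single_sum_induct)
         (simp_all add: tmul_single tmul_add_right chi_add_left chi_add_right algebra_simps)
  qed (simp_all add: tmul_add_left tmul_add_right)
qed (simp_all add: tmul_add_left)

lemma tmul_one [simp]: "1 \<star> f = f" "f \<star> 1 = f"
  unfolding single_one[symmetric]
  by (induction f rule: single_sum_induct)
     (auto simp: tmul_single tmul_add_right tmul_add_left simp del: single_one)

lemma scalar_commute: "f \<star> single 0 c = single 0 c \<star> f"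
  by (induction f rule: single_sum_induct)
     (auto simp: tmul_single tmul_add_right tmul_add_left mult.commute)

lemma lookup_scalar: "lookup (single 0 c \<star> f) a = c * lookup f a"
  by (induction f rule: single_sum_induct)
     (auto simp: tmul_single tmul_add_right lookup_add algebra_simps lookup_single when_def)

lemma scalar_move: "f \<star> (single 0 c \<star> g) = single 0 c \<star> (f \<star> g)"
  by (metis scalar_commute tmul_assoc)

lemma scalar_scalar: "single 0 c \<star> (single 0 d \<star> f) = single 0 (c * d) \<star> f"
  by (simp flip: tmul_assoc add: tmul_single)

lemma scalar_single [simp]: "single 0 c \<star> single a d = single a (c * d)"
  by (simp add: tmul_single)

lemma scalar_pair:
  "(single 0 c \<star> f) \<star> (single 0 d \<star> g) = single 0 (c * d) \<star> (f \<star> g)"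
proof -
  have "(single 0 c \<star> f) \<star> (single 0 d \<star> g) = single 0 c \<star> (f \<star> (single 0 d \<star> g))"
    by (rule tmul_assoc)
  then show ?thesis by (simp only: scalar_move[of f] scalar_scalar)
qed

lemma keys_scalar: "c \<noteq> 0 \<Longrightarrow> keys (single 0 c \<star> f) = keys f"
  by (auto simp: in_keys_iff lookup_scalar)

lemma keys_tmul: "keys (f \<star> g) \<subseteq> {a + b | a b. a \<in> keys f \<and> b \<in> keys g}"
  unfolding tmul_def
  by (rule order.trans[OF keys_sum] UN_least)+ auto

lemma keys_tmul_closed:
  assumes "\<And>a b. a \<in> S \<Longrightarrow> b \<in> T \<Longrightarrow> a + b \<in> U" "keys f \<subseteq> S" "keys g \<subseteq> T"
  shows "keys (f \<star> g) \<subseteq> U"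
  using keys_tmul[of f g] assms by blast

lemma lookup_tmul:
  "lookup (f \<star> g) c =
     (\<Sum>a\<in>keys f. \<Sum>b\<in>keys g. if a + b = c then chi a b * (lookup f a * lookup g b) else 0)"
  by (auto simp: tmul_def lookup_sum lookup_single when_def intro!: sum.cong)

text \<open>A sum of exponents that arises in only one way cannot cancel. The largest and the smallest
  exponents of the factors give such sums.\<close>

lemma lookup_tmul_extreme:
  assumes "a0 \<in> keys f" "b0 \<in> keys g"
    and uniq: "\<And>a b. a \<in> keys f \<Longrightarrow> b \<in> keys g \<Longrightarrow> a + b = a0 + b0 \<Longrightarrow> a = a0 \<and> b = b0"
  shows "a0 + b0 \<in> keys (f \<star> g)"
proof -
  have "lookup (f \<star> g) (a0 + b0) =
      (\<Sum>a\<in>keys f. \<Sum>b\<in>keys g. if a = a0 \<and> b = b0 then chi a b * (lookup f a * lookup g b) else 0)"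
    unfolding lookup_tmul using uniq by (intro sum.cong refl) auto
  also have "\<dots> = (\<Sum>a\<in>keys f. if a = a0 then chi a b0 * (lookup f a * lookup g b0) else 0)"
    using assms(2) by (intro sum.cong refl) auto
  also have "\<dots> = chi a0 b0 * (lookup f a0 * lookup g b0)"
    using assms(1) by simp
  finally show ?thesis using assms(1,2) chi_nonzero by (simp add: in_keys_iff)
qed

lemma lookup_tmul_single_right: "lookup (f \<star> single b c) (a + b) = chi a b * (lookup f a * c)"
  by (induction f rule: single_sum_induct)
     (auto simp: tmul_single tmul_add_left lookup_add algebra_simps lookup_single when_def)

lemma lookup_tmul_single_left: "lookup (single b c \<star> f) (a + b) = chi b a * (c * lookup f a)"
  by (induction f rule: single_sum_induct)
     (auto simp: tmul_single tmul_add_right lookup_add algebra_simps lookup_single when_def)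

lemma keys_tmul_single_right:
  "a \<in> keys f \<Longrightarrow> c \<noteq> 0 \<Longrightarrow> a + b \<in> keys (f \<star> single b c)"
  using chi_nonzero by (simp add: in_keys_iff lookup_tmul_single_right)

lemma monomial_inverse:
  obtains c where "single a 1 \<star> single (- a) c = (1 :: 'e \<Rightarrow>\<^sub>0 'k)"
  by (rule that[of "1 / chi a (- a)"]) (simp add: tmul_single chi_nonzero flip: single_one)

lemma add_eq_add_of_le:
  fixes a b c d :: 'e
  assumes "a \<le> c" "b \<le> d" "a + b = c + d"
  shows "a = c \<and> b = d"
proof -
  have "\<not> a < c"
    using add_less_le_mono[OF _ assms(2), of a c] assms(3) by (metis less_irrefl)
  then have "a = c" using assms(1) by order
  then show ?thesis using assms(3) by simp
qed

lemma Max_keys_tmul: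
  assumes "f \<noteq> 0" "g \<noteq> 0"
  shows "Max (keys f) + Max (keys g) \<in> keys (f \<star> g)"
proof (rule lookup_tmul_extreme)
  fix a b assume ab: "a \<in> keys f" "b \<in> keys g" "a + b = Max (keys f) + Max (keys g)"
  show "a = Max (keys f) \<and> b = Max (keys g)"
    by (rule add_eq_add_of_le) (use ab in auto)
qed (use assms in auto)

lemma Min_keys_tmul:
  assumes "f \<noteq> 0" "g \<noteq> 0"
  shows "Min (keys f) + Min (keys g) \<in> keys (f \<star> g)"
proof (rule lookup_tmul_extreme)
  fix a b assume ab: "a \<in> keys f" "b \<in> keys g" "a + b = Min (keys f) + Min (keys g)"
  have "Min (keys f) = a \<and> Min (keys g) = b"
    by (rule add_eq_add_of_le) (use ab in auto)
  then show "a = Min (keys f) \<and> b = Min (keys g)" by simp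
qed (use assms in auto)

lemma tmul_eq_0_iff [simp]: "f \<star> g = 0 \<longleftrightarrow> f = 0 \<or> g = 0"
  using Max_keys_tmul[of f g] by (metis empty_iff keys_zero tmul_zero)

lemma tmul_left_cancel: "f \<noteq> 0 \<Longrightarrow> f \<star> g = f \<star> h \<Longrightarrow> g = h"
  by (metis eq_iff_diff_eq_0 tmul_diff_right tmul_eq_0_iff)

text \<open>The largest and the smallest exponent of a product are the sums of those of the factors, so
  if they agree in the product, they agree in each factor.\<close>

lemma factor_of_monomial:
  assumes "f \<star> g = single c k" "k \<noteq> 0"
  obtains a l where "f = single a l" "l \<noteq> 0"
proof -
  have ne: "f \<noteq> 0" "g \<noteq> 0"
    using assms by auto
  have "Max (keys f) + Max (keys g) = c" "Min (keys f) + Min (keys g) = c"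
    using Max_keys_tmul[OF ne] Min_keys_tmul[OF ne] assms by auto
  moreover have le: "Min (keys f) \<le> Max (keys f)" "Min (keys g) \<le> Max (keys g)"
    using ne by (simp_all)
  ultimately have eq: "Min (keys f) = Max (keys f)"
    using add_eq_add_of_le by metis
  define m where "m = Max (keys f)"
  have "m \<in> keys f" using ne(1) by (simp add: m_def)
  moreover have "a = m" if "a \<in> keys f" for a
    using eq Max_ge[OF finite_keys that] Min_le[OF finite_keys that] unfolding m_def
    by (metis order_antisym)
  ultimately have "keys f = {m}" by blast
  then have "f = single m (lookup f m)" "lookup f m \<noteq> 0"
    using sum_single_keys[of f] by (simp_all flip: in_keys_iff)
  then show thesis using that by blast
qed

subsection \<open>Commutation and powers\<close>

lemma tmul_commute:
  assumes "\<And>a b. a \<in> keys f \<Longrightarrow> b \<in> keys g \<Longrightarrow> chi a b = chi b a"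
  shows "f \<star> g = g \<star> f"
proof -
  have "f \<star> g = (\<Sum>a\<in>keys f. \<Sum>b\<in>keys g. single (b + a) (chi b a * (lookup g b * lookup f a)))"
    unfolding tmul_def
  proof (intro sum.cong refl)
    fix a b assume "a \<in> keys f" "b \<in> keys g"
    from assms[OF this] show "single (a + b) (chi a b * (lookup f a * lookup g b)) =
        single (b + a) (chi b a * (lookup g b * lookup f a))"
      by (simp add: add.commute mult.commute)
  qed
  also have "\<dots> = g \<star> f" unfolding tmul_def by (rule sum.swap)
  finally show ?thesis .
qed

primrec tpow :: "('e \<Rightarrow>\<^sub>0 'k) \<Rightarrow> nat \<Rightarrow> ('e \<Rightarrow>\<^sub>0 'k)" where
  "tpow f 0 = 1"
| "tpow f (Suc k) = f \<star> tpow f k"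

lemma tpow_add: "tpow f (j + k) = tpow f j \<star> tpow f k"
  by (induction j) (simp_all add: tmul_assoc)

lemma tpow_commute: "f \<star> g = g \<star> f \<Longrightarrow> tpow f k \<star> g = g \<star> tpow f k"
  by (induction k) (simp_all add: tmul_assoc, metis tmul_assoc)

lemma tpow_tmul: "f \<star> g = g \<star> f \<Longrightarrow> tpow (f \<star> g) k = tpow f k \<star> tpow g k"
proof (induction k)
  case (Suc k)
  have "tpow (f \<star> g) (Suc k) = f \<star> (g \<star> tpow f k) \<star> tpow g k"
    using Suc.IH[OF Suc.prems] by (simp only: tpow.simps tmul_assoc)
  also have "g \<star> tpow f k = tpow f k \<star> g" using tpow_commute[OF Suc.prems, of k] by (rule sym)
  finally show ?case by (simp only: tpow.simps tmul_assoc)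
qed simp

lemma tpow_nonzero: "f \<noteq> 0 \<Longrightarrow> tpow f k \<noteq> 0"
  by (induction k) auto

lemma keys_tpow_closed:
  assumes "0 \<in> S" "\<And>a b. a \<in> S \<Longrightarrow> b \<in> S \<Longrightarrow> a + b \<in> S" "keys f \<subseteq> S"
  shows "keys (tpow f k) \<subseteq> S"
proof (induction k)
  case (Suc k)
  then show ?case
    using keys_tmul_closed[of S S S f "tpow f k"] assms by simp
qed (use assms in simp)

text \<open>The iterate is \<open>k\<close> times \<open>a\<close>, written without a scalar multiplication on exponents.\<close>

lemma tpow_single: 
  obtains c' where "tpow (single a c) k = single (((+) a ^^ k) 0) c'" "c \<noteq> 0 \<Longrightarrow> c' \<noteq> 0"
proof -
  have "\<exists>c'. tpow (single a c) k = single (((+) a ^^ k) 0) c' \<and> (c \<noteq> 0 \<longrightarrow> c' \<noteq> 0)"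
  proof (induction k)
    case (Suc k)
    then obtain c' where c': "tpow (single a c) k = single (((+) a ^^ k) 0) c'" "c \<noteq> 0 \<longrightarrow> c' \<noteq> 0" by blast
    show ?case
      by (rule exI[of _ "chi a (((+) a ^^ k) 0) * (c * c')"]) (use c' chi_nonzero in \<open>auto simp: tmul_single\<close>)
  qed (auto intro!: exI[of _ 1] simp flip: single_one)
  then show thesis using that by blast
qed

subsection \<open>Projections onto sets of exponents\<close>

definition proj :: "'e set \<Rightarrow> ('e \<Rightarrow>\<^sub>0 'k) \<Rightarrow> ('e \<Rightarrow>\<^sub>0 'k)" where
  "proj S f = (\<Sum>a\<in>keys f \<inter> S. single a (lookup f a))"

lemma lookup_proj: "lookup (proj S f) a = (if a \<in> S then lookup f a else 0)"
  by (auto simp: proj_def lookup_sum lookup_single when_def in_keys_iff)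

lemma proj_add: "proj S (f + g) = proj S f + proj S g"
  by (intro poly_mapping_eqI) (simp add: lookup_proj lookup_add)

lemma proj_zero [simp]: "proj S 0 = 0"
  by (simp add: proj_def)

lemma proj_sum: "proj S (sum f I) = (\<Sum>i\<in>I. proj S (f i))"
  by (induction I rule: infinite_finite_induct) (simp_all add: proj_add)

lemma proj_single: "proj S (single a c) = (if a \<in> S then single a c else 0)"
  by (intro poly_mapping_eqI) (auto simp: lookup_proj lookup_single when_def)

lemma keys_proj: "keys (proj S f) = keys f \<inter> S"
  by (auto simp: in_keys_iff lookup_proj split: if_splits)

lemma proj_id: "keys f \<subseteq> S \<Longrightarrow> proj S f = f"
  by (intro poly_mapping_eqI) (auto simp: lookup_proj in_keys_iff)

text \<open>The terms of \<open>f \<star> g\<close> and \<open>g \<star> f\<close> with exponents in \<open>S\<close> agree one by one. For the exponents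
  of central monomials this makes the projection onto the centre a trace.\<close>

lemma proj_trace:
  assumes comm: "\<And>a b. a \<in> keys f \<Longrightarrow> b \<in> keys g \<Longrightarrow> a + b \<in> S \<Longrightarrow> chi a b = chi b a"
  shows "proj S (f \<star> g) = proj S (g \<star> f)"
proof -
  have "proj S (f \<star> g) = (\<Sum>a\<in>keys f. \<Sum>b\<in>keys g.
      proj S (single (b + a) (chi b a * (lookup g b * lookup f a))))"
    unfolding tmul_def proj_sum
  proof (intro sum.cong refl)
    fix a b assume ab: "a \<in> keys f" "b \<in> keys g"
    show "proj S (single (a + b) (chi a b * (lookup f a * lookup g b))) =
        proj S (single (b + a) (chi b a * (lookup g b * lookup f a)))"
    proof (cases "a + b \<in> S")
      case True
      then show ?thesis
        using comm[OF ab] by (simp add: add.commute mult.commute)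
    qed (simp add: proj_single add.commute)
  qed
  also have "\<dots> = proj S (g \<star> f)" unfolding tmul_def proj_sum by (rule sum.swap)
  finally show ?thesis .
qed

text \<open>With \<open>S = T\<close> this is linearity over elements whose exponents preserve \<open>S\<close>; with a monomial
  \<open>g\<close> it moves one graded component onto another.\<close>

lemma proj_tmul_right:
  assumes "\<And>a b. b \<in> keys g \<Longrightarrow> a + b \<in> T \<longleftrightarrow> a \<in> S"
  shows "proj T (f \<star> g) = proj S f \<star> g"
proof (induction f rule: single_sum_induct)
  case (single a c)
  have "proj T (single a c \<star> g) = (\<Sum>b\<in>keys g. proj T (single a c \<star> single b (lookup g b)))"
    by (subst (1) sum_single_keys[of g, symmetric]) (simp only: tmul_sum_right proj_sum)
  also have "\<dots> = (\<Sum>b\<in>keys g. proj S (single a c) \<star> single b (lookup g b))"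
    using assms by (intro sum.cong refl) (auto simp: tmul_single proj_single)
  also have "\<dots> = proj S (single a c) \<star> g"
    by (subst (3) sum_single_keys[of g, symmetric]) (simp only: tmul_sum_right)
  finally show ?case .
qed (simp_all add: proj_add tmul_add_left)

lemma proj_tmul_left:
  assumes "\<And>a b. b \<in> keys g \<Longrightarrow> b + a \<in> T \<longleftrightarrow> a \<in> S"
  shows "proj T (g \<star> f) = g \<star> proj S f"
proof (induction f rule: single_sum_induct)
  case (single a c)
  have "proj T (g \<star> single a c) = (\<Sum>b\<in>keys g. proj T (single b (lookup g b) \<star> single a c))"
    by (subst (1) sum_single_keys[of g, symmetric]) (simp only: tmul_sum_left proj_sum)
  also have "\<dots> = (\<Sum>b\<in>keys g. single b (lookup g b) \<star> proj S (single a c))"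
    using assms by (intro sum.cong refl) (auto simp: tmul_single proj_single)
  also have "\<dots> = g \<star> proj S (single a c)"
    by (subst (3) sum_single_keys[of g, symmetric]) (simp only: tmul_sum_left)
  finally show ?case .
qed (simp_all add: proj_add tmul_add_right)

subsection \<open>The algebra spanned by a monoid of exponents\<close>

definition monoid_alg :: "'e set \<Rightarrow> ('k, 'e \<Rightarrow>\<^sub>0 'k) module" where
  "monoid_alg S =
     \<lparr>carrier = {f. keys f \<subseteq> S}, mult = tmul, one = 1, zero = 0, add = (+),
      smult = \<lambda>c f. single 0 c \<star> f\<rparr>"

lemma monoid_alg_simps [simp]:
  "carrier (monoid_alg S) = {f. keys f \<subseteq> S}"
  "f \<otimes>\<^bsub>monoid_alg S\<^esub> g = f \<star> g" "\<one>\<^bsub>monoid_alg S\<^esub> = 1"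
  "\<zero>\<^bsub>monoid_alg S\<^esub> = 0" "f \<oplus>\<^bsub>monoid_alg S\<^esub> g = f + g" "c \<odot>\<^bsub>monoid_alg S\<^esub> f = single 0 c \<star> f"
  by (simp_all add: monoid_alg_def)

lemma ring_monoid_alg:
  assumes "0 \<in> S" "\<And>a b. a \<in> S \<Longrightarrow> b \<in> S \<Longrightarrow> a + b \<in> S"
  shows "ring (monoid_alg S)"
proof (rule ringI)
  show "abelian_group (monoid_alg S)"
  proof (rule abelian_groupI)
    fix f assume "f \<in> carrier (monoid_alg S)"
    then show "\<exists>g\<in>carrier (monoid_alg S). g \<oplus>\<^bsub>monoid_alg S\<^esub> f = \<zero>\<^bsub>monoid_alg S\<^esub>"
      by (intro bexI[of _ "- f"]) auto
  qed (auto simp: add_ac dest!: subsetD[OF keys_add])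
  show "Group.monoid (monoid_alg S)"
    by (rule monoidI) (use assms in \<open>auto simp: tmul_assoc dest: subsetD[OF keys_tmul_closed[OF assms(2)], rotated -1]\<close>)
qed (simp_all add: tmul_add_left tmul_add_right)

end

section \<open>Group-theoretic criteria\<close>

lemma reduced_words_Nil [simp]: "[] \<in> reduced_words B"
  by (simp add: reduced_words_def)

lemma reduced_words_Cons:
  "x # w \<in> reduced_words B \<longleftrightarrow>
     fst x \<in> B \<and> w \<in> reduced_words B \<and> (w = [] \<or> \<not> (fst x = fst (hd w) \<and> snd x \<noteq> snd (hd w)))"
proof (cases w)
  case Nil
  then show ?thesis by (simp add: reduced_words_def)
next
  case (Cons y w')
  have "(\<forall>i. Suc i < length (x # w) \<longrightarrow> P ((x # w) ! i) ((x # w) ! Suc i)) \<longleftrightarrow>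
      P x y \<and> (\<forall>i. Suc i < length w \<longrightarrow> P (w ! i) (w ! Suc i))" for P
    using Cons by (auto simp: nth_Cons split: nat.splits)
  from this[of "\<lambda>u v. \<not> (fst u = fst v \<and> snd u \<noteq> snd v)"] show ?thesis
    using Cons by (auto simp: reduced_words_def)
qed

lemma reduced_words_append:
  assumes "u \<in> reduced_words B" "w \<in> reduced_words B"
    and "u \<noteq> [] \<Longrightarrow> w \<noteq> [] \<Longrightarrow> \<not> (fst (last u) = fst (hd w) \<and> snd (last u) \<noteq> snd (hd w))"
  shows "u @ w \<in> reduced_words B"
  using assms
proof (induction u)
  case (Cons x u)
  then show ?case by (cases u) (auto simp: reduced_words_Cons)
qed simp

lemma reduced_words_snocD:
  assumes "u @ [x] \<in> reduced_words B"
  shows "u \<in> reduced_words B" "fst x \<in> B"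
    "u \<noteq> [] \<Longrightarrow> \<not> (fst (last u) = fst x \<and> snd (last u) \<noteq> snd x)"
proof -
  have "u \<in> reduced_words B \<and> fst x \<in> B \<and> (u \<noteq> [] \<longrightarrow> \<not> (fst (last u) = fst x \<and> snd (last u) \<noteq> snd x))"
    using assms by (induction u) (auto simp: reduced_words_Cons)
  then show "u \<in> reduced_words B" "fst x \<in> B"
    "u \<noteq> [] \<Longrightarrow> \<not> (fst (last u) = fst x \<and> snd (last u) \<noteq> snd x)" by auto
qed

definition inverse_word :: "('g \<times> bool) list \<Rightarrow> ('g \<times> bool) list" where
  "inverse_word w = rev (map (\<lambda>(x, e). (x, \<not> e)) w)"

lemma inverse_word_reduced: "w \<in> reduced_words B \<Longrightarrow> inverse_word w \<in> reduced_words B"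
proof (induction w)
  case (Cons x w)
  have "inverse_word w @ [(fst x, \<not> snd x)] \<in> reduced_words B"
  proof (rule reduced_words_append)
    assume "inverse_word w \<noteq> []"
    then have "w \<noteq> []" by (simp add: inverse_word_def)
    then have "last (inverse_word w) = (fst (hd w), \<not> snd (hd w))"
      by (cases w) (auto simp: inverse_word_def split: prod.splits)
    with Cons.prems \<open>w \<noteq> []\<close>
    show "\<not> (fst (last (inverse_word w)) = fst (hd [(fst x, \<not> snd x)]) \<and>
        snd (last (inverse_word w)) \<noteq> snd (hd [(fst x, \<not> snd x)]))"
      by (auto simp: reduced_words_Cons)
  qed (use Cons in \<open>auto simp: reduced_words_Cons\<close>)
  then show ?case by (simp add: inverse_word_def case_prod_beta)
qed (simp add: inverse_word_def)

context group
begin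

lemma word_eval_closed: "fst ` set w \<subseteq> carrier G \<Longrightarrow> word_eval G w \<in> carrier G"
  by (induction w) auto

lemma word_eval_append:
  "fst ` set u \<subseteq> carrier G \<Longrightarrow> fst ` set w \<subseteq> carrier G \<Longrightarrow>
     word_eval G (u @ w) = word_eval G u \<otimes> word_eval G w"
  by (induction u) (auto simp: word_eval_closed m_assoc)

lemma word_eval_inverse:
  "fst ` set w \<subseteq> carrier G \<Longrightarrow> word_eval G (inverse_word w) = inv (word_eval G w)"
proof (induction w)
  case (Cons x w)
  have w: "fst ` set (inverse_word w) \<subseteq> carrier G" "fst ` set w \<subseteq> carrier G" "fst x \<in> carrier G"
    using Cons.prems by (auto simp: inverse_word_def)
  have "word_eval G (inverse_word (x # w)) = word_eval G (inverse_word w @ [(fst x, \<not> snd x)])"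
    by (simp add: inverse_word_def case_prod_beta)
  also have "\<dots> = inv (word_eval G w) \<otimes> word_eval G [(fst x, \<not> snd x)]"
    using w Cons.IH by (subst word_eval_append) auto
  also have "word_eval G [(fst x, \<not> snd x)] = inv (if snd x then fst x else inv (fst x))"
    using w by simp
  also have "inv (word_eval G w) \<otimes> \<dots> = inv (word_eval G (x # w))"
    using w word_eval_closed[of w] by (cases x) (auto simp: inv_mult_group)
  finally show ?case .
qed (simp add: inverse_word_def)

lemma ex_reduced_word:
  assumes "fst ` set w \<subseteq> B" "B \<subseteq> carrier G"
  obtains u where "u \<in> reduced_words B" "word_eval G u = word_eval G w"
proof -
  have "\<exists>u \<in> reduced_words B. word_eval G u = word_eval G w"
    using assms(1)
  proof (induction w)
    case (Cons x w)
    then obtain u where u: "u \<in> reduced_words B" "word_eval G u = word_eval G w" by auto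
    show ?case
    proof (cases "u = [] \<or> \<not> (fst x = fst (hd u) \<and> snd x \<noteq> snd (hd u))")
      case True
      then have "x # u \<in> reduced_words B"
        using u Cons.prems by (simp add: reduced_words_Cons)
      then show ?thesis using u by (intro bexI[of _ "x # u"]) (cases x, simp_all)
    next
      case False
      then obtain u' where u': "u = (fst x, \<not> snd x) # u'" by (cases u) auto
      have "u' \<in> reduced_words B" using u(1) by (simp add: u' reduced_words_Cons)
      moreover from this have "word_eval G u' \<in> carrier G" "fst x \<in> carrier G"
        using assms(2) Cons.prems by (auto intro!: word_eval_closed simp: reduced_words_def)
      then have "word_eval G u' = word_eval G (x # w)"
        by (cases x) (auto simp: u' simp flip: u(2) m_assoc)
      ultimately show ?thesis by blast
    qed
  qed (auto intro: bexI[of _ "[]"])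
  then show thesis using that by blast
qed

text \<open>The values of the reduced words form a subgroup, since every word can be reduced. If two
  distinct reduced words had the same value, then, after removal of a common prefix, the inverse of
  one followed by the other would be a nonempty reduced word of value one.\<close>

lemma contains_free_rank_2I:
  assumes ab: "a \<in> carrier G" "b \<in> carrier G" "a \<noteq> b"
    and nontriv: "\<And>w. w \<in> reduced_words {a, b} \<Longrightarrow> w \<noteq> [] \<Longrightarrow> word_eval G w \<noteq> \<one>"
  shows "contains_free_rank_2 G"
proof -
  let ?B = "{a, b}"
  define H where "H = word_eval G ` reduced_words ?B"
  have carr: "fst ` set w \<subseteq> carrier G" if "w \<in> reduced_words ?B" for w
    using that ab by (auto simp: reduced_words_def)
  have H: "subgroup H G"
  proof (rule subgroupI)
    show "H \<subseteq> carrier G" using word_eval_closed carr by (auto simp: H_def)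
    show "H \<noteq> {}" unfolding H_def using reduced_words_Nil by blast
    show "inv h \<in> H" if "h \<in> H" for h
      using that unfolding H_def
      by (auto simp flip: word_eval_inverse[OF carr] intro: inverse_word_reduced)
    show "h \<otimes> h' \<in> H" if "h \<in> H" "h' \<in> H" for h h'
    proof -
      obtain u w where uw: "u \<in> reduced_words ?B" "w \<in> reduced_words ?B"
          "h = word_eval G u" "h' = word_eval G w"
        using \<open>h \<in> H\<close> \<open>h' \<in> H\<close> unfolding H_def by blast
      then have "h \<otimes> h' = word_eval G (u @ w)" using carr by (simp add: word_eval_append)
      moreover have "fst ` set (u @ w) \<subseteq> ?B" using uw unfolding reduced_words_def by auto
      then obtain t where "t \<in> reduced_words ?B" "word_eval G t = word_eval G (u @ w)"
        using ex_reduced_word[of "u @ w" ?B] ab by blast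
      ultimately show ?thesis unfolding H_def by (metis imageI)
    qed
  qed
  have inj: "u = w" if "u \<in> reduced_words ?B" "w \<in> reduced_words ?B" "word_eval G u = word_eval G w"
    for u w
    using that
  proof (induction u arbitrary: w)
    case Nil
    then show ?case using nontriv[of w] by (cases w) auto
  next
    case (Cons x u)
    show ?case
    proof (cases w)
      case Nil
      then show ?thesis using nontriv[OF Cons.prems(1)] Cons.prems(3) by simp
    next
      case w: (Cons y w')
      have red: "u \<in> reduced_words ?B" "w' \<in> reduced_words ?B" "fst x \<in> carrier G"
        using Cons.prems ab unfolding w by (auto simp: reduced_words_Cons)
      show ?thesis
      proof (cases "x = y")
        case True
        then have "word_eval G u = word_eval G w'"
          using Cons.prems(3) red word_eval_closed carr unfolding w
          by (cases y) (auto split: if_splits)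
        then show ?thesis using Cons.IH red True w by blast
      next
        case False
        \<comment> \<open>Two words with the same value and different first letters give a nonempty reduced
          word of value one.\<close>
        have "inverse_word (x # u) @ w \<in> reduced_words ?B"
        proof (rule reduced_words_append)
          show "\<not> (fst (last (inverse_word (x # u))) = fst (hd w) \<and>
              snd (last (inverse_word (x # u))) \<noteq> snd (hd w))"
            using False by (auto simp: inverse_word_def w case_prod_beta prod_eq_iff)
        qed (use Cons.prems inverse_word_reduced in blast)+
        moreover have "word_eval G (inverse_word (x # u) @ w) = \<one>"
          using Cons.prems carr[OF Cons.prems(1)] carr[OF Cons.prems(2)]
            carr[OF inverse_word_reduced[OF Cons.prems(1)]]
          by (simp only: word_eval_append word_eval_inverse) (simp add: word_eval_closed l_inv)
        ultimately show ?thesis using nontriv w by blast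
      qed
    qed
  qed
  have eval: "word_eval (G\<lparr>carrier := H\<rparr>) w = word_eval G w" if "w \<in> reduced_words ?B" for w
    using that
  proof (induction w)
    case (Cons x w)
    have "word_eval G [(fst x, True)] \<in> H"
      using Cons.prems unfolding H_def by (intro imageI) (simp add: reduced_words_Cons)
    then have "fst x \<in> H" using carr[OF Cons.prems] by simp
    then have "inv\<^bsub>G\<lparr>carrier := H\<rparr>\<^esub> (fst x) = inv (fst x)"
      using m_inv_consistent[OF H] by blast
    then show ?case using Cons by (cases x) (auto simp: reduced_words_Cons)
  qed simp
  have "?B \<subseteq> H"
  proof
    fix x assume "x \<in> ?B"
    then have "word_eval G [(x, True)] \<in> H" unfolding H_def
      by (intro imageI) (simp add: reduced_words_Cons)
    then show "x \<in> H" using \<open>x \<in> ?B\<close> ab by auto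
  qed
  moreover have "bij_betw (word_eval (G\<lparr>carrier := H\<rparr>)) (reduced_words ?B) H"
    using inj eval by (auto simp: bij_betw_def H_def inj_on_def image_iff) 
  ultimately have "free_basis (G\<lparr>carrier := H\<rparr>) ?B" by (simp add: free_basis_def)
  then show ?thesis using H ab(3) unfolding contains_free_rank_2_def by (metis card_2_iff)
qed

end

lemma hom_word_eval:
  assumes "group_hom G H h" "fst ` set w \<subseteq> carrier G"
  shows "h (word_eval G w) = word_eval H (map (apfst h) w)"
proof -
  interpret group_hom G H h by fact
  show ?thesis using assms(2)
  proof (induction w)
    case (Cons x w)
    then show ?case using G.word_eval_closed[of w] by (cases x) auto
  qed simp
qed

text \<open>Preimages of a free pair form a free pair, because \<open>h\<close> maps reduced words to reduced words.\<close>

lemma contains_free_rank_2_lift: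
  assumes h: "group_hom G H h" and surj: "h ` carrier G = carrier H"
    and ab: "a \<in> carrier H" "b \<in> carrier H" "a \<noteq> b"
    and nontriv: "\<And>w. w \<in> reduced_words {a, b} \<Longrightarrow> w \<noteq> [] \<Longrightarrow> word_eval H w \<noteq> \<one>\<^bsub>H\<^esub>"
  shows "contains_free_rank_2 G"
proof -
  interpret group_hom G H h by fact
  obtain a' where a': "a = h a'" "a' \<in> carrier G"
    using ab(1) unfolding surj[symmetric] by (rule imageE)
  obtain b' where b': "b = h b'" "b' \<in> carrier G"
    using ab(2) unfolding surj[symmetric] by (rule imageE)
  note ab' = a'(2) b'(2) a'(1)[symmetric] b'(1)[symmetric]
  show ?thesis
  proof (rule G.contains_free_rank_2I)
    fix w assume w: "w \<in> reduced_words {a', b'}" "w \<noteq> []"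
    have inj: "u = u'" if "u \<in> {a', b'}" "u' \<in> {a', b'}" "h u = h u'" for u u'
      using that ab' ab(3) by (elim insertE emptyE) simp_all
    have "map (apfst h) w \<in> reduced_words {a, b}"
      using w(1)
    proof (induction w)
      case (Cons x w)
      then have x: "fst x \<in> {a', b'}" and w: "w \<in> reduced_words {a', b'}"
        and IH: "map (apfst h) w \<in> reduced_words {a, b}"
        and ne: "w = [] \<or> \<not> (fst x = fst (hd w) \<and> snd x \<noteq> snd (hd w))"
        by (simp_all only: reduced_words_Cons)
      have "h (fst x) \<in> {a, b}" using x ab'(3,4) by (elim insertE emptyE) simp_all
      moreover have "w = [] \<or> \<not> (h (fst x) = h (fst (hd w)) \<and> snd x \<noteq> snd (hd w))"
      proof (cases w)
        case (Cons y w')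
        then have "fst y \<in> {a', b'}" using w by (simp only: reduced_words_Cons)
        then show ?thesis using inj[OF x] ne Cons by auto
      qed simp
      ultimately show ?case using IH by (cases w) (simp_all add: reduced_words_Cons)
    qed simp
    then have "word_eval H (map (apfst h) w) \<noteq> \<one>\<^bsub>H\<^esub>" using nontriv w(2) by auto
    moreover have "fst ` set w \<subseteq> carrier G" using w(1) ab' unfolding reduced_words_def by auto
    ultimately have "h (word_eval G w) \<noteq> \<one>\<^bsub>H\<^esub>" by (simp add: hom_word_eval[OF h])
    then show "word_eval G w \<noteq> \<one>\<^bsub>G\<^esub>" by (metis hom_one)
  qed (use ab ab' in auto)
qed

lemma (in comm_group) solvable: "solvable G"
proof -
  have "comm_group (G Mod {\<one>})"
    by (intro abelian_FactGroup triv_subgroup)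
  then have "solvable_seq G (carrier G)"
    using solvable_seq.extension[OF solvable_seq.unity, of G "carrier G"] one_is_normal subgroup_self
    by simp
  then show ?thesis by (simp add: solvable_def)
qed

text \<open>The kernel is abelian, and the quotient by it is in bijection with the image of \<open>h\<close>.\<close>

lemma virtually_solvableI:
  assumes h: "group_hom G H h" and fin: "finite (h ` carrier G)"
    and comm: "\<And>x y. x \<in> kernel G H h \<Longrightarrow> y \<in> kernel G H h \<Longrightarrow> x \<otimes>\<^bsub>G\<^esub> y = y \<otimes>\<^bsub>G\<^esub> x"
  shows "virtually_solvable G"
proof -
  interpret group_hom G H h by fact
  let ?N = "kernel G H h"
  have N: "?N \<lhd> G" by (rule normal_kernel)
  have "group (G\<lparr>carrier := ?N\<rparr>)"
    by (intro subgroup.subgroup_is_group subgroup_kernel G.is_group)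
  then have "comm_group (G\<lparr>carrier := ?N\<rparr>)"
    by (rule group.group_comm_groupI) (simp add: comm)
  then have "solvable (G\<lparr>carrier := ?N\<rparr>)"
    by (rule comm_group.solvable)
  moreover have "finite (carrier (G Mod ?N))"
  proof (rule inj_on_finite[OF FactGroup_inj_on _ fin])
    show "(\<lambda>X. the_elem (h ` X)) ` carrier (G Mod ?N) \<subseteq> h ` carrier G"
    proof (rule image_subsetI)
      fix X assume "X \<in> carrier (G Mod ?N)"
      then obtain g where g: "g \<in> carrier G" "X = ?N #>\<^bsub>G\<^esub> g" by (auto simp: carrier_FactGroup)
      then have "h ` X = {h g}"
        using G.one_closed by (force simp: r_coset_def kernel_def)
      then show "the_elem (h ` X) \<in> h ` carrier G" using g by simp
    qed
  qed
  ultimately show ?thesis unfolding virtually_solvable_def using N by blast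
qed

section \<open>Automorphism groups of isomorphic algebras\<close>

text \<open>Closure under the operations makes the inverse of a bijective homomorphism a homomorphism,
  and hence the automorphisms a group.\<close>

definition alg_closed :: "('k::field, 'a) module \<Rightarrow> bool" where
  "alg_closed A \<longleftrightarrow>
     \<one>\<^bsub>A\<^esub> \<in> carrier A \<and>
     (\<forall>x\<in>carrier A. \<forall>y\<in>carrier A. x \<otimes>\<^bsub>A\<^esub> y \<in> carrier A \<and> x \<oplus>\<^bsub>A\<^esub> y \<in> carrier A) \<and>
     (\<forall>c. \<forall>x\<in>carrier A. c \<odot>\<^bsub>A\<^esub> x \<in> carrier A)"

lemma alg_homI:
  assumes "\<And>x. x \<in> carrier A \<Longrightarrow> h x \<in> carrier B"
    "\<And>x y. x \<in> carrier A \<Longrightarrow> y \<in> carrier A \<Longrightarrow> h (x \<otimes>\<^bsub>A\<^esub> y) = h x \<otimes>\<^bsub>B\<^esub> h y"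
    "\<And>x y. x \<in> carrier A \<Longrightarrow> y \<in> carrier A \<Longrightarrow> h (x \<oplus>\<^bsub>A\<^esub> y) = h x \<oplus>\<^bsub>B\<^esub> h y"
    "h \<one>\<^bsub>A\<^esub> = \<one>\<^bsub>B\<^esub>" "\<And>c x. x \<in> carrier A \<Longrightarrow> h (c \<odot>\<^bsub>A\<^esub> x) = c \<odot>\<^bsub>B\<^esub> h x"
  shows "h \<in> alg_hom A B"
  using assms by (simp add: alg_hom_def ring_hom_def)

lemma alg_homD:
  assumes "h \<in> alg_hom A B"
  shows "\<And>x. x \<in> carrier A \<Longrightarrow> h x \<in> carrier B"
    "\<And>x y. x \<in> carrier A \<Longrightarrow> y \<in> carrier A \<Longrightarrow> h (x \<otimes>\<^bsub>A\<^esub> y) = h x \<otimes>\<^bsub>B\<^esub> h y"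
    "\<And>x y. x \<in> carrier A \<Longrightarrow> y \<in> carrier A \<Longrightarrow> h (x \<oplus>\<^bsub>A\<^esub> y) = h x \<oplus>\<^bsub>B\<^esub> h y"
    "h \<one>\<^bsub>A\<^esub> = \<one>\<^bsub>B\<^esub>" "\<And>c x. x \<in> carrier A \<Longrightarrow> h (c \<odot>\<^bsub>A\<^esub> x) = c \<odot>\<^bsub>B\<^esub> h x"
  using assms by (auto simp: alg_hom_def ring_hom_def)

lemma alg_hom_compose:
  assumes "h \<in> alg_hom A B" "g \<in> alg_hom B C"
  shows "(\<lambda>x. g (h x)) \<in> alg_hom A C"
  using alg_homD[OF assms(1)] alg_homD[OF assms(2)] by (intro alg_homI) simp_all

lemma alg_hom_restrict:
  assumes "alg_closed A" "h \<in> alg_hom A B"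
  shows "restrict h (carrier A) \<in> alg_hom A B"
  using assms(1) alg_homD[OF assms(2)] by (intro alg_homI) (auto simp: alg_closed_def)

lemma alg_hom_inv_into:
  assumes "alg_closed A" "h \<in> alg_hom A B" "bij_betw h (carrier A) (carrier B)"
  shows "inv_into (carrier A) h \<in> alg_hom B A"
proof (rule alg_homI)
  note h = alg_homD[OF assms(2)]
  let ?g = "inv_into (carrier A) h"
  have g: "?g y \<in> carrier A" "h (?g y) = y" if "y \<in> carrier B" for y
    using that assms(3) by (auto simp: bij_betw_def f_inv_into_f inv_into_into)
  have gI: "?g y = x" if "h x = y" "x \<in> carrier A" for x y
    using that assms(3) by (auto simp: bij_betw_def)
  show "?g y \<in> carrier A" if "y \<in> carrier B" for y using g that by blast
  show "?g (x \<otimes>\<^bsub>B\<^esub> y) = ?g x \<otimes>\<^bsub>A\<^esub> ?g y" if "x \<in> carrier B" "y \<in> carrier B" for x y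
    using that assms(1) g h by (intro gI) (simp_all add: alg_closed_def)
  show "?g (x \<oplus>\<^bsub>B\<^esub> y) = ?g x \<oplus>\<^bsub>A\<^esub> ?g y" if "x \<in> carrier B" "y \<in> carrier B" for x y
    using that assms(1) g h by (intro gI) (simp_all add: alg_closed_def)
  show "?g (c \<odot>\<^bsub>B\<^esub> x) = c \<odot>\<^bsub>A\<^esub> ?g x" if "x \<in> carrier B" for c x
    using that assms(1) g h by (intro gI) (simp_all add: alg_closed_def)
  show "?g \<one>\<^bsub>B\<^esub> = \<one>\<^bsub>A\<^esub>"
    using assms(1) h by (intro gI) (simp_all add: alg_closed_def)
qed

lemma carrier_alg_Aut: "carrier (alg_Aut A) = alg_hom A A \<inter> Bij (carrier A)"
  by (simp add: alg_Aut_def)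

lemma mult_alg_Aut:
  "f \<in> carrier (alg_Aut A) \<Longrightarrow> g \<in> carrier (alg_Aut A) \<Longrightarrow>
     f \<otimes>\<^bsub>alg_Aut A\<^esub> g = compose (carrier A) f g"
  by (simp add: alg_Aut_def BijGroup_def)

lemma one_alg_Aut: "\<one>\<^bsub>alg_Aut A\<^esub> = (\<lambda>x\<in>carrier A. x)"
  by (simp add: alg_Aut_def BijGroup_def)

lemma alg_hom_compose_restrict:
  assumes "alg_closed A" "f \<in> alg_hom A A" "g \<in> alg_hom A A"
  shows "compose (carrier A) f g \<in> alg_hom A A"
  unfolding compose_def by (rule alg_hom_restrict[OF assms(1) alg_hom_compose[OF assms(3,2)]])

lemma group_alg_Aut:
  assumes "alg_closed A"
  shows "group (alg_Aut A)"
proof -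
  have "subgroup (alg_hom A A \<inter> Bij (carrier A)) (BijGroup (carrier A))"
  proof (rule subgroup.intro)
    fix f assume f: "f \<in> alg_hom A A \<inter> Bij (carrier A)"
    then have f': "f \<in> alg_hom A A" "f \<in> Bij (carrier A)" "bij_betw f (carrier A) (carrier A)"
      by (simp_all add: Bij_def)
    have "restrict (inv_into (carrier A) f) (carrier A) \<in> alg_hom A A \<inter> Bij (carrier A)"
      by (intro IntI alg_hom_restrict alg_hom_inv_into restrict_inv_into_Bij assms f')
    then show "inv\<^bsub>BijGroup (carrier A)\<^esub> f \<in> alg_hom A A \<inter> Bij (carrier A)"
      using f by (simp add: inv_BijGroup)
  next
    have "(\<lambda>x\<in>carrier A. x) \<in> alg_hom A A"
      by (rule alg_hom_restrict[OF assms alg_homI]) simp_all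
    then show "\<one>\<^bsub>BijGroup (carrier A)\<^esub> \<in> alg_hom A A \<inter> Bij (carrier A)"
      by (simp add: BijGroup_def id_Bij)
  next
    fix f g assume "f \<in> alg_hom A A \<inter> Bij (carrier A)" "g \<in> alg_hom A A \<inter> Bij (carrier A)"
    then show "f \<otimes>\<^bsub>BijGroup (carrier A)\<^esub> g \<in> alg_hom A A \<inter> Bij (carrier A)"
      by (simp add: BijGroup_def compose_Bij alg_hom_compose_restrict[OF assms])
  qed (simp add: BijGroup_def)
  then show ?thesis
    unfolding alg_Aut_def by (rule subgroup.subgroup_is_group[OF _ group_BijGroup])
qed

lemma alg_AutI:
  assumes "f \<in> alg_hom A A" "f \<in> extensional (carrier A)"
    and "\<And>x. x \<in> carrier A \<Longrightarrow> g x \<in> carrier A" "\<And>x. x \<in> carrier A \<Longrightarrow> f (g x) = x"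
    "\<And>x. x \<in> carrier A \<Longrightarrow> g (f x) = x"
  shows "f \<in> carrier (alg_Aut A)"
proof -
  have "bij_betw f (carrier A) (carrier A)"
    by (intro bij_betwI[of _ _ _ g] funcsetI alg_homD(1)[OF assms(1)] assms(3-5))
  then show ?thesis using assms by (simp add: carrier_alg_Aut Bij_def)
qed

text \<open>The isomorphism is conjugation by \<open>h\<close>.\<close>

lemma alg_Aut_iso:
  assumes A: "alg_closed A" and B: "alg_closed B"
    and h: "h \<in> alg_hom A B" "bij_betw h (carrier A) (carrier B)"
  obtains c where "group_hom (alg_Aut A) (alg_Aut B) c"
    "c ` carrier (alg_Aut A) = carrier (alg_Aut B)" "inj_on c (carrier (alg_Aut A))"
proof -
  define g where "g = inv_into (carrier A) h"
  have g: "g \<in> alg_hom B A" using alg_hom_inv_into[OF A h] by (simp add: g_def)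
  have gh: "g (h x) = x" if "x \<in> carrier A" for x
    using h(2) that by (simp add: g_def bij_betw_def)
  have hg: "h (g y) = y" if "y \<in> carrier B" for y
    using h(2) that by (simp add: g_def bij_betw_def f_inv_into_f)
  define c where "c f = (\<lambda>y\<in>carrier B. h (f (g y)))" for f
  define d where "d f = (\<lambda>x\<in>carrier A. g (f (h x)))" for f
  note closed = alg_homD(1)[OF h(1)] alg_homD(1)[OF g]
  have AutD: "f \<in> alg_hom C C" "f \<in> extensional (carrier C)" "bij_betw f (carrier C) (carrier C)"
    "\<And>x. x \<in> carrier C \<Longrightarrow> f x \<in> carrier C"
    if "f \<in> carrier (alg_Aut C)" for f and C :: "('m::field, 'n) module"
    using that alg_homD(1)[of f C C] by (auto simp: carrier_alg_Aut Bij_def)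
  have c: "c f \<in> carrier (alg_Aut B)" if "f \<in> carrier (alg_Aut A)" for f
  proof (rule alg_AutI)
    show "c f \<in> alg_hom B B"
      unfolding c_def by (intro alg_hom_restrict B alg_hom_compose[OF _ h(1)] alg_hom_compose[OF g] AutD that)
    fix y assume "y \<in> carrier B"
    note y = this closed AutD(4)[OF that] AutD(3)[OF that, unfolded bij_betw_def] inv_into_into[of _ f "carrier A"]
    show "h (inv_into (carrier A) f (g y)) \<in> carrier B" using y by simp
    show "c f (h (inv_into (carrier A) f (g y))) = y" using y by (simp add: c_def gh hg f_inv_into_f)
    show "h (inv_into (carrier A) f (g (c f y))) = y" using y by (simp add: c_def gh hg)
  qed (simp add: c_def)
  have d: "d f \<in> carrier (alg_Aut A)" if "f \<in> carrier (alg_Aut B)" for f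
  proof (rule alg_AutI)
    show "d f \<in> alg_hom A A"
      unfolding d_def by (intro alg_hom_restrict A alg_hom_compose[OF _ g] alg_hom_compose[OF h(1)] AutD that)
    fix y assume "y \<in> carrier A"
    note y = this closed AutD(4)[OF that] AutD(3)[OF that, unfolded bij_betw_def] inv_into_into[of _ f "carrier B"]
    show "g (inv_into (carrier B) f (h y)) \<in> carrier A" using y by simp
    show "d f (g (inv_into (carrier B) f (h y))) = y" using y by (simp add: d_def gh hg f_inv_into_f)
    show "g (inv_into (carrier B) f (h (d f y))) = y" using y by (simp add: d_def gh hg)
  qed (simp add: d_def)
  have cd: "c (d f) = f" if "f \<in> carrier (alg_Aut B)" for f
    using AutD(2,4)[OF that] closed by (intro extensionalityI[of _ "carrier B"]) (auto simp: c_def d_def hg)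
  have dc: "d (c f) = f" if "f \<in> carrier (alg_Aut A)" for f
    using AutD(2,4)[OF that] closed by (intro extensionalityI[of _ "carrier A"]) (auto simp: c_def d_def gh)
  show thesis
  proof (rule that)
    show "group_hom (alg_Aut A) (alg_Aut B) c"
    proof (intro group_hom.intro group_alg_Aut A B group_hom_axioms.intro homI c)
      fix f f' assume f: "f \<in> carrier (alg_Aut A)" "f' \<in> carrier (alg_Aut A)"
      then show "c (f \<otimes>\<^bsub>alg_Aut A\<^esub> f') = c f \<otimes>\<^bsub>alg_Aut B\<^esub> c f'"
        using AutD(4)[OF f(1)] AutD(4)[OF f(2)] closed
        by (simp only: mult_alg_Aut[OF f] mult_alg_Aut[OF c c, OF f])
           (auto simp: c_def compose_def gh restrict_def fun_eq_iff)
    qed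
    show "c ` carrier (alg_Aut A) = carrier (alg_Aut B)"
      using c d cd by (auto intro!: image_eqI[of _ c "d _"] simp: )
    show "inj_on c (carrier (alg_Aut A))" by (rule inj_on_inverseI[of _ d]) (rule dc)
  qed
qed

lemma alg_Aut_virtually_solvableI:
  assumes "alg_closed A" "alg_closed B" "h \<in> alg_hom A B" "bij_betw h (carrier A) (carrier B)"
    and f: "group_hom (alg_Aut B) Q f" and fin: "finite (f ` carrier (alg_Aut B))"
    and comm: "\<And>x y. x \<in> kernel (alg_Aut B) Q f \<Longrightarrow> y \<in> kernel (alg_Aut B) Q f \<Longrightarrow>
      x \<otimes>\<^bsub>alg_Aut B\<^esub> y = y \<otimes>\<^bsub>alg_Aut B\<^esub> x"
  shows "virtually_solvable (alg_Aut A)"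
proof -
  obtain c where c: "group_hom (alg_Aut A) (alg_Aut B) c"
    "c ` carrier (alg_Aut A) = carrier (alg_Aut B)" "inj_on c (carrier (alg_Aut A))"
    by (rule alg_Aut_iso[OF assms(1-4)])
  interpret c: group_hom "alg_Aut A" "alg_Aut B" c by fact
  interpret f: group_hom "alg_Aut B" Q f by fact
  show ?thesis
  proof (rule virtually_solvableI)
    show "group_hom (alg_Aut A) Q (f \<circ> c)"
      by (intro group_hom.intro group_hom_axioms.intro c.G.is_group f.H.is_group
            hom_compose[OF c.homh f.homh])
    show "finite ((f \<circ> c) ` carrier (alg_Aut A))"
      using fin by (simp only: image_comp[symmetric] c(2))
    fix x y assume xy: "x \<in> kernel (alg_Aut A) Q (f \<circ> c)" "y \<in> kernel (alg_Aut A) Q (f \<circ> c)"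
    then have k: "x \<in> carrier (alg_Aut A)" "y \<in> carrier (alg_Aut A)"
      "c x \<in> kernel (alg_Aut B) Q f" "c y \<in> kernel (alg_Aut B) Q f"
      by (auto simp: kernel_def)
    then have "c (x \<otimes>\<^bsub>alg_Aut A\<^esub> y) = c (y \<otimes>\<^bsub>alg_Aut A\<^esub> x)"
      using comm by simp
    then show "x \<otimes>\<^bsub>alg_Aut A\<^esub> y = y \<otimes>\<^bsub>alg_Aut A\<^esub> x"
      using c(3) k by (simp add: inj_on_def)
  qed
qed

lemma alg_Aut_contains_free_rank_2I:
  assumes "alg_closed A" "alg_closed B" "h \<in> alg_hom A B" "bij_betw h (carrier A) (carrier B)"
    and "a \<in> carrier (alg_Aut B)" "b \<in> carrier (alg_Aut B)" "a \<noteq> b"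
    and "\<And>w. w \<in> reduced_words {a, b} \<Longrightarrow> w \<noteq> [] \<Longrightarrow> word_eval (alg_Aut B) w \<noteq> \<one>\<^bsub>alg_Aut B\<^esub>"
  shows "contains_free_rank_2 (alg_Aut A)"
proof -
  obtain c where c: "group_hom (alg_Aut A) (alg_Aut B) c"
    "c ` carrier (alg_Aut A) = carrier (alg_Aut B)" "inj_on c (carrier (alg_Aut A))"
    by (rule alg_Aut_iso[OF assms(1-4)])
  show ?thesis
    by (rule contains_free_rank_2_lift[OF c(1,2) assms(5-8)])
qed

section \<open>Quantum polynomial algebras have a basis of ordered monomials\<close>

subsection \<open>Words\<close>

lemma free_alg_zero: "\<zero>\<^bsub>free_alg B\<^esub> = (\<lambda>w. 0)"
  and free_alg_one: "\<one>\<^bsub>free_alg B\<^esub> = (\<lambda>w. if w = [] then 1 else 0)"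
  and free_alg_add: "f \<oplus>\<^bsub>free_alg B\<^esub> g = (\<lambda>w. f w + g w)"
  and free_alg_mult: "f \<otimes>\<^bsub>free_alg B\<^esub> g = (\<lambda>w. \<Sum>i\<le>length w. f (take i w) * g (drop i w))"
  and free_alg_smult: "c \<odot>\<^bsub>free_alg B\<^esub> f = (\<lambda>w. c * f w)"
  and carrier_free_alg: "carrier (free_alg B) = {f. finite {w. f w \<noteq> 0} \<and> {w. f w \<noteq> 0} \<subseteq> lists B}"
  by (simp_all add: free_alg_def)

definition word_vec :: "'x list \<Rightarrow> 'x list \<Rightarrow> 'k::field" where
  "word_vec w = (\<lambda>u. if u = w then 1 else 0)"

lemma free_gen_word_vec: "free_gen x = word_vec [x]"
  by (simp add: free_gen_def word_vec_def)

lemma word_vec_carrier: "w \<in> lists B \<Longrightarrow> word_vec w \<in> carrier (free_alg B)"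
  by (rule free_alg_carrierI[of _ "{w}"]) (auto simp: word_vec_def)

lemma word_vec_comb_carrier:
  "w \<in> lists B \<Longrightarrow> u \<in> lists B \<Longrightarrow> (\<lambda>t. word_vec w t - c * word_vec u t) \<in> carrier (free_alg B)"
  by (rule free_alg_carrierI[of _ "{w, u}"]) (auto simp: word_vec_def split: if_splits)

lemma word_vec_convolution:
  "(\<Sum>i\<le>length t. word_vec u (take i t) * word_vec w (drop i t)) = (word_vec (u @ w) t :: 'k::field)"
proof -
  have "(\<Sum>i\<le>length t. word_vec u (take i t) * word_vec w (drop i t)) =
      (\<Sum>i\<le>length t. if i = length u then word_vec (u @ w) t else (0::'k))"
  proof (intro sum.cong refl)
    fix i assume i: "i \<in> {..length t}"
    have "take i t = u \<and> drop i t = w \<longleftrightarrow> i = length u \<and> t = u @ w"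
    proof
      assume *: "take i t = u \<and> drop i t = w"
      then have "t = u @ w" using append_take_drop_id[of i t] by simp
      moreover have "length u = i" using i conjunct1[OF *] by (simp flip: \<open>t = u @ w\<close>) (metis atMost_iff i length_take min.absorb2)
      ultimately show "i = length u \<and> t = u @ w" by simp
    qed simp
    then show "word_vec u (take i t) * word_vec w (drop i t) =
        (if i = length u then word_vec (u @ w) t else (0::'k))"
      unfolding word_vec_def by (cases "take i t = u"; cases "drop i t = w") simp_all
  qed
  also have "\<dots> = word_vec (u @ w) t" by (auto simp: word_vec_def)
  finally show ?thesis .
qed

lemma word_vec_mult_left:
  "word_vec u \<otimes>\<^bsub>free_alg B\<^esub> (\<lambda>t. word_vec w t - c * word_vec w' t) =
     (\<lambda>t. word_vec (u @ w) t - c * word_vec (u @ w') t)"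
  by (simp add: free_alg_def right_diff_distrib sum_subtractf fun_eq_iff mult.left_commute[of _ c]
        sum_distrib_left[symmetric] word_vec_convolution)

lemma word_vec_mult_right:
  "(\<lambda>t. word_vec w t - c * word_vec w' t) \<otimes>\<^bsub>free_alg B\<^esub> word_vec u =
     (\<lambda>t. word_vec (w @ u) t - c * word_vec (w' @ u) t)"
  by (simp add: free_alg_def left_diff_distrib sum_subtractf fun_eq_iff mult.assoc
        sum_distrib_left[symmetric] word_vec_convolution)

lemma a_inv_free_alg:
  assumes "f \<in> carrier (free_alg B)"
  shows "\<ominus>\<^bsub>free_alg B\<^esub> f = (\<lambda>w. - f w)"
proof -
  interpret ring "free_alg B" by (rule ring_free_alg)
  show ?thesis
    by (rule minus_equality) (use assms in \<open>auto simp: free_alg_def\<close>)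
qed

lemma a_minus_free_alg:
  assumes "g \<in> carrier (free_alg B)"
  shows "f \<ominus>\<^bsub>free_alg B\<^esub> g = (\<lambda>w. f w - g w)"
  by (simp add: a_minus_def a_inv_free_alg[OF assms]) (simp add: free_alg_def)

lemma quantum_rels_eq:
  "quantum_rels n q =
     {(\<lambda>t. word_vec [j, i] t - q * word_vec [i, j] t) | i j. 1 \<le> i \<and> i < j \<and> j \<le> n}"
proof -
  have *: "free_gen j \<otimes>\<^bsub>free_alg B\<^esub> free_gen i = (word_vec [j, i] :: nat list \<Rightarrow> 'a)" for i j B
    unfolding free_gen_word_vec free_alg_mult word_vec_convolution by simp
  have "free_gen j \<otimes>\<^bsub>free_alg {1..n}\<^esub> free_gen i \<ominus>\<^bsub>free_alg {1..n}\<^esub>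
        q \<odot>\<^bsub>free_alg {1..n}\<^esub> (free_gen i \<otimes>\<^bsub>free_alg {1..n}\<^esub> free_gen j) =
      (\<lambda>t. word_vec [j, i] t - q * word_vec [i, j] t)" if "1 \<le> i" "i < j" "j \<le> n" for i j
  proof -
    have "q \<odot>\<^bsub>free_alg {1..n}\<^esub> word_vec [i, j] \<in> carrier (free_alg {1..n})"
      by (rule free_alg_carrierI[of _ "{[i, j]}"]) (use that in \<open>auto simp: word_vec_def free_alg_def split: if_splits\<close>)
    then show ?thesis unfolding * by (simp add: a_minus_free_alg) (simp add: free_alg_def)
  qed
  then show ?thesis unfolding quantum_rels_def by (metis (no_types, lifting))
qed

lemma quantum_rels_carrier: "quantum_rels n q \<subseteq> carrier (free_alg {1..n})"
  unfolding quantum_rels_eq by (auto intro!: word_vec_comb_carrier)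

lemma ideal_quantum_ideal: "ideal (quantum_ideal n q) (free_alg {1..n})"
  unfolding quantum_ideal_def by (rule ring.genideal_ideal[OF ring_free_alg quantum_rels_carrier])

subsection \<open>Sorting words modulo the relations\<close>

text \<open>The factor is left open; comparing the values of the two words determines it.\<close>

definition proportional :: "nat \<Rightarrow> 'k::field \<Rightarrow> nat list \<Rightarrow> nat list \<Rightarrow> bool" where
  "proportional n q w u \<longleftrightarrow> (\<exists>c. (\<lambda>t. word_vec w t - c * word_vec u t) \<in> quantum_ideal n q)"

lemma quantum_ideal_zero: "(\<lambda>t. 0) \<in> quantum_ideal n q"
proof -
  interpret ideal "quantum_ideal n q" "free_alg {1..n}" by (rule ideal_quantum_ideal)
  show ?thesis using additive_subgroup.zero_closed[OF is_additive_subgroup] unfolding free_alg_zero .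
qed

lemma quantum_ideal_add:
  "f \<in> quantum_ideal n q \<Longrightarrow> g \<in> quantum_ideal n q \<Longrightarrow> (\<lambda>t. f t + g t) \<in> quantum_ideal n q"
proof -
  interpret ideal "quantum_ideal n q" "free_alg {1..n}" by (rule ideal_quantum_ideal)
  show "f \<in> quantum_ideal n q \<Longrightarrow> g \<in> quantum_ideal n q \<Longrightarrow> (\<lambda>t. f t + g t) \<in> quantum_ideal n q"
    using additive_subgroup.a_closed[OF is_additive_subgroup, of f g] unfolding free_alg_add .
qed

lemma quantum_ideal_scale:
  assumes "f \<in> quantum_ideal n q"
  shows "(\<lambda>t. c * f t) \<in> quantum_ideal n q"
proof -
  interpret ideal "quantum_ideal n q" "free_alg {1..n}" by (rule ideal_quantum_ideal)
  have "(\<lambda>t. c * word_vec [] t) \<in> carrier (free_alg {1..n})"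
    by (rule free_alg_carrierI[of _ "{[]}"]) (auto simp: word_vec_def split: if_splits)
  from I_l_closed[OF assms this]
  have "(\<lambda>t. c * word_vec [] t) \<otimes>\<^bsub>free_alg {1..n}\<^esub> f \<in> quantum_ideal n q" .
  moreover have "((\<lambda>t. c * word_vec [] t) \<otimes>\<^bsub>free_alg {1..n}\<^esub> f) w = c * f w" for w
  proof -
    have "((\<lambda>t. c * word_vec [] t) \<otimes>\<^bsub>free_alg {1..n}\<^esub> f) w =
        (\<Sum>i\<le>length w. if i = 0 then c * f w else 0)"
      unfolding free_alg_mult
    proof (intro sum.cong refl)
      fix i assume "i \<in> {..length w}"
      then show "c * word_vec [] (take i w) * f (drop i w) = (if i = 0 then c * f w else 0)"
        by (cases "i = 0") (auto simp: word_vec_def)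
    qed
    then show ?thesis by simp
  qed
  then have "(\<lambda>t. c * word_vec [] t) \<otimes>\<^bsub>free_alg {1..n}\<^esub> f = (\<lambda>t. c * f t)" by (rule ext)
  ultimately show ?thesis by (simp only:)
qed

lemma proportional_refl: "proportional n q w w"
  unfolding proportional_def using quantum_ideal_zero by (intro exI[of _ 1]) simp

lemma proportional_trans:
  assumes "proportional n q w u" "proportional n q u t"
  shows "proportional n q w t"
proof -
  obtain c d where c: "(\<lambda>s. word_vec w s - c * word_vec u s) \<in> quantum_ideal n q"
    and d: "(\<lambda>s. word_vec u s - d * word_vec t s) \<in> quantum_ideal n q"
    using assms unfolding proportional_def by blast
  have "(\<lambda>s. (word_vec w s - c * word_vec u s) + c * (word_vec u s - d * word_vec t s)) \<in> quantum_ideal n q"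
    by (rule quantum_ideal_add[OF c quantum_ideal_scale[OF d]])
  then show ?thesis
    unfolding proportional_def by (intro exI[of _ "c * d"]) (simp add: algebra_simps)
qed

lemma proportional_Cons:
  assumes "proportional n q w u" "x \<in> {1..n}"
  shows "proportional n q (x # w) (x # u)"
proof -
  interpret ideal "quantum_ideal n q" "free_alg {1..n}" by (rule ideal_quantum_ideal)
  obtain c where c: "(\<lambda>s. word_vec w s - c * word_vec u s) \<in> quantum_ideal n q"
    using assms unfolding proportional_def by blast
  have "word_vec [x] \<in> carrier (free_alg {1..n})" using assms(2) by (intro word_vec_carrier) auto
  from I_l_closed[OF c this] show ?thesis
    unfolding word_vec_mult_left proportional_def by auto
qed

text \<open>A defining relation, multiplied by a word on the right.\<close>

lemma proportional_swap:
  assumes "1 \<le> i" "i < j" "j \<le> n" "set w \<subseteq> {1..n}"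
  shows "proportional n q (j # i # w) (i # j # w)"
proof -
  interpret ideal "quantum_ideal n q" "free_alg {1..n}" by (rule ideal_quantum_ideal)
  have "(\<lambda>t. word_vec [j, i] t - q * word_vec [i, j] t) \<in> quantum_rels n q"
    using assms unfolding quantum_rels_eq by blast
  then have c: "(\<lambda>t. word_vec [j, i] t - q * word_vec [i, j] t) \<in> quantum_ideal n q"
    unfolding quantum_ideal_def
    using ring.genideal_self[OF ring_free_alg quantum_rels_carrier] by blast
  have "word_vec w \<in> carrier (free_alg {1..n})" using assms(4) by (intro word_vec_carrier) auto
  from I_r_closed[OF c this] show ?thesis
    unfolding word_vec_mult_right proportional_def by auto
qed

lemma proportional_insort:
  "x \<in> {1..n} \<Longrightarrow> set w \<subseteq> {1..n} \<Longrightarrow> proportional n q (x # w) (insort x w)"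
proof (induction w)
  case (Cons y w)
  show ?case
  proof (cases "x \<le> y")
    case False
    have "proportional n q (x # y # w) (y # x # w)"
      using False Cons.prems by (intro proportional_swap) auto
    moreover have "proportional n q (y # x # w) (y # insort x w)"
      using Cons by (intro proportional_Cons) auto
    ultimately show ?thesis using False by (auto intro: proportional_trans)
  qed (simp add: proportional_refl)
qed (simp add: proportional_refl)

lemma proportional_sort: "set w \<subseteq> {1..n} \<Longrightarrow> proportional n q w (sort w)"
proof (induction w)
  case (Cons x w)
  have "proportional n q (x # w) (x # sort w)"
    using Cons by (intro proportional_Cons) auto
  moreover have "proportional n q (x # sort w) (insort x (sort w))"
    using Cons.prems by (intro proportional_insort) auto
  ultimately show ?case by (auto intro: proportional_trans)
qed (simp add: proportional_refl)


subsection \<open>The twisted monoid algebra of exponent vectors\<close>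

definition total_degree :: "nat \<Rightarrow> (nat \<Rightarrow>\<^sub>0 int) \<Rightarrow> int" where
  "total_degree n a = (\<Sum>i\<in>{1..n}. lookup a i)"

text \<open>Moving the letters of \<open>x\<^sup>b\<close> to the left past those of \<open>x\<^sup>a\<close> costs one factor \<open>q\<close> for each
  letter \<open>x\<^sub>j\<close> of \<open>x\<^sup>a\<close> and each letter \<open>x\<^sub>i\<close> of \<open>x\<^sup>b\<close> with \<open>i < j\<close>.\<close>

definition twist_form :: "nat \<Rightarrow> (nat \<Rightarrow>\<^sub>0 int) \<Rightarrow> (nat \<Rightarrow>\<^sub>0 int) \<Rightarrow> int" where
  "twist_form n a b = (\<Sum>j\<in>{1..n}. \<Sum>i\<in>{1..<j}. lookup a j * lookup b i)"

definition cone :: "nat \<Rightarrow> nat \<Rightarrow> (nat \<Rightarrow>\<^sub>0 int) set" where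
  "cone n v = {a. keys a \<subseteq> {1..n} \<and> (\<forall>i. 0 \<le> lookup a i) \<and> int v dvd total_degree n a}"

lemma total_degree_add: "total_degree n (a + b) = total_degree n a + total_degree n b"
  by (simp add: total_degree_def lookup_add sum.distrib)

lemma total_degree_zero [simp]: "total_degree n 0 = 0"
  by (simp add: total_degree_def)

lemma total_degree_single: "total_degree n (single i c) = (if i \<in> {1..n} then c else 0)"
  by (simp add: total_degree_def lookup_single when_def)

lemma twist_form_add_left: "twist_form n (a + b) c = twist_form n a c + twist_form n b c"
  by (simp add: twist_form_def lookup_add sum.distrib distrib_right)

lemma twist_form_add_right: "twist_form n a (b + c) = twist_form n a b + twist_form n a c"
  by (simp add: twist_form_def lookup_add sum.distrib distrib_left)

lemma zero_in_cone [simp]: "0 \<in> cone n v"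
  by (simp add: cone_def)

lemma cone_add: "a \<in> cone n v \<Longrightarrow> b \<in> cone n v \<Longrightarrow> a + b \<in> cone n v"
  using keys_add[of a b] by (auto simp: cone_def lookup_add total_degree_add)

lemma twist_form_single:
  assumes "i \<in> {1..n}" "j \<in> {1..n}"
  shows "twist_form n (single j c) (single i d) = (if i < j then c * d else 0)"
proof -
  have "twist_form n (single j c) (single i d) =
      (\<Sum>k\<in>{1..n}. if k = j then (\<Sum>l\<in>{1..<j}. c * (if i = l then d else 0)) else 0)"
    unfolding twist_form_def
    by (intro sum.cong refl) (auto simp: lookup_single when_def)
  also have "\<dots> = (if i < j then c * d else 0)"
    using assms by (simp flip: sum_distrib_left)
  finally show ?thesis .
qed

locale quantum =
  fixes n :: nat and q :: "'k::field"
  assumes q_nonzero: "q \<noteq> 0"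
begin

abbreviation chi :: "(nat \<Rightarrow>\<^sub>0 int) \<Rightarrow> (nat \<Rightarrow>\<^sub>0 int) \<Rightarrow> 'k" where
  "chi a b \<equiv> q powi twist_form n a b"

sublocale twisted_group_algebra chi
  using q_nonzero
  by unfold_locales (simp_all add: twist_form_add_left twist_form_add_right power_int_add)

notation tmul (infixl \<open>\<star>\<close> 70)

lemma ring_cone_alg: "ring (monoid_alg (cone n v))"
  by (rule ring_monoid_alg) (auto intro: cone_add)

subsection \<open>Evaluation of noncommutative polynomials\<close>

primrec exponent :: "nat list \<Rightarrow> nat \<Rightarrow>\<^sub>0 int" where
  "exponent [] = 0"
| "exponent (i # w) = single i 1 + exponent w"

lemma exponent_append: "exponent (u @ w) = exponent u + exponent w"
  by (induction u) (simp_all add: add_ac)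

primrec word_value :: "nat list \<Rightarrow> (nat \<Rightarrow>\<^sub>0 int) \<Rightarrow>\<^sub>0 'k" where
  "word_value [] = 1"
| "word_value (i # w) = single (single i 1) 1 \<star> word_value w"

lemma word_value_append: "word_value (u @ w) = word_value u \<star> word_value w"
  by (induction u) (simp_all add: tmul_assoc)

lemma word_value_monomial:
  obtains c where "word_value w = single (exponent w) c" "c \<noteq> 0"
proof -
  have "\<exists>c. word_value w = single (exponent w) c \<and> c \<noteq> 0"
  proof (induction w)
    case (Cons i w)
    then obtain c where "word_value w = single (exponent w) c" "c \<noteq> 0" by blast
    then show ?case using chi_nonzero by (auto simp: tmul_single)
  qed (auto intro!: exI[of _ 1] simp flip: single_one)
  then show thesis using that by blast
qed

lemma keys_word_value: "keys (word_value w) = {exponent w}"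
  by (rule word_value_monomial[of w]) simp

lemma exponent_lookup: "lookup (exponent w) i = int (count_list w i)"
  by (induction w) (auto simp: lookup_add lookup_single when_def)

lemma in_keys_exponent: "i \<in> keys (exponent w) \<longleftrightarrow> i \<in> set w"
  by (simp add: in_keys_iff exponent_lookup count_list_0_iff)

lemma exponent_cone: "set w \<subseteq> {1..n} \<Longrightarrow> exponent w \<in> cone n 1"
  unfolding cone_def using in_keys_exponent[of _ w] by (auto simp: exponent_lookup)

lemma total_degree_exponent: "set w \<subseteq> {1..n} \<Longrightarrow> total_degree n (exponent w) = int (length w)"
  by (induction w) (auto simp: total_degree_add total_degree_single)

lemma exponent_inj_sorted:
  "exponent w = exponent u \<Longrightarrow> sorted w \<Longrightarrow> sorted u \<Longrightarrow> w = u"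
proof (induction w arbitrary: u)
  case Nil
  then show ?case using in_keys_exponent[of _ u] by (cases u) auto
next
  case (Cons x w)
  have eq: "set u = set (x # w)"
    using in_keys_exponent[of _ u] in_keys_exponent[of _ "x # w"] unfolding Cons.prems(1) by blast
  then obtain y u' where u: "u = y # u'" by (cases u) auto
  have "y \<le> x" "x \<le> y" using eq Cons.prems(2,3) by (auto simp: u)
  then show ?case using Cons.IH[of u'] Cons.prems by (simp add: u)
qed

definition evaluate :: "(nat list \<Rightarrow> 'k) \<Rightarrow> (nat \<Rightarrow>\<^sub>0 int) \<Rightarrow>\<^sub>0 'k" where
  "evaluate f = (\<Sum>w | f w \<noteq> 0. single 0 (f w) \<star> word_value w)"

lemma evaluate_superset:
  assumes "finite S" "\<And>w. f w \<noteq> 0 \<Longrightarrow> w \<in> S"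
  shows "evaluate f = (\<Sum>w\<in>S. single 0 (f w) \<star> word_value w)"
  unfolding evaluate_def using assms by (intro sum.mono_neutral_left) auto

lemma evaluate_add:
  assumes "finite {w. f w \<noteq> 0}" "finite {w. g w \<noteq> 0}"
  shows "evaluate (\<lambda>w. f w + g w) = evaluate f + evaluate g"
proof -
  let ?S = "{w. f w \<noteq> 0} \<union> {w. g w \<noteq> 0}"
  have S: "finite ?S" using assms by simp
  show ?thesis
    by (subst (1 2 3) evaluate_superset[OF S])
       (auto simp: single_add tmul_add_left sum.distrib)
qed

lemma evaluate_scale: "finite {w. f w \<noteq> 0} \<Longrightarrow> evaluate (\<lambda>w. c * f w) = single 0 c \<star> evaluate f"
  by (subst evaluate_superset[of "{w. f w \<noteq> 0}"], simp, simp)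
     (simp add: evaluate_def tmul_sum_right scalar_scalar)

lemma evaluate_word_vec: "evaluate (word_vec w) = word_value w"
  by (subst evaluate_superset[of "{w}"]) (auto simp: word_vec_def split: if_splits)

lemma evaluate_diff_word_vec:
  "evaluate (\<lambda>t. word_vec w t - c * word_vec u t) = word_value w - single 0 c \<star> word_value u"
proof -
  have fin: "finite {t. word_vec u t \<noteq> (0::'k)}" for u :: "nat list"
    by (rule finite_subset[of _ "{u}"]) (auto simp: word_vec_def)
  have "finite {t. - c * word_vec u t \<noteq> (0::'k)}" for u :: "nat list"
    by (rule finite_subset[of _ "{u}"]) (auto simp: word_vec_def)
  from evaluate_add[OF fin[of w] this[of u]] show ?thesis
    by (simp add: evaluate_scale[OF fin] evaluate_word_vec del: mult_minus_left)
       (simp add: single_uminus tmul_uminus)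
qed

lemma evaluate_mult:
  assumes f: "finite {w. f w \<noteq> 0}" and g: "finite {w. g w \<noteq> 0}"
  shows "evaluate (\<lambda>w. \<Sum>i\<le>length w. f (take i w) * g (drop i w)) = evaluate f \<star> evaluate g"
proof -
  let ?F = "{w. f w \<noteq> 0}" and ?G = "{w. g w \<noteq> 0}"
  define S where "S = (\<lambda>(u, w). u @ w) ` (?F \<times> ?G)"
  let ?t = "\<lambda>u w. single 0 (f u * g w) \<star> word_value (u @ w)"
  have fin: "finite S" using f g by (simp add: S_def)
  have "evaluate (\<lambda>w. \<Sum>i\<le>length w. f (take i w) * g (drop i w)) =
      (\<Sum>w\<in>S. single 0 (\<Sum>i\<le>length w. f (take i w) * g (drop i w)) \<star> word_value w)"
  proof (rule evaluate_superset[OF fin])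
    fix w assume "(\<Sum>i\<le>length w. f (take i w) * g (drop i w)) \<noteq> 0"
    then obtain i where "f (take i w) * g (drop i w) \<noteq> 0"
      by (meson sum.not_neutral_contains_not_neutral)
    then show "w \<in> S" unfolding S_def by (intro image_eqI[of _ _ "(take i w, drop i w)"]) auto
  qed
  also have "\<dots> = (\<Sum>w\<in>S. \<Sum>i\<le>length w. ?t (take i w) (drop i w))"
  proof (intro sum.cong refl)
    fix w
    have single_sum: "single 0 (\<Sum>i\<in>I. h i) = (\<Sum>i\<in>I. single 0 (h i))" if "finite I" for I and h :: "nat \<Rightarrow> 'k"
      using that by (induction I rule: finite_induct) (simp_all add: single_add)
    show "single 0 (\<Sum>i\<le>length w. f (take i w) * g (drop i w)) \<star> word_value w =
        (\<Sum>i\<le>length w. ?t (take i w) (drop i w))"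
      by (simp only: append_take_drop_id single_sum[OF finite_atMost] tmul_sum_left)
  qed
  also have "\<dots> = (\<Sum>(w, i)\<in>(SIGMA w:S. {..length w}). ?t (take i w) (drop i w))"
    using fin by (subst sum.Sigma) auto
  also have "\<dots> = (\<Sum>(u, w)\<in>?F \<times> ?G. ?t u w)"
  proof (rule sum.reindex_bij_witness_not_neutral[where
        i = "\<lambda>(u, w). (u @ w, length u)" and j = "\<lambda>(w, i). (take i w, drop i w)"
        and S' = "{p \<in> (SIGMA w:S. {..length w}). f (take (snd p) (fst p)) * g (drop (snd p) (fst p)) = 0}"
        and T' = "{}"], goal_cases)
    case 1
    have "finite (SIGMA w:S. {..length w})" using fin by auto
    then show ?case by (rule finite_subset[rotated]) auto
  next
    case (3 p)
    then show ?case by (cases p) (auto simp: min_def)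
  next
    case (4 p)
    then show ?case by (cases p) auto
  next
    case (5 p)
    then show ?case by (cases p) auto
  next
    case (6 p)
    have "u @ w \<in> S" if "f u \<noteq> 0" "g w \<noteq> 0" for u w
      unfolding S_def using that by (intro image_eqI[of _ _ "(u, w)"]) auto
    with 6 show ?case by (cases p) auto
  next
    case (9 p)
    then show ?case by (cases p) auto
  qed auto
  also have "\<dots> = evaluate f \<star> evaluate g"
    unfolding evaluate_def
    by (simp only: tmul_sum_left tmul_sum_right sum.cartesian_product[symmetric] case_prod_conv
          word_value_append scalar_pair) (rule sum.swap)
  finally show ?thesis .
qed


subsection \<open>The kernel of evaluation\<close>

lemma evaluate_in_cone_alg:
  assumes "f \<in> carrier (free_alg {1..n})"
  shows "keys (evaluate f) \<subseteq> cone n 1"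
proof -
  have "keys (single 0 (f w) \<star> word_value w) \<subseteq> cone n 1" if "f w \<noteq> 0" for w
    using that assms exponent_cone[of w] by (auto simp: carrier_free_alg keys_scalar keys_word_value)
  then show ?thesis unfolding evaluate_def by (intro order.trans[OF keys_sum] UN_least) auto
qed

lemma ring_hom_evaluate: "evaluate \<in> ring_hom (free_alg {1..n}) (monoid_alg (cone n 1))"
proof -
  have "evaluate (\<lambda>w. if w = [] then 1 else 0) = 1"
    using evaluate_word_vec[of "[]"] by (simp add: word_vec_def)
  then have one: "evaluate \<one>\<^bsub>free_alg {1..n}\<^esub> = 1" by (simp only: free_alg_one)
  have fin: "finite {w. f w \<noteq> 0}" if "f \<in> carrier (free_alg {1..n})" for f :: "nat list \<Rightarrow> 'k"
    using that by (simp add: carrier_free_alg)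
  show ?thesis
  proof (rule ring_hom_memI)
    fix f g :: "nat list \<Rightarrow> 'k"
    assume f: "f \<in> carrier (free_alg {1..n})"
    show "evaluate f \<in> carrier (monoid_alg (cone n 1))"
      using evaluate_in_cone_alg[OF f] by simp
    assume g: "g \<in> carrier (free_alg {1..n})"
    show "evaluate (f \<otimes>\<^bsub>free_alg {1..n}\<^esub> g) =
        evaluate f \<otimes>\<^bsub>monoid_alg (cone n 1)\<^esub> evaluate g"
      by (simp only: free_alg_mult evaluate_mult[OF fin fin, OF f g] monoid_alg_simps)
    show "evaluate (f \<oplus>\<^bsub>free_alg {1..n}\<^esub> g) =
        evaluate f \<oplus>\<^bsub>monoid_alg (cone n 1)\<^esub> evaluate g"
      by (simp only: free_alg_add evaluate_add[OF fin fin, OF f g] monoid_alg_simps)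
  qed (simp only: one monoid_alg_simps)
qed

lemma ring_hom_ring_evaluate:
  "ring_hom_ring (free_alg {1..n}) (monoid_alg (cone n 1)) evaluate"
  by (rule ring_hom_ringI2[OF ring_free_alg ring_cone_alg ring_hom_evaluate])

lemma evaluate_relation:
  assumes "1 \<le> i" "i < j" "j \<le> n"
  shows "word_value [j, i] = single 0 q \<star> word_value [i, j]"
  using assms by (simp add: tmul_single twist_form_single add.commute)

lemma quantum_ideal_le_kernel:
  "quantum_ideal n q \<subseteq> a_kernel (free_alg {1..n}) (monoid_alg (cone n 1)) evaluate"
  unfolding quantum_ideal_def
proof (rule ring.genideal_minimal[OF ring_free_alg])
  interpret ring_hom_ring "free_alg {1..n}" "monoid_alg (cone n 1)" evaluate
    by (rule ring_hom_ring_evaluate)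
  show "ideal (a_kernel (free_alg {1..n}) (monoid_alg (cone n 1)) evaluate) (free_alg {1..n})"
    by (rule kernel_is_ideal)
  show "quantum_rels n q \<subseteq> a_kernel (free_alg {1..n}) (monoid_alg (cone n 1)) evaluate"
  proof
    fix f assume f: "f \<in> quantum_rels n q"
    then obtain i j where ij: "1 \<le> i" "i < j" "j \<le> n"
      and f_eq: "f = (\<lambda>t. word_vec [j, i] t - q * word_vec [i, j] t)"
      unfolding quantum_rels_eq by blast
    have "evaluate f = 0"
      unfolding f_eq evaluate_diff_word_vec evaluate_relation[OF ij] by (rule diff_self)
    then show "f \<in> a_kernel (free_alg {1..n}) (monoid_alg (cone n 1)) evaluate"
      using subsetD[OF quantum_rels_carrier f] unfolding a_kernel_def' monoid_alg_simps by blast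
  qed
qed

lemma evaluate_quantum_ideal: "f \<in> quantum_ideal n q \<Longrightarrow> evaluate f = 0"
  using subsetD[OF quantum_ideal_le_kernel, of f] by (simp add: a_kernel_def')

text \<open>Modulo the relations every element is a combination of sorted words, and the values of
  distinct sorted words are multiples of distinct monomials.\<close>

lemma kernel_le_quantum_ideal:
  assumes f: "f \<in> carrier (free_alg {1..n})" and ev: "evaluate f = 0"
  shows "f \<in> quantum_ideal n q"
proof -
  let ?S = "{w. f w \<noteq> 0}"
  have S: "finite ?S" "\<And>w. w \<in> ?S \<Longrightarrow> set w \<subseteq> {1..n}" using f by (auto simp: carrier_free_alg)
  have "\<forall>w\<in>?S. \<exists>c. (\<lambda>t. word_vec w t - c * word_vec (sort w) t) \<in> quantum_ideal n q"
    using proportional_sort S(2) unfolding proportional_def by blast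
  then obtain c where c: "\<And>w. w \<in> ?S \<Longrightarrow> (\<lambda>t. word_vec w t - c w * word_vec (sort w) t) \<in> quantum_ideal n q"
    by metis
  have sums: "(\<lambda>t. \<Sum>w\<in>A. f w * (word_vec w t - c w * word_vec (sort w) t)) \<in> quantum_ideal n q"
    if "finite A" "A \<subseteq> ?S" for A
    using that
  proof (induction A rule: finite_induct)
    case (insert w A)
    then have "w \<in> ?S" "A \<subseteq> ?S" by auto
    from quantum_ideal_add[OF quantum_ideal_scale[OF c[OF this(1)], of "f w"] insert.IH[OF this(2)]]
    show ?case using insert.hyps by simp
  qed (simp add: quantum_ideal_zero)
  define s where "s t = (\<Sum>w\<in>?S. f w * c w * word_vec (sort w) t)" for t
  define r where "r t = (\<Sum>w\<in>?S. f w * (word_vec w t - c w * word_vec (sort w) t))" for t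
  have r: "r \<in> quantum_ideal n q" unfolding r_def using sums S(1) by blast
  have f_eq: "f = (\<lambda>t. r t + s t)"
  proof
    fix t
    have "r t + s t = (\<Sum>w\<in>?S. if w = t then f w else 0)"
      unfolding r_def s_def sum.distrib[symmetric]
      by (intro sum.cong refl) (simp add: right_diff_distrib mult.assoc word_vec_def)
    then show "f t = r t + s t" using S(1) by simp
  qed
  have s_supp: "t \<in> sort ` ?S" if nz: "s t \<noteq> 0" for t
  proof -
    obtain w where "w \<in> ?S" "f w * c w * word_vec (sort w) t \<noteq> 0"
      using nz unfolding s_def by (rule sum.not_neutral_contains_not_neutral)
    then have "t = sort w" by (simp add: word_vec_def split: if_splits)
    then show ?thesis using \<open>w \<in> ?S\<close> by blast
  qed
  have s_fin: "finite {t. s t \<noteq> 0}"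
  proof (rule finite_subset)
    show "{t. s t \<noteq> 0} \<subseteq> sort ` ?S" using s_supp by blast
    show "finite (sort ` ?S)" using S(1) by (rule finite_imageI)
  qed
  have "r \<in> carrier (free_alg {1..n})"
    by (rule ideal.Icarr[OF ideal_quantum_ideal r])
  then have "finite {t. r t \<noteq> 0}" by (simp add: carrier_free_alg)
  then have "evaluate f = evaluate r + evaluate s"
    unfolding f_eq using s_fin by (rule evaluate_add)
  then have ev_s: "evaluate s = 0" using ev evaluate_quantum_ideal[OF r] by simp
  have "s t = 0" for t
  proof (rule ccontr)
    assume t: "s t \<noteq> 0"
    obtain k where k: "word_value t = single (exponent t) k" "k \<noteq> 0" by (rule word_value_monomial)
    have "lookup (evaluate s) (exponent t) =
        (\<Sum>w | s w \<noteq> 0. s w * lookup (word_value w) (exponent t))"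
      by (simp add: evaluate_def lookup_sum lookup_scalar)
    also have "\<dots> = (\<Sum>w | s w \<noteq> 0. if w = t then s t * k else 0)"
    proof (intro sum.cong refl)
      fix w assume w: "w \<in> {w. s w \<noteq> 0}"
      show "s w * lookup (word_value w) (exponent t) = (if w = t then s t * k else 0)"
      proof (cases "w = t")
        case False
        have "sorted w" "sorted t" using s_supp w t by (auto dest!: s_supp)
        then have "exponent t \<noteq> exponent w" using False exponent_inj_sorted by metis
        then have "exponent t \<notin> keys (word_value w)" by (simp add: keys_word_value)
        then show ?thesis using False by (simp add: in_keys_iff)
      qed (simp add: k)
    qed
    also have "\<dots> = s t * k" using s_fin t by simp
    finally show False using t k ev_s by simp
  qed
  then have "f = r" unfolding f_eq by simp
  then show ?thesis using r by simp
qed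

lemma kernel_evaluate:
  "a_kernel (free_alg {1..n}) (monoid_alg (cone n 1)) evaluate = quantum_ideal n q"
  by (rule antisym[OF _ quantum_ideal_le_kernel])
     (auto simp: a_kernel_def' intro: kernel_le_quantum_ideal simp del: One_nat_def)

lemma ex_evaluate:
  assumes "keys h \<subseteq> cone n 1" "\<And>a. a \<in> keys h \<Longrightarrow> total_degree n a \<in> D"
  obtains f where "f \<in> carrier (free_alg {1..n})" "evaluate f = h"
    "\<And>w. f w \<noteq> 0 \<Longrightarrow> int (length w) \<in> D"
proof -
  have "\<exists>f \<in> carrier (free_alg {1..n}). evaluate f = h \<and> (\<forall>w. f w \<noteq> 0 \<longrightarrow> int (length w) \<in> D)"
  proof (induction h rule: single_sum_induct)
    case zero
    then show ?case by (intro bexI[of _ "\<lambda>w. 0"]) (simp_all add: evaluate_def carrier_free_alg)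
  next
    case (single a c)
    \<comment> \<open>The sorted word with the given exponent vector.\<close>
    define w where "w = concat (map (\<lambda>i. replicate (nat (lookup a i)) i) [1..<Suc n])"
    have w: "set w \<subseteq> {1..n}" by (auto simp: w_def)
    have a: "keys a \<subseteq> {1..n}" "\<And>i. 0 \<le> lookup a i"
      using single assms(1) by (auto simp: cone_def)
    have "exponent w = a"
    proof -
      have "exponent (replicate k i) = single i (int k)" for k i
        by (induction k) (simp_all add: single_add)
      then have "exponent (concat (map (\<lambda>i. replicate (nat (lookup a i)) i) is)) =
          (\<Sum>i\<leftarrow>is. single i (lookup a i))" for "is"
        using a(2) by (induction "is") (simp_all add: exponent_append)
      then have "exponent w = (\<Sum>i\<in>{1..<Suc n}. single i (lookup a i))"
        by (simp only: w_def sum_list_distinct_conv_sum_set[OF distinct_upt] set_upt)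
      also have "\<dots> = (\<Sum>i\<in>keys a. single i (lookup a i))"
        using a(1) by (intro sum.mono_neutral_right) (auto simp: in_keys_iff)
      finally show ?thesis by (simp add: sum_single_keys)
    qed
    obtain k where k: "word_value w = single (exponent w) k" "k \<noteq> 0" by (rule word_value_monomial)
    define g where "g = (\<lambda>t. c / k * word_vec w t)"
    have g_supp: "t = w" if "g t \<noteq> 0" for t
      using that by (simp add: g_def word_vec_def split: if_splits)
    have fin: "finite {t. word_vec w t \<noteq> (0::'k)}"
      by (rule finite_subset[of _ "{w}"]) (auto simp: word_vec_def)
    have "evaluate g = single 0 (c / k) \<star> single a k"
      unfolding g_def evaluate_scale[OF fin] evaluate_word_vec k(1) \<open>exponent w = a\<close> ..
    then have "evaluate g = single a c" using k(2) by simp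
    moreover have "g \<in> carrier (free_alg {1..n})"
      by (rule free_alg_carrierI[of _ "{w}"]) (use w g_supp in auto)
    moreover have "int (length w) \<in> D"
      using assms(2)[OF single] total_degree_exponent[OF w] \<open>exponent w = a\<close> by simp
    then have "\<forall>t. g t \<noteq> 0 \<longrightarrow> int (length t) \<in> D" using g_supp by metis
    ultimately show ?case by blast
  next
    case (add g h)
    then obtain f f' where f: "f \<in> carrier (free_alg {1..n})" "evaluate f = g" "\<forall>w. f w \<noteq> 0 \<longrightarrow> int (length w) \<in> D"
      "f' \<in> carrier (free_alg {1..n})" "evaluate f' = h" "\<forall>w. f' w \<noteq> 0 \<longrightarrow> int (length w) \<in> D" by blast
    then have "(\<lambda>w. f w + f' w) \<in> carrier (free_alg {1..n})"
      using abelian_groupE(1)[OF ring.is_abelian_group[OF ring_free_alg], of f "{1..n}" f'] by (simp only: free_alg_add)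
    moreover have "evaluate (\<lambda>w. f w + f' w) = g + h"
      using f by (simp add: evaluate_add carrier_free_alg)
    moreover have "int (length w) \<in> D" if "f w + f' w \<noteq> 0" for w
      using that f by (cases "f w = 0") auto
    ultimately show ?case by blast
  qed
  then show thesis using that by blast
qed

end

(* Otherwise the simplifier turns {1..n} into {Suc 0..n}. *)
declare One_nat_def [simp del]

context quantum
begin

subsection \<open>The Veronese subring\<close>

abbreviation F where "F \<equiv> free_alg {1..n} :: ('k, nat list \<Rightarrow> 'k) module"
abbreviation I where "I \<equiv> quantum_ideal n q"
abbreviation Q where "Q \<equiv> quantum_poly n q"
abbreviation M where "M \<equiv> monoid_alg (cone n 1)"

text \<open>By \<open>kernel_evaluate\<close>, evaluation is constant on cosets of the quantum ideal.\<close>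

definition class_value :: "(nat list \<Rightarrow> 'k) set \<Rightarrow> (nat \<Rightarrow>\<^sub>0 int) \<Rightarrow>\<^sub>0 'k" where
  "class_value X = the_elem (evaluate ` X)"

lemma quantum_poly_simps:
  "carrier Q = carrier (F Quot I)" "monoid.mult Q = monoid.mult (F Quot I)" "monoid.one Q = monoid.one (F Quot I)"
  "ring.add Q = ring.add (F Quot I)" "ring.zero Q = ring.zero (F Quot I)"
  "c \<odot>\<^bsub>Q\<^esub> X = (\<Union>f\<in>X. I +>\<^bsub>F\<^esub> (c \<odot>\<^bsub>F\<^esub> f))"
  by (simp_all add: quantum_poly_def quot_alg_def ring.defs module.defs)

lemma class_value_coset: "f \<in> carrier F \<Longrightarrow> class_value (I +>\<^bsub>F\<^esub> f) = evaluate f"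
  using ring_hom_ring.the_elem_simp[OF ring_hom_ring_evaluate]
  unfolding kernel_evaluate class_value_def .

lemma carrier_quantum_poly: "carrier Q = {I +>\<^bsub>F\<^esub> f | f. f \<in> carrier F}"
  unfolding quantum_poly_simps FactRing_def A_RCOSETS_def' by auto

lemma coset_in_quantum_poly: "f \<in> carrier F \<Longrightarrow> I +>\<^bsub>F\<^esub> f \<in> carrier Q"
  unfolding carrier_quantum_poly by blast

lemma class_value_iso: "class_value \<in> ring_iso (F Quot I) M"
proof -
  interpret ring_hom_ring F M evaluate by (rule ring_hom_ring_evaluate)
  have "evaluate ` carrier F = carrier M"
  proof (rule antisym)
    show "carrier M \<subseteq> evaluate ` carrier F"
    proof
      fix h assume "h \<in> carrier M"
      then have "keys h \<subseteq> cone n 1" by simp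
      then obtain f where "f \<in> carrier F" "evaluate f = h"
        using ex_evaluate[of h UNIV] by blast
      then show "h \<in> evaluate ` carrier F" by blast
    qed
  qed (use hom_closed in blast)
  from FactRing_iso_set[OF this] show ?thesis
    unfolding kernel_evaluate class_value_def .
qed

lemma class_value_inj: "X \<in> carrier Q \<Longrightarrow> Y \<in> carrier Q \<Longrightarrow> class_value X = class_value Y \<Longrightarrow> X = Y"
  using class_value_iso unfolding quantum_poly_simps ring_iso_def bij_betw_def inj_on_def by blast

lemma class_value_hom:
  "X \<in> carrier Q \<Longrightarrow> keys (class_value X) \<subseteq> cone n 1"
  "X \<in> carrier Q \<Longrightarrow> Y \<in> carrier Q \<Longrightarrow> class_value (X \<otimes>\<^bsub>Q\<^esub> Y) = class_value X \<star> class_value Y"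
  "X \<in> carrier Q \<Longrightarrow> Y \<in> carrier Q \<Longrightarrow> class_value (X \<oplus>\<^bsub>Q\<^esub> Y) = class_value X + class_value Y"
  "class_value \<one>\<^bsub>Q\<^esub> = 1"
  using class_value_iso unfolding quantum_poly_simps ring_iso_def ring_hom_def by auto

lemma ring_Quot: "ring (F Quot I)"
  by (rule ideal.quotient_is_ring[OF ideal_quantum_ideal])

lemma quantum_poly_closed:
  "X \<in> carrier Q \<Longrightarrow> Y \<in> carrier Q \<Longrightarrow> X \<otimes>\<^bsub>Q\<^esub> Y \<in> carrier Q"
  "X \<in> carrier Q \<Longrightarrow> Y \<in> carrier Q \<Longrightarrow> X \<oplus>\<^bsub>Q\<^esub> Y \<in> carrier Q"
  "\<one>\<^bsub>Q\<^esub> \<in> carrier Q" "\<zero>\<^bsub>Q\<^esub> \<in> carrier Q"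
proof -
  interpret ring "F Quot I" by (rule ring_Quot)
  show "X \<in> carrier Q \<Longrightarrow> Y \<in> carrier Q \<Longrightarrow> X \<otimes>\<^bsub>Q\<^esub> Y \<in> carrier Q"
    "X \<in> carrier Q \<Longrightarrow> Y \<in> carrier Q \<Longrightarrow> X \<oplus>\<^bsub>Q\<^esub> Y \<in> carrier Q"
    "\<one>\<^bsub>Q\<^esub> \<in> carrier Q" "\<zero>\<^bsub>Q\<^esub> \<in> carrier Q"
    unfolding quantum_poly_simps by (rule m_closed a_closed one_closed zero_closed; assumption?)+
qed

lemma abelian_monoid_quantum_poly: "abelian_monoid Q"
proof -
  interpret ring "F Quot I" by (rule ring_Quot)
  show ?thesis
    by (rule abelian_monoidI) (unfold quantum_poly_simps, simp_all add: a_assoc, rule a_comm)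
qed

lemma class_value_smult:
  assumes "X \<in> carrier Q"
  shows "c \<odot>\<^bsub>Q\<^esub> X \<in> carrier Q" "class_value (c \<odot>\<^bsub>Q\<^esub> X) = single 0 c \<star> class_value X"
proof -
  interpret ideal I F by (rule ideal_quantum_ideal)
  obtain f where f: "f \<in> carrier F" "X = I +>\<^bsub>F\<^esub> f"
    using assms unfolding carrier_quantum_poly by blast
  have fin: "finite {w. g w \<noteq> 0}" if "g \<in> carrier F" for g
    using that by (simp add: carrier_free_alg)
  have cF: "c \<odot>\<^bsub>F\<^esub> g \<in> carrier F" "evaluate (c \<odot>\<^bsub>F\<^esub> g) = single 0 c \<star> evaluate g"
    if "g \<in> carrier F" for g
  proof -
    show "c \<odot>\<^bsub>F\<^esub> g \<in> carrier F"
      by (rule free_alg_carrierI[of _ "{w. g w \<noteq> 0}"])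
         (use that in \<open>auto simp: carrier_free_alg free_alg_smult\<close>)
    show "evaluate (c \<odot>\<^bsub>F\<^esub> g) = single 0 c \<star> evaluate g"
      unfolding free_alg_smult by (rule evaluate_scale[OF fin[OF that]])
  qed
  have "I +>\<^bsub>F\<^esub> (c \<odot>\<^bsub>F\<^esub> g) = I +>\<^bsub>F\<^esub> (c \<odot>\<^bsub>F\<^esub> f)" if g: "g \<in> X" for g
  proof (rule class_value_inj)
    have gF: "g \<in> carrier F" using g f a_r_coset_subset_G[OF a_subset f(1)] by blast
    have "I +>\<^bsub>F\<^esub> g = X" unfolding f(2)
      using a_repr_independence[OF _ f(1) a_subgroup] g unfolding f(2) by simp
    then have "evaluate g = evaluate f"
      using class_value_coset[OF gF] class_value_coset[OF f(1)] f(2) by simp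
    then show "class_value (I +>\<^bsub>F\<^esub> (c \<odot>\<^bsub>F\<^esub> g)) = class_value (I +>\<^bsub>F\<^esub> (c \<odot>\<^bsub>F\<^esub> f))"
      by (simp only: class_value_coset cF gF f(1))
    show "I +>\<^bsub>F\<^esub> (c \<odot>\<^bsub>F\<^esub> g) \<in> carrier Q" by (intro coset_in_quantum_poly cF gF)
    show "I +>\<^bsub>F\<^esub> (c \<odot>\<^bsub>F\<^esub> f) \<in> carrier Q" by (intro coset_in_quantum_poly cF f)
  qed
  moreover have "f \<in> X" using a_rcos_self[OF f(1)] f(2) by simp
  ultimately have eq: "c \<odot>\<^bsub>Q\<^esub> X = I +>\<^bsub>F\<^esub> (c \<odot>\<^bsub>F\<^esub> f)" unfolding quantum_poly_simps by blast
  show "c \<odot>\<^bsub>Q\<^esub> X \<in> carrier Q" unfolding eq by (intro coset_in_quantum_poly cF f)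
  show "class_value (c \<odot>\<^bsub>Q\<^esub> X) = single 0 c \<star> class_value X"
    unfolding eq using class_value_coset[OF f(1)] by (simp only: class_value_coset cF f)
qed

lemma class_value_finsum:
  assumes "finite S" "\<And>i. i \<in> S \<Longrightarrow> a i \<in> carrier Q"
  shows "finsum Q a S \<in> carrier Q \<and> class_value (finsum Q a S) = (\<Sum>i\<in>S. class_value (a i))"
proof -
  interpret abelian_monoid Q by (rule abelian_monoid_quantum_poly)
  have "class_value \<zero>\<^bsub>Q\<^esub> + class_value \<zero>\<^bsub>Q\<^esub> = class_value \<zero>\<^bsub>Q\<^esub>"
    using class_value_hom(3)[OF zero_closed zero_closed] by simp
  then have zero: "class_value \<zero>\<^bsub>Q\<^esub> = 0" by (metis add_cancel_right_right)
  show ?thesis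
    using assms
  proof (induction S rule: finite_induct)
    case (insert i S)
    then have "a \<in> S \<rightarrow> carrier Q" "a i \<in> carrier Q" by auto
    with insert show ?case by (simp add: class_value_hom)
  qed (simp add: zero)
qed

lemma quantum_deg_iff:
  "X \<in> quantum_deg n q d \<longleftrightarrow>
     X \<in> carrier Q \<and> (\<forall>a\<in>keys (class_value X). total_degree n a = d)"
proof
  assume "X \<in> quantum_deg n q d"
  then obtain f where f: "X = I +>\<^bsub>F\<^esub> f" "f \<in> carrier F" "\<And>w. f w \<noteq> 0 \<Longrightarrow> int (length w) = d"
    unfolding quantum_deg_def by blast
  have "keys (evaluate f) \<subseteq> {a. total_degree n a = d}"
    unfolding evaluate_def
  proof (intro order.trans[OF keys_sum] UN_least)
    fix w assume w: "w \<in> {w. f w \<noteq> 0}"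
    then have "set w \<subseteq> {1..n}" using f(2) by (auto simp: carrier_free_alg)
    then show "keys (single 0 (f w) \<star> word_value w) \<subseteq> {a. total_degree n a = d}"
      using w f(3)[of w] by (simp add: keys_scalar keys_word_value total_degree_exponent)
  qed
  then show "X \<in> carrier Q \<and> (\<forall>a\<in>keys (class_value X). total_degree n a = d)"
    using f(2) coset_in_quantum_poly by (auto simp: f(1) class_value_coset)
next
  assume X: "X \<in> carrier Q \<and> (\<forall>a\<in>keys (class_value X). total_degree n a = d)"
  then have "keys (class_value X) \<subseteq> cone n 1" using class_value_hom(1) by blast
  then obtain f where f: "f \<in> carrier F" "evaluate f = class_value X"
    "\<And>w. f w \<noteq> 0 \<Longrightarrow> int (length w) \<in> {d}"
    using ex_evaluate[of "class_value X" "{d}"] X by blast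
  have "X = I +>\<^bsub>F\<^esub> f"
    using X f by (intro class_value_inj) (auto simp: class_value_coset intro: coset_in_quantum_poly)
  then show "X \<in> quantum_deg n q d" using f unfolding quantum_deg_def by blast
qed

lemma cone_le: "a \<in> cone n v \<longleftrightarrow> a \<in> cone n 1 \<and> int v dvd total_degree n a"
  by (auto simp: cone_def)

text \<open>An element whose value has exponents in the cone is the sum of the classes of its
  homogeneous parts; the degrees that occur are multiples of \<open>v\<close>.\<close>

lemma carrier_quantum_veronese:
  assumes "v > 0"
  shows "carrier (quantum_veronese n q v) = {X \<in> carrier Q. keys (class_value X) \<subseteq> cone n v}"
proof (intro equalityI subsetI)
  fix X assume "X \<in> carrier (quantum_veronese n q v)"
  then obtain a S where X: "X = finsum Q a S" "finite S" "\<And>i. i \<in> S \<Longrightarrow> a i \<in> quantum_deg n q (int v * i)"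
    unfolding quantum_veronese_def veronese_def by auto
  then have a: "a i \<in> carrier Q" "\<And>x. x \<in> keys (class_value (a i)) \<Longrightarrow> total_degree n x = int v * i"
    if "i \<in> S" for i
    using that by (auto simp: quantum_deg_iff)
  have "keys (class_value (a i)) \<subseteq> cone n v" if "i \<in> S" for i
    using a[OF that] class_value_hom(1)[OF a(1)[OF that]] by (auto simp: cone_le[of _ v])
  then have "keys (class_value X) \<subseteq> cone n v"
    using class_value_finsum[OF X(2), of a] a(1) unfolding X(1)
    by (auto dest!: subsetD[OF keys_sum])
  then show "X \<in> {X \<in> carrier Q. keys (class_value X) \<subseteq> cone n v}"
    using class_value_finsum[OF X(2), of a] a(1) unfolding X(1) by simp
next
  fix X assume "X \<in> {X \<in> carrier Q. keys (class_value X) \<subseteq> cone n v}"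
  then have X: "X \<in> carrier Q" "keys (class_value X) \<subseteq> cone n v" by auto
  define h where "h = class_value X"
  define S where "S = (\<lambda>x. total_degree n x div int v) ` keys h"
  define part where "part i = proj {x. total_degree n x = int v * i} h" for i
  have "\<exists>Y \<in> quantum_deg n q (int v * i). class_value Y = part i" for i
  proof -
    have "keys (part i) \<subseteq> cone n 1"
      using X(2) by (auto simp: part_def keys_proj h_def cone_le[of _ v])
    then obtain f where "f \<in> carrier F" "evaluate f = part i"
      using ex_evaluate[of "part i" UNIV] by blast
    moreover have "\<forall>x\<in>keys (part i). total_degree n x = int v * i" by (auto simp: part_def keys_proj)
    ultimately show ?thesis
      by (intro bexI[of _ "I +>\<^bsub>F\<^esub> f"]) (simp_all add: quantum_deg_iff class_value_coset coset_in_quantum_poly)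
  qed
  then obtain a where a: "\<And>i. a i \<in> quantum_deg n q (int v * i)" "\<And>i. class_value (a i) = part i"
    by metis
  have aQ: "a i \<in> carrier Q" for i using a(1) by (simp add: quantum_deg_iff)
  have S: "finite S" by (simp add: S_def)
  have "h = (\<Sum>i\<in>S. part i)"
  proof (rule poly_mapping_eqI)
    fix x
    have "lookup (\<Sum>i\<in>S. part i) x = (\<Sum>i\<in>S. if total_degree n x = int v * i then lookup h x else 0)"
      by (simp add: lookup_sum part_def lookup_proj)
    also have "\<dots> = lookup h x"
    proof (cases "x \<in> keys h")
      case True
      define i where "i = total_degree n x div int v"
      have "int v dvd total_degree n x" using X(2) True by (auto simp: h_def cone_def)
      then have i: "total_degree n x = int v * i" by (simp add: i_def)
      have "i \<in> S" using True by (simp add: S_def i_def)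
      have "(\<Sum>i\<in>S. if total_degree n x = int v * i then lookup h x else 0) =
          (\<Sum>j\<in>S. if j = i then lookup h x else 0)"
        using assms by (intro sum.cong refl) (auto simp: i)
      then show ?thesis using S \<open>i \<in> S\<close> by simp
    qed (auto simp: in_keys_iff intro!: sum.neutral)
    finally show "lookup h x = lookup (\<Sum>i\<in>S. part i) x" by simp
  qed
  then have "X = finsum Q a S"
    using class_value_finsum[OF S, of a] aQ a(2) X(1) by (intro class_value_inj) (auto simp: h_def)
  then show "X \<in> carrier (quantum_veronese n q v)"
    using a(1) S unfolding quantum_veronese_def veronese_def by auto
qed

lemma quantum_veronese_simps:
  "monoid.mult (quantum_veronese n q v) = monoid.mult Q"
  "monoid.one (quantum_veronese n q v) = monoid.one Q"
  "ring.add (quantum_veronese n q v) = ring.add Q"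
  "module.smult (quantum_veronese n q v) = module.smult Q"
  by (simp_all add: quantum_veronese_def veronese_def)

lemma alg_closed_cone_alg: "alg_closed (monoid_alg (cone n v))"
proof -
  interpret ring "monoid_alg (cone n v)" by (rule ring_cone_alg)
  have "keys (single 0 c \<star> x) \<subseteq> cone n v" if "keys x \<subseteq> cone n v" for c x
    using that by (cases "c = 0") (simp_all add: keys_scalar)
  then show ?thesis
    using m_closed a_closed one_closed unfolding alg_closed_def by simp
qed

lemma alg_closed_quantum_veronese:
  assumes "v > 0"
  shows "alg_closed (quantum_veronese n q v)"
  using alg_closed_cone_alg[of v] quantum_poly_closed class_value_smult
  unfolding alg_closed_def carrier_quantum_veronese[OF assms] quantum_veronese_simps
  by (simp add: class_value_hom)

lemma veronese_class_value:
  assumes "v > 0"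
  shows "class_value \<in> alg_hom (quantum_veronese n q v) (monoid_alg (cone n v))"
    "bij_betw class_value (carrier (quantum_veronese n q v)) (carrier (monoid_alg (cone n v)))"
proof -
  show "class_value \<in> alg_hom (quantum_veronese n q v) (monoid_alg (cone n v))"
    by (rule alg_homI)
       (auto simp: carrier_quantum_veronese[OF assms] quantum_veronese_simps class_value_hom class_value_smult)
  show "bij_betw class_value (carrier (quantum_veronese n q v)) (carrier (monoid_alg (cone n v)))"
  proof (rule bij_betw_imageI)
    show "inj_on class_value (carrier (quantum_veronese n q v))"
      using class_value_inj unfolding carrier_quantum_veronese[OF assms] inj_on_def by blast
    show "class_value ` carrier (quantum_veronese n q v) = carrier (monoid_alg (cone n v))"
    proof (intro equalityI subsetI)
      fix h assume "h \<in> carrier (monoid_alg (cone n v))"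
      then have h: "keys h \<subseteq> cone n v" by simp
      then have "keys h \<subseteq> cone n 1" using cone_le[of _ v] by blast
      then obtain f where f: "f \<in> carrier F" "evaluate f = h"
        using ex_evaluate[of h UNIV] by blast
      then show "h \<in> class_value ` carrier (quantum_veronese n q v)"
        using h unfolding carrier_quantum_veronese[OF assms]
        by (intro image_eqI[of _ _ "I +>\<^bsub>F\<^esub> f"]) (simp_all add: class_value_coset coset_in_quantum_poly)
    qed (auto simp: carrier_quantum_veronese[OF assms])
  qed
qed

end

section \<open>The exponent lattice and its radical\<close>

lemma total_degree_frag_cmul: "total_degree n (frag_cmul k a) = k * total_degree n a"
  by (simp add: total_degree_def sum_distrib_left)

lemma twist_form_diff:
  "twist_form n a (b - c) = twist_form n a b - twist_form n a c"
  "twist_form n (b - c) a = twist_form n b a - twist_form n c a"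
  by (simp_all add: twist_form_def lookup_minus left_diff_distrib right_diff_distrib sum_subtractf)

lemma total_degree_diff: "total_degree n (a - b) = total_degree n a - total_degree n b"
  by (simp add: total_degree_def lookup_minus sum_subtractf)

lemma total_degree_uminus: "total_degree n (- a) = - total_degree n a"
  by (simp add: total_degree_def sum_negf)

lemma twist_form_frag_cmul_left: "twist_form n (frag_cmul k a) b = k * twist_form n a b"
  by (simp add: twist_form_def sum_distrib_left mult.assoc)

lemma twist_form_frag_cmul_right: "twist_form n a (frag_cmul k b) = k * twist_form n a b"
  by (simp add: twist_form_def sum_distrib_left mult_ac)

lemma keys_frag_cmul_subset: "keys a \<subseteq> S \<Longrightarrow> keys (frag_cmul k a) \<subseteq> S"
  using keys_cmul by blast

definition lattice :: "nat \<Rightarrow> nat \<Rightarrow> (nat \<Rightarrow>\<^sub>0 int) set" where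
  "lattice n v = {a. keys a \<subseteq> {1..n} \<and> int v dvd total_degree n a}"

lemma cone_iff: "a \<in> cone n v \<longleftrightarrow> a \<in> lattice n v \<and> (\<forall>i\<in>{1..n}. 0 \<le> lookup a i)"
proof -
  have "0 \<le> lookup a i" if "keys a \<subseteq> {1..n}" "\<forall>i\<in>{1..n}. 0 \<le> lookup a i" for i
  proof (cases "i \<in> keys a")
    case True
    then show ?thesis using that by blast
  qed (simp add: in_keys_iff)
  then show ?thesis by (auto simp: cone_def lattice_def)
qed

lemma lattice_zero [simp]: "0 \<in> lattice n v"
  by (simp add: lattice_def)

lemma lattice_add: "a \<in> lattice n v \<Longrightarrow> b \<in> lattice n v \<Longrightarrow> a + b \<in> lattice n v"
  using keys_add[of a b] by (auto simp: lattice_def total_degree_add)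

lemma lattice_uminus: "a \<in> lattice n v \<Longrightarrow> - a \<in> lattice n v"
  by (auto simp: lattice_def total_degree_uminus)

lemma lattice_diff: "a \<in> lattice n v \<Longrightarrow> b \<in> lattice n v \<Longrightarrow> a - b \<in> lattice n v"
  using lattice_add[OF _ lattice_uminus] by simp

lemma lattice_frag_cmul: "a \<in> lattice n v \<Longrightarrow> frag_cmul k a \<in> lattice n v"
  using keys_cmul[of k a] by (auto simp: lattice_def total_degree_frag_cmul)

definition vec_on :: "nat set \<Rightarrow> (nat \<Rightarrow> int) \<Rightarrow> nat \<Rightarrow>\<^sub>0 int" where
  "vec_on J f = (\<Sum>i\<in>J. single i (f i))"

lemma lookup_vec_on: "finite J \<Longrightarrow> lookup (vec_on J f) i = (if i \<in> J then f i else 0)"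
  by (simp add: vec_on_def lookup_sum lookup_single when_def)

lemma keys_vec_on: "finite J \<Longrightarrow> keys (vec_on J f) \<subseteq> J"
  by (auto simp: in_keys_iff lookup_vec_on split: if_splits)

text \<open>\<open>N\<close> is a period of \<open>q\<close> and a multiple of \<open>v\<close>, so that monomials with exponents divisible by
  \<open>N\<close> lie in the Veronese subring and are central.\<close>

locale quantum_root = quantum n q for n :: nat and q :: "'k::field" +
  fixes v N :: nat
  assumes n_ge_2: "2 \<le> n" and v_pos: "0 < v" and N_pos: "0 < N"
    and root: "q ^ N = 1" and v_dvd_N: "v dvd N"
begin

abbreviation \<Lambda> where "\<Lambda> \<equiv> lattice n v"
abbreviation C where "C \<equiv> cone n v"

definition radical :: "(nat \<Rightarrow>\<^sub>0 int) set" where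
  "radical = {e \<in> \<Lambda>. \<forall>b\<in>\<Lambda>. chi e b = chi b e}"

lemma cone_lattice: "a \<in> C \<Longrightarrow> a \<in> \<Lambda>"
  by (simp add: cone_iff)

lemma radical_lattice: "e \<in> radical \<Longrightarrow> e \<in> \<Lambda>"
  by (simp add: radical_def)

lemma chi_frag_cmul:
  "chi (frag_cmul k a) b = chi a b powi k" "chi a (frag_cmul k b) = chi a b powi k"
  by (simp_all add: twist_form_frag_cmul_left twist_form_frag_cmul_right power_int_mult mult.commute[of k])

lemma radical_zero [simp]: "0 \<in> radical"
  by (simp add: radical_def)

lemma radical_add: "a \<in> radical \<Longrightarrow> b \<in> radical \<Longrightarrow> a + b \<in> radical"
  by (auto simp: radical_def lattice_add chi_add_left chi_add_right)

lemma radical_frag_cmul: "a \<in> radical \<Longrightarrow> frag_cmul k a \<in> radical"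
  by (auto simp: radical_def lattice_frag_cmul chi_frag_cmul)

lemma radical_uminus: "a \<in> radical \<Longrightarrow> - a \<in> radical"
  using radical_frag_cmul[of a "-1"] by simp

lemma radical_diff: "a \<in> radical \<Longrightarrow> b \<in> radical \<Longrightarrow> a - b \<in> radical"
  using radical_add[OF _ radical_uminus] by simp

lemma radical_add_iff: "b \<in> radical \<Longrightarrow> a + b \<in> radical \<longleftrightarrow> a \<in> radical"
  using radical_add[of a b] radical_diff[of "a + b" b] by auto

lemma root_powi: "(q powi m) powi int N = 1"
proof -
  have "(q powi m) powi int N = (q powi int N) powi m"
    by (simp only: power_int_mult[symmetric] mult.commute)
  then show ?thesis by (simp add: root)
qed

lemma root_power: "(q powi m) ^ N = 1"
  using root_powi[of m] by simp

lemma frag_cmul_N_radical: "keys a \<subseteq> {1..n} \<Longrightarrow> frag_cmul (int N) a \<in> radical"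
  using v_dvd_N
  by (simp add: radical_def lattice_def chi_frag_cmul root_power total_degree_frag_cmul keys_frag_cmul_subset)

lemma vec_on_N_radical:
  assumes "J \<subseteq> {1..n}" "\<And>i. i \<in> J \<Longrightarrow> f i = int N * g i"
  shows "vec_on J f \<in> radical"
proof -
  have J: "finite J" using assms(1) finite_subset by blast
  have "vec_on J f = frag_cmul (int N) (vec_on J g)"
    using assms(2) by (intro poly_mapping_eqI) (simp add: lookup_vec_on J)
  then show ?thesis
    using frag_cmul_N_radical[of "vec_on J g"] keys_vec_on[OF J, of g] assms(1) by auto
qed

text \<open>Adding multiples of \<open>N\<close> makes chosen coordinates large and stays in the same class modulo
  the radical.\<close>

lemma raise:
  assumes a: "a \<in> \<Lambda>" and J: "J \<subseteq> {1..n}"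
  obtains b where "b \<in> \<Lambda>" "b - a \<in> radical" "\<And>i. i \<in> J \<Longrightarrow> L \<le> lookup b i"
    "\<And>i. i \<notin> J \<Longrightarrow> lookup b i = lookup a i"
proof -
  define K where "K = \<bar>L\<bar> + (\<Sum>i\<in>{1..n}. \<bar>lookup a i\<bar>)"
  define e where "e = vec_on J (\<lambda>_. int N * K)"
  have fin: "finite J" using J finite_subset by blast
  have e: "e \<in> radical" unfolding e_def by (rule vec_on_N_radical[OF J, of _ "\<lambda>_. K"]) simp
  show thesis
  proof (rule that[of "a + e"])
    show "a + e \<in> \<Lambda>" by (rule lattice_add[OF a radical_lattice[OF e]])
    show "a + e - a \<in> radical" using e by simp
    show "lookup (a + e) i = lookup a i" if "i \<notin> J" for i
      using that by (simp add: lookup_add e_def lookup_vec_on fin)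
    fix i assume i: "i \<in> J"
    have "\<bar>lookup a i\<bar> \<le> (\<Sum>i\<in>{1..n}. \<bar>lookup a i\<bar>)"
      using i J by (intro member_le_sum) auto
    then have "L \<le> lookup a i + K" "0 \<le> K" by (simp_all add: K_def)
    moreover have "1 * K \<le> int N * K" using \<open>0 \<le> K\<close> N_pos by (intro mult_right_mono) auto
    ultimately show "L \<le> lookup (a + e) i"
      using i by (simp add: lookup_add e_def lookup_vec_on fin)
  qed
qed

lemma raise_to_cone:
  assumes "a \<in> \<Lambda>"
  obtains b where "b \<in> C" "b - a \<in> radical"
proof -
  obtain b where "b \<in> \<Lambda>" "b - a \<in> radical" "\<And>i. i \<in> {1..n} \<Longrightarrow> 0 \<le> lookup b i"
    using raise[OF assms order.refl, of 0] by metis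
  then show thesis using that[of b] by (simp add: cone_iff)
qed

text \<open>The cone meets every class of the lattice modulo the radical, so it detects the radical.\<close>

lemma radical_iff_cone: "e \<in> radical \<longleftrightarrow> e \<in> \<Lambda> \<and> (\<forall>b\<in>C. chi e b = chi b e)"
proof (intro iffI conjI ballI)
  assume e: "e \<in> \<Lambda> \<and> (\<forall>b\<in>C. chi e b = chi b e)"
  have "chi e b = chi b e" if b: "b \<in> \<Lambda>" for b
  proof -
    obtain b' where b': "b' \<in> C" "b' - b \<in> radical" using raise_to_cone[OF b] .
    have *: "chi e (b' - b) = chi (b' - b) e" using b'(2) e by (simp add: radical_def)
    have "chi e b * chi e (b' - b) = chi e b'" "chi b e * chi (b' - b) e = chi b' e"
      by (simp_all only: chi_add_left[symmetric] chi_add_right[symmetric] add_diff_cancel_left' diff_add_cancel add.commute[of b])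
    then have "chi e b * chi e (b' - b) = chi b e * chi e (b' - b)"
      using b'(1) e * by simp
    then show ?thesis using q_nonzero by simp
  qed
  then show "e \<in> radical" using e by (simp add: radical_def)
qed (auto simp: radical_def cone_lattice)

text \<open>\<open>a + b\<close> commutes with \<open>b\<close>, and so does \<open>b\<close> itself.\<close>

lemma commute_sum_radical:
  assumes "a + b \<in> radical" "b \<in> \<Lambda>"
  shows "chi a b = chi b a"
proof -
  have "chi (a + b) b = chi b (a + b)" using assms by (simp add: radical_def)
  then show ?thesis by (simp only: chi_add_left chi_add_right) (simp add: q_nonzero)
qed

subsection \<open>The centre and the projection onto it\<close>

lemma radical_commute: "keys f \<subseteq> radical \<Longrightarrow> keys g \<subseteq> \<Lambda> \<Longrightarrow> f \<star> g = g \<star> f"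
  by (rule tmul_commute) (auto simp: radical_def)

lemma centre_iff:
  assumes "keys f \<subseteq> C"
  shows "(\<forall>g. keys g \<subseteq> C \<longrightarrow> f \<star> g = g \<star> f) \<longleftrightarrow> keys f \<subseteq> radical"
proof (intro iffI allI impI subsetI)
  fix a assume comm: "\<forall>g. keys g \<subseteq> C \<longrightarrow> f \<star> g = g \<star> f" and a: "a \<in> keys f"
  show "a \<in> radical"
    unfolding radical_iff_cone
  proof (intro conjI ballI)
    show "a \<in> \<Lambda>" using a assms cone_lattice by blast
    fix b assume "b \<in> C"
    then have "f \<star> single b 1 = single b 1 \<star> f" using comm by simp
    then have "lookup (f \<star> single b 1) (a + b) = lookup (single b 1 \<star> f) (a + b)" by simp
    then show "chi a b = chi b a"
      using a by (simp add: lookup_tmul_single_left lookup_tmul_single_right in_keys_iff)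
  qed
qed (use assms cone_lattice in \<open>auto intro!: radical_commute\<close>)

abbreviation E where "E \<equiv> proj radical"

lemma E_trace: "keys f \<subseteq> \<Lambda> \<Longrightarrow> keys g \<subseteq> \<Lambda> \<Longrightarrow> E (f \<star> g) = E (g \<star> f)"
  by (rule proj_trace) (use commute_sum_radical in blast)

lemma E_linear:
  assumes "keys z \<subseteq> radical"
  shows "E (f \<star> z) = E f \<star> z" "E (z \<star> f) = z \<star> E f"
proof -
  have *: "a + b \<in> radical \<longleftrightarrow> a \<in> radical" if "b \<in> keys z" for a b
    using radical_add_iff assms that by blast
  show "E (f \<star> z) = E f \<star> z" by (rule proj_tmul_right[OF *])
  show "E (z \<star> f) = z \<star> E f"
    by (rule proj_tmul_left) (subst add.commute, rule *)
qed

subsection \<open>Automorphisms\<close>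

abbreviation B where "B \<equiv> monoid_alg C"
abbreviation Aut where "Aut \<equiv> alg_Aut B"

lemma keys_cone_tmul: "keys f \<subseteq> C \<Longrightarrow> keys g \<subseteq> C \<Longrightarrow> keys (f \<star> g) \<subseteq> C"
  by (rule keys_tmul_closed) (auto intro: cone_add)

lemma keys_cone_tpow: "keys f \<subseteq> C \<Longrightarrow> keys (tpow f k) \<subseteq> C"
  by (rule keys_tpow_closed) (auto intro: cone_add)

lemma keys_cone_add: "keys f \<subseteq> C \<Longrightarrow> keys g \<subseteq> C \<Longrightarrow> keys (f + g) \<subseteq> C"
  by (rule order.trans[OF keys_add Un_least])

lemma keys_cone_scalar: "keys f \<subseteq> C \<Longrightarrow> keys (single 0 c \<star> f) \<subseteq> C"
  by (cases "c = 0") (simp_all add: keys_scalar)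

lemma AutD:
  assumes "\<phi> \<in> carrier Aut"
  shows "\<And>f. keys f \<subseteq> C \<Longrightarrow> keys (\<phi> f) \<subseteq> C"
    "\<And>f g. keys f \<subseteq> C \<Longrightarrow> keys g \<subseteq> C \<Longrightarrow> \<phi> (f \<star> g) = \<phi> f \<star> \<phi> g"
    "\<And>f g. keys f \<subseteq> C \<Longrightarrow> keys g \<subseteq> C \<Longrightarrow> \<phi> (f + g) = \<phi> f + \<phi> g"
    "\<phi> 1 = 1" "\<And>f c. keys f \<subseteq> C \<Longrightarrow> \<phi> (single 0 c \<star> f) = single 0 c \<star> \<phi> f"
    "\<phi> 0 = 0"
proof -
  have \<phi>: "\<phi> \<in> alg_hom B B" using assms by (simp add: carrier_alg_Aut)
  show "\<And>f. keys f \<subseteq> C \<Longrightarrow> keys (\<phi> f) \<subseteq> C"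
    "\<And>f g. keys f \<subseteq> C \<Longrightarrow> keys g \<subseteq> C \<Longrightarrow> \<phi> (f \<star> g) = \<phi> f \<star> \<phi> g"
    "\<And>f g. keys f \<subseteq> C \<Longrightarrow> keys g \<subseteq> C \<Longrightarrow> \<phi> (f + g) = \<phi> f + \<phi> g"
    "\<phi> 1 = 1" and smult: "\<And>f c. keys f \<subseteq> C \<Longrightarrow> \<phi> (single 0 c \<star> f) = single 0 c \<star> \<phi> f"
    using alg_homD[OF \<phi>] by simp_all
  show "\<phi> 0 = 0" using smult[of 0 0] by simp
qed

lemma Aut_tpow: "\<phi> \<in> carrier Aut \<Longrightarrow> keys f \<subseteq> C \<Longrightarrow> \<phi> (tpow f k) = tpow (\<phi> f) k"
  by (induction k) (simp_all add: AutD keys_cone_tpow)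

lemma Aut_single:
  assumes "\<phi> \<in> carrier Aut" "a \<in> C"
  shows "\<phi> (single a c) = single 0 c \<star> \<phi> (single a 1)"
proof -
  have "\<phi> (single 0 c \<star> single a 1) = single 0 c \<star> \<phi> (single a 1)"
    using assms by (intro AutD(5)) simp_all
  then show ?thesis by simp
qed

lemma group_Aut: "group Aut"
  by (rule group_alg_Aut[OF alg_closed_cone_alg])

lemma Aut_inverse:
  assumes "\<phi> \<in> carrier Aut"
  obtains \<psi> where "\<psi> \<in> carrier Aut" "\<And>f. keys f \<subseteq> C \<Longrightarrow> \<phi> (\<psi> f) = f"
    "\<And>f. keys f \<subseteq> C \<Longrightarrow> \<psi> (\<phi> f) = f"
proof -
  interpret group Aut by (rule group_Aut)
  let ?\<psi> = "inv\<^bsub>Aut\<^esub> \<phi>"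
  have \<psi>: "?\<psi> \<in> carrier Aut" using assms by simp
  have eqs: "compose (carrier B) \<phi> ?\<psi> = (\<lambda>x\<in>carrier B. x)"
    "compose (carrier B) ?\<psi> \<phi> = (\<lambda>x\<in>carrier B. x)"
    using r_inv[OF assms] l_inv[OF assms]
    unfolding mult_alg_Aut[OF assms \<psi>] mult_alg_Aut[OF \<psi> assms] one_alg_Aut .
  have "\<phi> (?\<psi> f) = f" "?\<psi> (\<phi> f) = f" if "keys f \<subseteq> C" for f
    using that fun_cong[OF eqs(1), of f] fun_cong[OF eqs(2), of f] by (simp_all add: compose_eq)
  then show thesis using that \<psi> by blast
qed

lemma Aut_eq_0:
  assumes "\<phi> \<in> carrier Aut" "keys f \<subseteq> C" "\<phi> f = 0"
  shows "f = 0"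
proof -
  obtain \<psi> where "\<psi> \<in> carrier Aut" "\<psi> (\<phi> f) = f"
    using Aut_inverse[OF assms(1)] assms(2) by metis
  then show ?thesis using AutD(6)[of \<psi>] by (simp add: assms(3))
qed

lemma Aut_centre:
  assumes \<phi>: "\<phi> \<in> carrier Aut" and f: "keys f \<subseteq> C" "keys f \<subseteq> radical"
  shows "keys (\<phi> f) \<subseteq> radical"
proof -
  obtain \<psi> where \<psi>: "\<psi> \<in> carrier Aut" "\<And>f. keys f \<subseteq> C \<Longrightarrow> \<phi> (\<psi> f) = f"
    using Aut_inverse[OF \<phi>] by metis
  have "\<phi> f \<star> g = g \<star> \<phi> f" if g: "keys g \<subseteq> C" for g
  proof -
    have "f \<star> \<psi> g = \<psi> g \<star> f" using centre_iff[OF f(1)] f(2) AutD(1)[OF \<psi>(1) g] by blast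
    then have "\<phi> (f \<star> \<psi> g) = \<phi> (\<psi> g \<star> f)" by simp
    then show ?thesis using AutD(2)[OF \<phi>] f(1) AutD(1)[OF \<psi>(1) g] \<psi>(2)[OF g] by simp
  qed
  then show ?thesis using centre_iff[OF AutD(1)[OF \<phi> f(1)]] by blast
qed

text \<open>A noncentral monomial commutes with some other monomial up to a scalar \<open>l \<noteq> 1\<close>, and a power of
  the latter is central. Let \<open>w\<close> and \<open>u\<close> be their images, \<open>z = tpow u N\<close>. The trace property gives
  \<open>E (w \<star> z) = l E (w \<star> z)\<close>, so \<open>E w \<star> z = 0\<close>.\<close>

lemma E_Aut_noncentral:
  assumes \<phi>: "\<phi> \<in> carrier Aut" and c: "c \<in> C" "c \<notin> radical"
  shows "E (\<phi> (single c k)) = 0"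
proof -
  obtain b where b: "b \<in> C" "chi c b \<noteq> chi b c"
    using c radical_iff_cone[of c] cone_lattice by blast
  define l where "l = chi b c / chi c b"
  have l: "l \<noteq> 1" using b by (simp add: l_def q_nonzero)
  define u w where "u = \<phi> (single b 1)" and "w = \<phi> (single c k)"
  have "single b 1 \<star> single c k = single 0 l \<star> (single c k \<star> single b 1)"
    by (simp add: tmul_single l_def add.commute q_nonzero)
  moreover have bc: "keys (single b (1::'k)) \<subseteq> C" "keys (single c k) \<subseteq> C" using b c by (auto split: if_splits)
  ultimately have "\<phi> (single b 1 \<star> single c k) = \<phi> (single 0 l \<star> (single c k \<star> single b 1))"
    by simp
  then have uw: "u \<star> w = single 0 l \<star> (w \<star> u)"
    unfolding u_def w_def AutD(2)[OF \<phi> bc] AutD(5)[OF \<phi> keys_cone_tmul[OF bc(2,1)]]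
      AutD(2)[OF \<phi> bc(2,1)] .
  have uC: "keys u \<subseteq> C" "keys w \<subseteq> C" unfolding u_def w_def by (intro AutD(1)[OF \<phi>] bc)+
  obtain N' where N': "N = Suc N'" using N_pos by (cases N) auto
  define z where "z = tpow u N"
  have z: "z = \<phi> (tpow (single b 1) N)" using b by (simp add: z_def u_def Aut_tpow[OF \<phi>])
  have "keys (tpow (single b 1) N) \<subseteq> radical"
  proof -
    obtain c' where c': "tpow (single b 1) N = single (((+) b ^^ N) 0) c'" by (rule tpow_single)
    have "((+) b ^^ j) 0 = frag_cmul (int j) b" for j
      by (induction j) (simp_all add: frag_cmul_distrib)
    then show ?thesis using c' frag_cmul_N_radical[of b] b(1) by (simp add: cone_def)
  qed
  then have zr: "keys z \<subseteq> radical" unfolding z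
    using b by (intro Aut_centre[OF \<phi>] keys_cone_tpow) simp_all
  have "u \<noteq> 0" using Aut_eq_0[OF \<phi>, of "single b 1"] b by (auto simp: u_def)
  then have z0: "z \<noteq> 0" by (simp add: z_def tpow_nonzero)
  have sub: "keys f \<subseteq> C \<Longrightarrow> keys f \<subseteq> \<Lambda>" for f using cone_lattice by blast
  have "E (u \<star> (w \<star> tpow u N')) = E (w \<star> tpow u N' \<star> u)"
    using uC by (intro E_trace sub keys_cone_tmul keys_cone_tpow)
  also have "w \<star> tpow u N' \<star> u = w \<star> z"
    using tpow_commute[of u u N'] by (simp add: tmul_assoc z_def N')
  finally have 1: "E (u \<star> (w \<star> tpow u N')) = E (w \<star> z)" .
  have "u \<star> (w \<star> tpow u N') = (u \<star> w) \<star> tpow u N'" by (simp only: tmul_assoc)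
  also have "\<dots> = single 0 l \<star> (w \<star> (u \<star> tpow u N'))" by (simp only: uw tmul_assoc)
  also have "u \<star> tpow u N' = z" by (simp only: z_def N' tpow.simps)
  finally have "u \<star> (w \<star> tpow u N') = single 0 l \<star> (w \<star> z)" .
  then have "E (w \<star> z) = single 0 l \<star> E (w \<star> z)"
    using 1 E_linear(2)[of "single 0 l" "w \<star> z"] by simp
  then have "single 0 (1 - l) \<star> E (w \<star> z) = 0"
    by (simp add: single_diff tmul_diff_left)
  then have "E w \<star> z = 0" using l E_linear(1)[OF zr, of w] by simp
  then show ?thesis using z0 by (simp add: w_def)
qed

lemma E_cone: "keys f \<subseteq> C \<Longrightarrow> keys (E f) \<subseteq> C"
  by (auto simp: keys_proj)

text \<open>The projection onto the centre depends only on the algebra structure, although it was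
  defined through monomials.\<close>

lemma E_Aut:
  assumes \<phi>: "\<phi> \<in> carrier Aut" and f: "keys f \<subseteq> C"
  shows "\<phi> (E f) = E (\<phi> f)"
proof -
  have "keys g \<subseteq> C \<and> \<phi> (E g) = E (\<phi> g)" if "keys g \<subseteq> C" for g
  proof (induction g rule: single_sum_induct)
    case (single a c)
    then have "a \<in> C" using that by blast
    then show ?case
    proof (cases "a \<in> radical")
      case True
      then have "keys (\<phi> (single a c)) \<subseteq> radical"
        using \<open>a \<in> C\<close> by (intro Aut_centre[OF \<phi>]) auto
      then show ?thesis using True \<open>a \<in> C\<close> by (simp add: proj_single proj_id)
    qed (use E_Aut_noncentral[OF \<phi>] in \<open>simp add: proj_single AutD[OF \<phi>]\<close>)
  next
    case (add g h)
    then show ?case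
      by (simp add: proj_add AutD[OF \<phi>] E_cone keys_cone_add)
  qed (simp add: AutD[OF \<phi>])
  then show ?thesis using f by blast
qed

end

section \<open>Automorphisms when all variables ramify over the centre\<close>

text \<open>\<open>d i\<close> generates the group of \<open>i\<close>-th coordinates of the radical; it is the ramification index
  of the variable \<open>x\<^sub>i\<close> over the centre.\<close>

locale rigid = quantum_root n q v N for n :: nat and q :: "'k::field" and v N :: nat +
  fixes d :: "nat \<Rightarrow> int"
  assumes d_ge_2: "i \<in> {1..n} \<Longrightarrow> 2 \<le> d i"
    and d_dvd: "e \<in> radical \<Longrightarrow> i \<in> {1..n} \<Longrightarrow> d i dvd lookup e i"
    and d_attained: "i \<in> {1..n} \<Longrightarrow> \<exists>e\<in>radical. lookup e i = d i"
begin

lemma ex_small_coordinate: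
  assumes k: "k \<in> \<Lambda>" and i: "i \<in> {1..n}"
  obtains a where "a \<in> C" "a - k \<in> radical" "lookup a i \<le> d i - 1"
proof -
  obtain \<rho> where \<rho>: "\<rho> \<in> radical" "lookup \<rho> i = d i" using d_attained[OF i] by blast
  define k' where "k' = k - frag_cmul (lookup k i div d i) \<rho>"
  have k': "k' \<in> \<Lambda>" "k - k' \<in> radical"
    unfolding k'_def using k \<rho>(1) by (simp_all add: lattice_diff radical_lattice radical_frag_cmul)
  have "lookup k' i = lookup k i mod d i"
    by (simp add: k'_def lookup_minus \<rho>(2) minus_div_mult_eq_mod)
  then have small: "0 \<le> lookup k' i" "lookup k' i \<le> d i - 1"
    using d_ge_2[OF i] pos_mod_bound[of "d i" "lookup k i"] by simp_all
  obtain a where a: "a \<in> \<Lambda>" "a - k' \<in> radical" "\<And>j. j \<in> {1..n} - {i} \<Longrightarrow> 0 \<le> lookup a j"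
    "\<And>j. j \<notin> {1..n} - {i} \<Longrightarrow> lookup a j = lookup k' j"
    using raise[OF k'(1), of "{1..n} - {i}" 0] by blast
  show thesis
  proof (rule that)
    show "a \<in> C" unfolding cone_iff using a small by (metis Diff_iff singletonD)
    show "a - k \<in> radical" using radical_diff[OF a(2) k'(2)] by simp
    show "lookup a i \<le> d i - 1" using a(4)[of i] small by simp
  qed
qed

subsection \<open>The inverse different\<close>

text \<open>A fraction with central denominator: \<open>y / x\<close> lies in the dual of \<open>B\<close> with respect to
  the form that sends \<open>a\<close> and \<open>b\<close> to \<open>E (a \<star> b)\<close>. Pairs avoid a localization of \<open>B\<close>.\<close>

definition dual_pair :: "((nat \<Rightarrow>\<^sub>0 int) \<Rightarrow>\<^sub>0 'k) \<Rightarrow> ((nat \<Rightarrow>\<^sub>0 int) \<Rightarrow>\<^sub>0 'k) \<Rightarrow> bool" where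
  "dual_pair y x \<longleftrightarrow>
     keys y \<subseteq> C \<and> keys x \<subseteq> C \<and> keys x \<subseteq> radical \<and> x \<noteq> 0 \<and>
     (\<forall>b. keys b \<subseteq> C \<longrightarrow> (\<exists>z. keys z \<subseteq> C \<and> E (y \<star> b) = x \<star> z))"

text \<open>\<open>z\<close> multiplies \<open>N\<close>-th powers of elements of the dual into \<open>B\<close>. The exponent \<open>N\<close> is
  chosen such that \<open>N (d i - 1)\<close> are the coordinates of an element of the radical; this makes the
  ideal principal.\<close>

definition in_different_power :: "((nat \<Rightarrow>\<^sub>0 int) \<Rightarrow>\<^sub>0 'k) \<Rightarrow> bool" where
  "in_different_power z \<longleftrightarrow>
     keys z \<subseteq> C \<and>
     (\<forall>y x. dual_pair y x \<longrightarrow> (\<exists>u. keys u \<subseteq> C \<and> z \<star> tpow y N = tpow x N \<star> u))"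

lemma Aut_dual_pair:
  assumes \<phi>: "\<phi> \<in> carrier Aut" and yx: "dual_pair y x"
  shows "dual_pair (\<phi> y) (\<phi> x)"
proof -
  obtain \<psi> where \<psi>: "\<psi> \<in> carrier Aut" "\<And>f. keys f \<subseteq> C \<Longrightarrow> \<phi> (\<psi> f) = f"
    using Aut_inverse[OF \<phi>] by metis
  have yx': "keys y \<subseteq> C" "keys x \<subseteq> C" "keys x \<subseteq> radical" "x \<noteq> 0"
    using yx by (simp_all add: dual_pair_def)
  have "\<exists>z. keys z \<subseteq> C \<and> E (\<phi> y \<star> b) = \<phi> x \<star> z" if b: "keys b \<subseteq> C" for b
  proof -
    have b': "keys (\<psi> b) \<subseteq> C" by (rule AutD(1)[OF \<psi>(1) b])
    then obtain z where z: "keys z \<subseteq> C" "E (y \<star> \<psi> b) = x \<star> z" using yx by (auto simp: dual_pair_def)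
    have "E (\<phi> y \<star> b) = E (\<phi> (y \<star> \<psi> b))"
      by (simp only: AutD(2)[OF \<phi> yx'(1) b'] \<psi>(2)[OF b])
    also have "\<dots> = \<phi> (E (y \<star> \<psi> b))"
      by (rule E_Aut[OF \<phi> keys_cone_tmul[OF yx'(1) b'], symmetric])
    also have "\<dots> = \<phi> x \<star> \<phi> z" by (simp only: z(2) AutD(2)[OF \<phi> yx'(2) z(1)])
    finally show ?thesis using AutD(1)[OF \<phi> z(1)] by blast
  qed
  moreover have "\<phi> x \<noteq> 0" using Aut_eq_0[OF \<phi> yx'(2)] yx'(4) by blast
  ultimately show ?thesis
    unfolding dual_pair_def
    using AutD(1)[OF \<phi> yx'(1)] AutD(1)[OF \<phi> yx'(2)] Aut_centre[OF \<phi> yx'(2,3)] by blast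
qed

lemma Aut_in_different_power:
  assumes \<phi>: "\<phi> \<in> carrier Aut" and z: "in_different_power z"
  shows "in_different_power (\<phi> z)"
proof -
  obtain \<psi> where \<psi>: "\<psi> \<in> carrier Aut" "\<And>f. keys f \<subseteq> C \<Longrightarrow> \<phi> (\<psi> f) = f"
    using Aut_inverse[OF \<phi>] by metis
  have zC: "keys z \<subseteq> C" using z by (simp add: in_different_power_def)
  have "\<exists>u. keys u \<subseteq> C \<and> \<phi> z \<star> tpow y N = tpow x N \<star> u" if yx: "dual_pair y x" for y x
  proof -
    have yx': "keys y \<subseteq> C" "keys x \<subseteq> C" using yx by (simp_all add: dual_pair_def)
    note \<psi>yx = AutD(1)[OF \<psi>(1) yx'(1)] AutD(1)[OF \<psi>(1) yx'(2)]
    obtain u where u: "keys u \<subseteq> C" "z \<star> tpow (\<psi> y) N = tpow (\<psi> x) N \<star> u"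
      using z Aut_dual_pair[OF \<psi>(1) yx] unfolding in_different_power_def by blast
    have "\<phi> z \<star> tpow y N = \<phi> (z \<star> tpow (\<psi> y) N)"
      by (simp only: AutD(2)[OF \<phi> zC keys_cone_tpow[OF \<psi>yx(1)]] Aut_tpow[OF \<phi> \<psi>yx(1)] \<psi>(2)[OF yx'(1)])
    also have "\<dots> = tpow x N \<star> \<phi> u"
      by (simp only: u(2) AutD(2)[OF \<phi> keys_cone_tpow[OF \<psi>yx(2)] u(1)] Aut_tpow[OF \<phi> \<psi>yx(2)] \<psi>(2)[OF yx'(2)])
    finally show ?thesis using AutD(1)[OF \<phi> u(1)] by blast
  qed
  then show ?thesis using AutD(1)[OF \<phi> zC] unfolding in_different_power_def by blast
qed

abbreviation dual_exponents where
  "dual_exponents \<equiv> {b \<in> \<Lambda>. \<forall>i\<in>{1..n}. - (d i - 1) \<le> lookup b i}"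

text \<open>The dual is spanned by monomials with \<open>i\<close>-th exponent at least \<open>-(d i - 1)\<close>. The element \<open>y\<close> is split
  into classes modulo the radical. A class can be moved into the radical by a monomial
  whose \<open>i\<close>-th exponent is at most \<open>d i - 1\<close>, and the condition on the projection says that the
  moved class is \<open>x\<close> times an element of \<open>B\<close>, whose exponents are nonnegative.\<close>

lemma dual_pair_quotient:
  assumes x: "keys x \<subseteq> radical" "x \<noteq> 0"
  shows "keys y \<subseteq> \<Lambda> \<Longrightarrow> (\<And>a. a \<in> C \<Longrightarrow> \<exists>z. keys z \<subseteq> C \<and> E (y \<star> single a 1) = x \<star> z) \<Longrightarrow>
    \<exists>w. keys w \<subseteq> dual_exponents \<and> y = x \<star> w"
proof (induction "card (keys y)" arbitrary: y rule: less_induct)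
  case less
  show ?case
  proof (cases "y = 0")
    case False
    then obtain k where k: "k \<in> keys y" by fastforce
    then have k\<Lambda>: "k \<in> \<Lambda>" using less.prems(1) by blast
    define P where "P = {a. a - k \<in> radical}"
    have kP: "k \<in> P" by (simp add: P_def)
    define y1 y2 where "y1 = proj P y" and "y2 = proj (- P) y"
    have y: "y = y1 + y2"
      by (intro poly_mapping_eqI) (simp add: y1_def y2_def lookup_add lookup_proj)
    have split: "E (f \<star> single a 1) = proj {c. c + a \<in> radical} f \<star> single a 1" for f a
      by (rule proj_tmul_right) (simp split: if_splits)
    \<comment> \<open>The class of \<open>k\<close> modulo the radical.\<close>
    have class_k: "{c. c + a \<in> radical} = P" if "a + k \<in> radical" for a
    proof -
      have "c + a \<in> radical \<longleftrightarrow> c - k \<in> radical" for c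
        using radical_add_iff[OF that, of "c - k"] by (simp add: algebra_simps)
      then show ?thesis by (simp add: P_def)
    qed
    have class_disj: "{c. c + a \<in> radical} \<inter> P = {}" if "a + k \<notin> radical" for a
    proof -
      have False if "c + a \<in> radical" "c - k \<in> radical" for c
        using radical_diff[OF that] \<open>a + k \<notin> radical\<close> by (simp add: algebra_simps)
      then show ?thesis by (auto simp: P_def)
    qed
    have "\<exists>w. keys w \<subseteq> dual_exponents \<and> y2 = x \<star> w"
    proof (rule less.hyps)
      have "keys y2 \<subseteq> keys y - {k}" using kP by (auto simp: y2_def keys_proj)
      then show "card (keys y2) < card (keys y)" using k by (intro psubset_card_mono) auto
      show "keys y2 \<subseteq> \<Lambda>" using less.prems(1) by (auto simp: y2_def keys_proj)
      fix a assume a: "a \<in> C"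
      show "\<exists>z. keys z \<subseteq> C \<and> E (y2 \<star> single a 1) = x \<star> z"
      proof (cases "a + k \<in> radical")
        case True
        then have "proj {c. c + a \<in> radical} y2 = 0"
          unfolding class_k[OF True] y2_def by (intro poly_mapping_eqI) (simp add: lookup_proj)
        then show ?thesis unfolding split by (intro exI[of _ 0]) simp
      next
        case False
        have "proj {c. c + a \<in> radical} y2 = proj {c. c + a \<in> radical} y"
          using class_disj[OF False] unfolding y2_def
          by (intro poly_mapping_eqI) (auto simp: lookup_proj)
        then show ?thesis using less.prems(2)[OF a] unfolding split by simp
      qed
    qed
    then obtain w2 where w2: "keys w2 \<subseteq> dual_exponents" "y2 = x \<star> w2"
      by blast
    have y1: "\<exists>a z. a \<in> C \<and> lookup a i \<le> d i - 1 \<and> keys z \<subseteq> C \<and> y1 \<star> single a 1 = x \<star> z"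
      if i: "i \<in> {1..n}" for i
    proof -
      obtain a where a: "a \<in> C" "a - (- k) \<in> radical" "lookup a i \<le> d i - 1"
        using ex_small_coordinate[OF lattice_uminus[OF k\<Lambda>] i] .
      then have "a + k \<in> radical" by simp
      obtain z where "keys z \<subseteq> C" "E (y \<star> single a 1) = x \<star> z" using less.prems(2)[OF a(1)] by blast
      then show ?thesis
        using a unfolding split class_k[OF \<open>a + k \<in> radical\<close>] y1_def by blast
    qed
    have "1 \<in> {1..n}" using n_ge_2 by simp
    from y1[OF this] obtain a z where a: "a \<in> C" "keys z \<subseteq> C" "y1 \<star> single a 1 = x \<star> z" by blast
    obtain c where c: "single a 1 \<star> single (- a) c = (1 :: _ \<Rightarrow>\<^sub>0 'k)" by (rule monomial_inverse)
    define w1 where "w1 = z \<star> single (- a) c"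
    have y1_eq: "y1 = x \<star> w1"
    proof -
      have "y1 = y1 \<star> (single a 1 \<star> single (- a) c)" by (simp only: c tmul_one)
      also have "\<dots> = y1 \<star> single a 1 \<star> single (- a) c" by (simp only: tmul_assoc)
      also have "\<dots> = x \<star> w1" by (simp only: a(3) w1_def tmul_assoc)
      finally show ?thesis .
    qed
    have w1_lattice: "keys w1 \<subseteq> \<Lambda>"
      unfolding w1_def
    proof (rule keys_tmul_closed[of \<Lambda> \<Lambda>])
      show "keys z \<subseteq> \<Lambda>" using a(2) cone_lattice by blast
      show "keys (single (- a) c) \<subseteq> \<Lambda>" using a(1) by (simp add: cone_lattice lattice_uminus)
    qed (rule lattice_add)
    have w1_bound: "- (d i - 1) \<le> lookup b i" if i: "i \<in> {1..n}" and b: "b \<in> keys w1" for i b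
    proof -
      obtain a' z' where a': "a' \<in> C" "lookup a' i \<le> d i - 1" "keys z' \<subseteq> C" "y1 \<star> single a' 1 = x \<star> z'"
        using y1[OF i] by blast
      then have "x \<star> (w1 \<star> single a' 1) = x \<star> z'" by (simp only: y1_eq tmul_assoc)
      then have "w1 \<star> single a' 1 = z'" by (rule tmul_left_cancel[OF x(2)])
      then have "b + a' \<in> C" using keys_tmul_single_right[OF b, of 1 a'] a'(3) by auto
      then show ?thesis using a'(2) i by (auto simp: cone_iff lookup_add dest!: bspec[of _ _ i])
    qed
    have "keys w1 \<subseteq> dual_exponents"
      by (intro subsetI CollectI conjI ballI w1_bound subsetD[OF w1_lattice])
    then have "keys (w1 + w2) \<subseteq> dual_exponents"
      using w2(1) by (rule order.trans[OF keys_add Un_least])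
    moreover have "y = x \<star> (w1 + w2)" by (simp only: y y1_eq w2(2) tmul_add_right)
    ultimately show ?thesis by blast
  qed (auto intro: exI[of _ 0])
qed

subsection \<open>An invariant principal ideal\<close>

definition X_exp :: "nat \<Rightarrow>\<^sub>0 int" where
  "X_exp = vec_on {1..n} (\<lambda>i. int N * (d i - 1))"

definition X :: "(nat \<Rightarrow>\<^sub>0 int) \<Rightarrow>\<^sub>0 'k" where
  "X = single X_exp 1"

lemma lookup_X_exp: "i \<in> {1..n} \<Longrightarrow> lookup X_exp i = int N * (d i - 1)"
  by (simp add: X_exp_def lookup_vec_on)

lemma X_exp_radical: "X_exp \<in> radical"
  unfolding X_exp_def by (rule vec_on_N_radical) auto

lemma X_exp_cone: "X_exp \<in> C"
  unfolding cone_iff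
proof
  show "\<forall>i\<in>{1..n}. 0 \<le> lookup X_exp i"
  proof
    fix i assume i: "i \<in> {1..n}"
    then show "0 \<le> lookup X_exp i" using d_ge_2[OF i] by (simp add: lookup_X_exp)
  qed
qed (rule radical_lattice[OF X_exp_radical])

lemma keys_X: "keys X = {X_exp}"
  by (simp add: X_def)

lemma keys_tpow_bound:
  assumes "keys w \<subseteq> dual_exponents"
  shows "keys (tpow w k) \<subseteq> {b \<in> \<Lambda>. \<forall>i\<in>{1..n}. - (int k * (d i - 1)) \<le> lookup b i}"
proof (induction k)
  case (Suc k)
  show ?case
    unfolding tpow.simps
  proof (rule keys_tmul_closed[OF _ assms Suc])
    fix a b assume "a \<in> dual_exponents"
      "b \<in> {b \<in> \<Lambda>. \<forall>i\<in>{1..n}. - (int k * (d i - 1)) \<le> lookup b i}"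
    then have ab: "a \<in> \<Lambda>" "b \<in> \<Lambda>" "\<And>i. i \<in> {1..n} \<Longrightarrow> - (d i - 1) \<le> lookup a i"
      "\<And>i. i \<in> {1..n} \<Longrightarrow> - (int k * (d i - 1)) \<le> lookup b i" by auto
    have "- (int (Suc k) * (d i - 1)) \<le> lookup (a + b) i" if "i \<in> {1..n}" for i
      using ab(3,4)[OF that] by (simp add: lookup_add algebra_simps)
    then show "a + b \<in> {b \<in> \<Lambda>. \<forall>i\<in>{1..n}. - (int (Suc k) * (d i - 1)) \<le> lookup b i}"
      using lattice_add[OF ab(1,2)] by blast
  qed
qed simp

lemma X_in_different_power: "in_different_power X"
  unfolding in_different_power_def
proof (intro conjI allI impI)
  show "keys X \<subseteq> C" using X_exp_cone by (simp add: keys_X)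
  fix y x assume yx: "dual_pair y x"
  then have x: "keys x \<subseteq> radical" "x \<noteq> 0" "keys y \<subseteq> \<Lambda>"
    using cone_lattice by (auto simp: dual_pair_def)
  have "\<exists>z. keys z \<subseteq> C \<and> E (y \<star> single a 1) = x \<star> z" if "a \<in> C" for a
  proof -
    have "keys (single a (1::'k)) \<subseteq> C" using that by simp
    then show ?thesis using yx unfolding dual_pair_def by blast
  qed
  from dual_pair_quotient[OF x(1,2,3) this] obtain w
    where w: "keys w \<subseteq> dual_exponents" "y = x \<star> w" by blast
  have "x \<star> w = w \<star> x" using w(1) by (intro radical_commute x) blast
  then have yN: "tpow y N = tpow x N \<star> tpow w N" unfolding w(2) by (rule tpow_tmul)
  have "keys (tpow x N) \<subseteq> \<Lambda>"
    using x(1) radical_lattice by (intro keys_tpow_closed lattice_add) auto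
  then have "X \<star> tpow x N = tpow x N \<star> X"
    using X_exp_radical by (intro radical_commute) (simp_all add: keys_X)
  then have "X \<star> tpow y N = tpow x N \<star> (X \<star> tpow w N)"
    by (simp only: yN tmul_assoc[symmetric])
  moreover have "keys (X \<star> tpow w N) \<subseteq> C"
  proof (rule keys_tmul_closed[OF _ order.refl keys_tpow_bound[OF w(1)]])
    fix a b assume "a \<in> keys X" "b \<in> {b \<in> \<Lambda>. \<forall>i\<in>{1..n}. - (int N * (d i - 1)) \<le> lookup b i}"
    then have "a = X_exp" "b \<in> \<Lambda>" "\<And>i. i \<in> {1..n} \<Longrightarrow> - (int N * (d i - 1)) \<le> lookup b i"
      by (auto simp: keys_X)
    moreover have "0 \<le> lookup X_exp i + lookup b i" if "i \<in> {1..n}" for i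
      using calculation(3)[OF that] lookup_X_exp[OF that] by linarith
    ultimately show "a + b \<in> C"
      unfolding cone_iff using lattice_add[OF cone_lattice[OF X_exp_cone]] by (simp add: lookup_add)
  qed
  ultimately show "\<exists>u. keys u \<subseteq> C \<and> X \<star> tpow y N = tpow x N \<star> u" by blast
qed

lemma funpow_add_frag_cmul: "((+) (a :: nat \<Rightarrow>\<^sub>0 int) ^^ k) 0 = frag_cmul (int k) a"
  by (induction k) (simp_all add: frag_cmul_distrib)

lemma tpow_monomial:
  obtains c where "tpow (single a (1::'k)) k = single (frag_cmul (int k) a) c" "c \<noteq> 0"
  using tpow_single[of a 1 k] unfolding funpow_add_frag_cmul by auto

text \<open>The bound is tested on one monomial of the dual. That it lies in the dual is where the
  divisibility by \<open>d i\<close> enters: a coordinate that is a multiple of \<open>d i\<close> and greater than \<open>- d i\<close>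
  is nonnegative.\<close>

lemma in_different_powerD:
  assumes z: "in_different_power z" and a: "a \<in> keys z" and i: "i \<in> {1..n}"
  shows "int N * (d i - 1) \<le> lookup a i"
proof -
  have "\<exists>j\<in>{1..n}. j \<noteq> i"
    using n_ge_2 by (cases "i = 1") (auto intro: bexI[of _ 1] bexI[of _ 2])
  then obtain j where j: "j \<in> {1..n}" "j \<noteq> i" by blast
  \<comment> \<open>A monomial of the inverse different whose \<open>i\<close>-th exponent is as small as possible.\<close>
  define c where "c = single j (d i - 1) - single i (d i - 1)"
  have c: "c \<in> \<Lambda>"
    using i j keys_diff[of "single j (d i - 1)" "single i (d i - 1)"]
    by (auto simp: c_def lattice_def total_degree_add[of _ _ "- _", simplified] total_degree_uminus total_degree_single split: if_splits)
  have c_lookup: "lookup c l = (if l = j then d i - 1 else 0) - (if l = i then d i - 1 else 0)" for l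
    by (simp add: c_def lookup_minus lookup_single when_def)
  define r where "r = vec_on {1..n} (\<lambda>l. int N * d i)"
  have r: "r \<in> radical" unfolding r_def by (rule vec_on_N_radical[of _ _ "\<lambda>_. d i"]) auto
  have di: "2 \<le> d i" by (rule d_ge_2[OF i])
  have Nd: "d i \<le> int N * d i" using di N_pos by simp
  have r_lookup: "lookup r l = int N * d i" if "l \<in> {1..n}" for l
    using that by (simp add: r_def lookup_vec_on)
  have rC: "r \<in> C" using r di by (auto simp: cone_iff radical_lattice r_lookup)
  have rcC: "r + c \<in> C"
    unfolding cone_iff
  proof (intro conjI ballI)
    show "r + c \<in> \<Lambda>" by (rule lattice_add[OF radical_lattice[OF r] c])
    show "0 \<le> lookup (r + c) l" if "l \<in> {1..n}" for l
    proof -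
      have "- (d i - 1) \<le> lookup c l" using di by (simp add: c_lookup)
      then have "0 \<le> lookup r l + lookup c l" using r_lookup[OF that] Nd by linarith
      then show ?thesis by (simp add: lookup_add)
    qed
  qed
  define x where "x = single r (1::'k)"
  define y where "y = x \<star> single c 1"
  have x: "keys x \<subseteq> radical" "keys x \<subseteq> C" "x \<noteq> 0" using r rC by (simp_all add: x_def)
  have "dual_pair y x"
    unfolding dual_pair_def
  proof (intro conjI allI impI x)
    show "keys y \<subseteq> C" using rcC by (simp add: y_def x_def tmul_single)
    fix b :: "(nat \<Rightarrow>\<^sub>0 int) \<Rightarrow>\<^sub>0 'k" assume b: "keys b \<subseteq> C"
    have "E (y \<star> b) = x \<star> E (single c 1 \<star> b)"
      using E_linear(2)[OF x(1)] by (simp only: y_def tmul_assoc)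
    moreover have "keys (E (single c 1 \<star> b)) \<subseteq> C"
    proof
      fix e assume "e \<in> keys (E (single c 1 \<star> b))"
      then have e: "e \<in> keys (single c 1 \<star> b)" "e \<in> radical" by (auto simp: keys_proj)
      then obtain b' where b': "b' \<in> keys b" "e = c + b'" using keys_tmul[of "single c 1" b] by auto
      then have "b' \<in> C" using b by blast
      have "0 \<le> lookup e l" if l: "l \<in> {1..n}" for l
      proof (cases "l = i")
        case True
        have ge: "- (d i - 1) \<le> lookup e i"
          using \<open>b' \<in> C\<close> i j by (auto simp: b'(2) lookup_add c_lookup cone_iff)
        obtain m where m: "lookup e i = d i * m" using d_dvd[OF e(2) i] by blast
        have "0 \<le> m"
        proof (rule ccontr)
          assume "\<not> 0 \<le> m"
          then have "d i * m \<le> d i * (- 1)" using di by (intro mult_left_mono) auto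
          then show False using ge m by simp
        qed
        then show ?thesis using True m di by simp
      next
        case False
        then show ?thesis using \<open>b' \<in> C\<close> l di by (auto simp: b'(2) lookup_add c_lookup cone_iff)
      qed
      then show "e \<in> C" using e(2) by (simp add: cone_iff radical_lattice)
    qed
    ultimately show "\<exists>z. keys z \<subseteq> C \<and> E (y \<star> b) = x \<star> z" by blast
  qed
  then obtain u where u: "keys u \<subseteq> C" "z \<star> tpow y N = tpow x N \<star> u"
    using z unfolding in_different_power_def by blast
  have zC: "keys z \<subseteq> C" using z by (simp add: in_different_power_def)
  have cx: "x \<star> single c 1 = single c 1 \<star> x" using c by (intro radical_commute x) simp
  have "keys (tpow x N) \<subseteq> radical"
    using x(1) by (intro keys_tpow_closed radical_add) auto
  then have "z \<star> tpow x N = tpow x N \<star> z"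
    using zC cone_lattice by (intro radical_commute[symmetric]) auto
  then have "tpow x N \<star> (z \<star> tpow (single c 1) N) = z \<star> tpow y N"
    unfolding y_def tpow_tmul[OF cx] by (simp only: tmul_assoc[symmetric])
  also have "\<dots> = tpow x N \<star> u" by (rule u(2))
  finally have "z \<star> tpow (single c 1) N = u"
    by (rule tmul_left_cancel[OF tpow_nonzero[OF x(3)]])
  moreover obtain k where k: "tpow (single c (1::'k)) N = single (frag_cmul (int N) c) k" "k \<noteq> 0"
    by (rule tpow_monomial)
  ultimately have "a + frag_cmul (int N) c \<in> C"
    using keys_tmul_single_right[OF a k(2)] u(1) by auto
  then have "0 \<le> lookup (a + frag_cmul (int N) c) i" using i by (simp add: cone_iff)
  then show ?thesis using j(2) by (simp add: lookup_add c_lookup algebra_simps)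
qed

lemma X_divides_Aut_X:
  assumes \<phi>: "\<phi> \<in> carrier Aut"
  obtains u where "keys u \<subseteq> C" "\<phi> X = X \<star> u"
proof -
  have D: "in_different_power (\<phi> X)"
    by (rule Aut_in_different_power[OF \<phi> X_in_different_power])
  obtain c where c: "single X_exp 1 \<star> single (- X_exp) c = (1 :: _ \<Rightarrow>\<^sub>0 'k)" by (rule monomial_inverse)
  show thesis
  proof (rule that)
    have "X \<star> (single (- X_exp) c \<star> \<phi> X) = (X \<star> single (- X_exp) c) \<star> \<phi> X" by (simp only: tmul_assoc)
    then show "\<phi> X = X \<star> (single (- X_exp) c \<star> \<phi> X)" by (simp add: X_def c)
    show "keys (single (- X_exp) c \<star> \<phi> X) \<subseteq> C"
    proof (rule keys_tmul_closed[OF _ order.refl order.refl])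
      fix a b assume "a \<in> keys (single (- X_exp) c)" and b: "b \<in> keys (\<phi> X)"
      then have a: "a = - X_exp" by (auto split: if_splits)
      have "b \<in> \<Lambda>" using D b cone_lattice by (auto simp: in_different_power_def)
      moreover have "0 \<le> lookup (a + b) i" if "i \<in> {1..n}" for i
        using in_different_powerD[OF D b that] lookup_X_exp[OF that] by (simp add: a lookup_minus)
      ultimately show "a + b \<in> C"
        unfolding cone_iff a using radical_lattice[OF X_exp_radical]
        by (simp add: lattice_diff)
    qed
  qed
qed


text \<open>\<open>X\<close> divides its images under an automorphism and under its inverse, so it changes by a unit
  of \<open>B\<close>. Units are monomials, and only the exponent \<open>0\<close> has its negative in the cone.\<close>

lemma Aut_X:
  assumes \<phi>: "\<phi> \<in> carrier Aut"
  obtains l where "\<phi> X = single X_exp l" "l \<noteq> 0"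
proof -
  obtain \<psi> where \<psi>: "\<psi> \<in> carrier Aut" "\<And>f. keys f \<subseteq> C \<Longrightarrow> \<phi> (\<psi> f) = f"
    using Aut_inverse[OF \<phi>] by metis
  obtain u where u: "keys u \<subseteq> C" "\<phi> X = X \<star> u" using X_divides_Aut_X[OF \<phi>] .
  obtain u' where u': "keys u' \<subseteq> C" "\<psi> X = X \<star> u'" using X_divides_Aut_X[OF \<psi>(1)] .
  have XC: "keys X \<subseteq> C" using X_exp_cone by (simp add: keys_X)
  have "X = \<phi> (\<psi> X)" using \<psi>(2)[OF XC] by simp
  also have "\<dots> = \<phi> X \<star> \<phi> u'" unfolding u'(2) by (rule AutD(2)[OF \<phi> XC u'(1)])
  also have "\<dots> = X \<star> (u \<star> \<phi> u')" by (simp only: u(2) tmul_assoc)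
  finally have "X \<star> 1 = X \<star> (u \<star> \<phi> u')" by simp
  then have "1 = u \<star> \<phi> u'" by (rule tmul_left_cancel[rotated]) (simp add: X_def)
  then have unit: "u \<star> \<phi> u' = single 0 1" by simp
  then obtain a l where a: "u = single a l" "l \<noteq> 0" by (rule factor_of_monomial) simp
  have "\<phi> u' \<noteq> 0" using unit by (metis single_eq_0_iff tmul_zero(2) zero_neq_one)
  then obtain b where b: "b \<in> keys (\<phi> u')" by fastforce
  have "lookup (single a l \<star> \<phi> u') (b + a) \<noteq> 0"
    using b a(2) chi_nonzero[of a b] lookup_tmul_single_left[of a l "\<phi> u'" b] 
    by (auto simp: in_keys_iff add.commute)
  then have "b + a = 0" using unit unfolding a(1) by (metis lookup_single_not_eq)
  have "lookup a i = 0" for i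
  proof -
    have "0 \<le> lookup a i" using u(1) a by (simp add: cone_def)
    moreover have "0 \<le> lookup b i" using b AutD(1)[OF \<phi> u'(1)] by (auto simp: cone_def)
    moreover have "lookup b i + lookup a i = 0"
      using \<open>b + a = 0\<close> by (metis lookup_add lookup_zero)
    ultimately show ?thesis by linarith
  qed
  then have "a = 0" by (intro poly_mapping_eqI) simp
  then have "\<phi> X = single X_exp l" using u(2) a(1) by (simp add: X_def tmul_single)
  then show thesis using that a(2) by blast
qed

subsection \<open>Automorphisms permute the monomials\<close>

text \<open>The image of \<open>x\<^sup>a\<close> divides the image of the \<open>k\<close>-th power of \<open>X\<close>, a monomial with the same
  exponent as that power itself.\<close>

lemma Aut_monomial_multiple:
  assumes \<phi>: "\<phi> \<in> carrier Aut" and a: "a \<in> C" "a' \<in> C" "a + a' = frag_cmul (int k) X_exp"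
  obtains b l b' where "b \<in> C" "b' \<in> C" "l \<noteq> 0" "\<phi> (single a 1) = single b l"
    "b + b' = frag_cmul (int k) X_exp"
proof -
  obtain l where l: "\<phi> X = single X_exp l" "l \<noteq> 0" by (rule Aut_X[OF \<phi>])
  obtain c where c: "tpow X k = single (a + a') c" "c \<noteq> 0"
    unfolding a(3) X_def by (rule tpow_monomial)
  obtain c' where c': "tpow (\<phi> X) k = single (a + a') c'" "c' \<noteq> 0"
    using tpow_single[of X_exp l k] l unfolding funpow_add_frag_cmul a(3) by auto
  have XC: "keys X \<subseteq> C" using X_exp_cone by (simp add: keys_X)
  have aC: "keys (single a (1::'k)) \<subseteq> C" "keys (single a' (1::'k)) \<subseteq> C" using a by simp_all
  have "single a 1 \<star> single a' 1 = single 0 (chi a a' / c) \<star> tpow X k"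
    using c(2) by (simp add: tmul_single c(1))
  then have "\<phi> (single a 1 \<star> single a' 1) = \<phi> (single 0 (chi a a' / c) \<star> tpow X k)" by simp
  then have eq: "\<phi> (single a 1) \<star> \<phi> (single a' 1) = single (a + a') (chi a a' / c * c')"
    unfolding AutD(2)[OF \<phi> aC] AutD(5)[OF \<phi> keys_cone_tpow[OF XC]] Aut_tpow[OF \<phi> XC] c'(1)
    by simp
  have nz: "chi a a' / c * c' \<noteq> 0" using c(2) c'(2) q_nonzero by simp
  obtain b m where b: "\<phi> (single a 1) = single b m" "m \<noteq> 0"
    using factor_of_monomial[OF eq nz] .
  have "\<phi> (single a' 1) \<noteq> 0" using eq nz by (metis single_eq_0_iff tmul_zero(2))
  then obtain b' where b': "b' \<in> keys (\<phi> (single a' 1))" by fastforce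
  have "lookup (single b m \<star> \<phi> (single a' 1)) (b' + b) \<noteq> 0"
    using b' b(2) chi_nonzero[of b b'] lookup_tmul_single_left[of b m "\<phi> (single a' 1)" b']
    by (auto simp: in_keys_iff add.commute)
  then have "b' + b = a + a'" using eq unfolding b(1) by (metis lookup_single_not_eq)
  moreover have "b \<in> C" using AutD(1)[OF \<phi> aC(1)] b by simp
  moreover have "b' \<in> C" using AutD(1)[OF \<phi> aC(2)] b' by blast
  ultimately show thesis using that[of b b' m] b a(3) by (simp add: add.commute)
qed

lemma X_exp_complement:
  assumes a: "a \<in> C" and le: "\<And>i. i \<in> {1..n} \<Longrightarrow> lookup a i \<le> int k"
  shows "frag_cmul (int k) X_exp - a \<in> C"
  unfolding cone_iff
proof (intro conjI ballI)
  show "frag_cmul (int k) X_exp - a \<in> \<Lambda>"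
    by (intro lattice_diff lattice_frag_cmul cone_lattice X_exp_cone a)
  fix i assume i: "i \<in> {1..n}"
  have "1 \<le> int N * (d i - 1)" using d_ge_2[OF i] N_pos by (smt (verit) mult_le_cancel_left1 of_nat_0_less_iff)
  then have "int k * 1 \<le> int k * (int N * (d i - 1))" by (intro mult_left_mono) auto
  then show "0 \<le> lookup (frag_cmul (int k) X_exp - a) i"
    using le[OF i] by (simp add: lookup_minus lookup_X_exp[OF i])
qed

lemma Aut_monomial:
  assumes \<phi>: "\<phi> \<in> carrier Aut" and a: "a \<in> C"
  obtains b l where "b \<in> C" "l \<noteq> 0" "\<phi> (single a 1) = single b l"
proof -
  define k where "k = nat (\<Sum>i\<in>{1..n}. lookup a i)"
  have "lookup a i \<le> int k" if "i \<in> {1..n}" for i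
  proof -
    have "lookup a i \<le> (\<Sum>i\<in>{1..n}. lookup a i)"
      using that a by (intro member_le_sum) (auto simp: cone_def)
    then show ?thesis by (simp add: k_def)
  qed
  then have "frag_cmul (int k) X_exp - a \<in> C" by (rule X_exp_complement[OF a])
  from Aut_monomial_multiple[OF \<phi> a this, of k] show thesis using that by (metis add.commute diff_add_cancel)
qed

definition exponent_perm :: "(((nat \<Rightarrow>\<^sub>0 int) \<Rightarrow>\<^sub>0 'k) \<Rightarrow> ((nat \<Rightarrow>\<^sub>0 int) \<Rightarrow>\<^sub>0 'k)) \<Rightarrow> (nat \<Rightarrow>\<^sub>0 int) \<Rightarrow> (nat \<Rightarrow>\<^sub>0 int)" where
  "exponent_perm \<phi> = (\<lambda>a\<in>C. the_elem (keys (\<phi> (single a 1))))"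

lemma exponent_perm_eqI:
  "a \<in> C \<Longrightarrow> \<phi> (single a 1) = single b l \<Longrightarrow> l \<noteq> 0 \<Longrightarrow> exponent_perm \<phi> a = b"
  by (simp add: exponent_perm_def)

lemma exponent_perm:
  assumes "\<phi> \<in> carrier Aut" "a \<in> C"
  shows "exponent_perm \<phi> a \<in> C"
    "\<exists>l. l \<noteq> 0 \<and> \<phi> (single a 1) = single (exponent_perm \<phi> a) l"
proof -
  obtain b l where "b \<in> C" "l \<noteq> 0" "\<phi> (single a 1) = single b l" using Aut_monomial[OF assms] .
  then show "exponent_perm \<phi> a \<in> C"
    "\<exists>l. l \<noteq> 0 \<and> \<phi> (single a 1) = single (exponent_perm \<phi> a) l"
    using exponent_perm_eqI[OF assms(2)] by auto
qed

lemma exponent_perm_compose: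
  assumes \<phi>: "\<phi> \<in> carrier Aut" and \<psi>: "\<psi> \<in> carrier Aut" and a: "a \<in> C"
    and \<chi>: "\<chi> (single a 1) = \<phi> (\<psi> (single a 1))"
  shows "exponent_perm \<chi> a = exponent_perm \<phi> (exponent_perm \<psi> a)"
proof -
  obtain l where l: "l \<noteq> 0" "\<psi> (single a 1) = single (exponent_perm \<psi> a) l"
    using exponent_perm(2)[OF \<psi> a] by blast
  have b: "exponent_perm \<psi> a \<in> C" by (rule exponent_perm(1)[OF \<psi> a])
  obtain m where m: "m \<noteq> 0" "\<phi> (single (exponent_perm \<psi> a) 1) = single (exponent_perm \<phi> (exponent_perm \<psi> a)) m"
    using exponent_perm(2)[OF \<phi> b] by blast
  have "\<chi> (single a 1) = single (exponent_perm \<phi> (exponent_perm \<psi> a)) (l * m)"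
    unfolding \<chi> l(2) Aut_single[OF \<phi> b, of l] m(2) by simp
  from exponent_perm_eqI[where \<phi> = \<chi> and l = "l * m", OF a this]
  show ?thesis using l(1) m(1) by simp
qed

lemma exponent_perm_hom: "group_hom Aut (BijGroup C) exponent_perm"
proof -
  have inv: "exponent_perm \<phi> (exponent_perm \<psi> a) = a"
    if "\<phi> \<in> carrier Aut" "\<psi> \<in> carrier Aut" "a \<in> C" "\<phi> (\<psi> (single a 1)) = single a 1" for \<phi> \<psi> a
  proof -
    have "exponent_perm id a = exponent_perm \<phi> (exponent_perm \<psi> a)"
      using that by (intro exponent_perm_compose) simp_all
    moreover have "exponent_perm id a = a" using that by (intro exponent_perm_eqI[of _ _ _ 1]) simp_all
    ultimately show ?thesis by simp
  qed
  have mem: "exponent_perm \<phi> \<in> Bij C" if \<phi>: "\<phi> \<in> carrier Aut" for \<phi>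
  proof -
    obtain \<psi> where \<psi>: "\<psi> \<in> carrier Aut" "\<And>f. keys f \<subseteq> C \<Longrightarrow> \<phi> (\<psi> f) = f"
      "\<And>f. keys f \<subseteq> C \<Longrightarrow> \<psi> (\<phi> f) = f" by (rule Aut_inverse[OF \<phi>]) blast
    have "bij_betw (exponent_perm \<phi>) C C"
    proof (rule bij_betwI[of _ _ _ "exponent_perm \<psi>"])
      show "exponent_perm \<psi> (exponent_perm \<phi> a) = a" if "a \<in> C" for a
        by (rule inv[OF \<psi>(1) \<phi> that \<psi>(3)]) (simp add: that)
      show "exponent_perm \<phi> (exponent_perm \<psi> a) = a" if "a \<in> C" for a
        by (rule inv[OF \<phi> \<psi>(1) that \<psi>(2)]) (simp add: that)
    qed (auto intro: exponent_perm(1) \<phi> \<psi>(1))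
    then show ?thesis by (simp add: Bij_def exponent_perm_def)
  qed
  show ?thesis
  proof (intro group_hom.intro group_hom_axioms.intro group_Aut group_BijGroup homI)
    show "exponent_perm \<phi> \<in> carrier (BijGroup C)" if "\<phi> \<in> carrier Aut" for \<phi>
      using mem[OF that] by (simp add: BijGroup_def)
    fix \<phi> \<psi> assume \<phi>: "\<phi> \<in> carrier Aut" and \<psi>: "\<psi> \<in> carrier Aut"
    have "exponent_perm (\<phi> \<otimes>\<^bsub>Aut\<^esub> \<psi>) a = exponent_perm \<phi> (exponent_perm \<psi> a)" if a: "a \<in> C" for a
      using a by (intro exponent_perm_compose[OF \<phi> \<psi> a]) (simp add: mult_alg_Aut[OF \<phi> \<psi>] compose_def)
    then have "exponent_perm (\<phi> \<otimes>\<^bsub>Aut\<^esub> \<psi>) = compose C (exponent_perm \<phi>) (exponent_perm \<psi>)"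
      by (intro extensionalityI[of _ C]) (auto simp: compose_def exponent_perm_def)
    then show "exponent_perm (\<phi> \<otimes>\<^bsub>Aut\<^esub> \<psi>) = exponent_perm \<phi> \<otimes>\<^bsub>BijGroup C\<^esub> exponent_perm \<psi>"
      using mem[OF \<phi>] mem[OF \<psi>] by (simp add: BijGroup_def)
  qed
qed

lemma kernel_commute:
  assumes \<phi>: "\<phi> \<in> kernel Aut (BijGroup C) exponent_perm"
    and \<psi>: "\<psi> \<in> kernel Aut (BijGroup C) exponent_perm"
  shows "\<phi> \<otimes>\<^bsub>Aut\<^esub> \<psi> = \<psi> \<otimes>\<^bsub>Aut\<^esub> \<phi>"
proof -
  have ker: "\<chi> \<in> carrier Aut" "\<And>a. a \<in> C \<Longrightarrow> \<exists>l. \<chi> (single a 1) = single a l"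
    if "\<chi> \<in> kernel Aut (BijGroup C) exponent_perm" for \<chi>
  proof -
    show \<chi>: "\<chi> \<in> carrier Aut" using that by (simp add: kernel_def)
    fix a assume a: "a \<in> C"
    have "exponent_perm \<chi> = (\<lambda>x\<in>C. x)" using that by (simp add: kernel_def BijGroup_def)
    then show "\<exists>l. \<chi> (single a 1) = single a l" using exponent_perm(2)[OF \<chi> a] a by auto
  qed
  note A = ker(1)[OF \<phi>] ker(1)[OF \<psi>]
  have "keys f \<subseteq> C \<and> \<phi> (\<psi> f) = \<psi> (\<phi> f)" if f: "keys f \<subseteq> C" for f
  proof (induction f rule: single_sum_induct)
    case (single a c)
    then have a: "a \<in> C" using f by blast
    obtain l m where lm: "\<phi> (single a 1) = single a l" "\<psi> (single a 1) = single a m"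
      using ker(2)[OF \<phi> a] ker(2)[OF \<psi> a] by blast
    have "\<phi> (single a c') = single a (c' * l)" "\<psi> (single a c') = single a (c' * m)" for c'
      using Aut_single[OF A(1) a, of c'] Aut_single[OF A(2) a, of c'] lm by simp_all
    then show ?case using a by (auto simp: mult_ac)
  next
    case (add g h)
    then show ?case using AutD(1,3)[OF A(1)] AutD(1,3)[OF A(2)] by (simp add: keys_cone_add)
  qed (simp add: AutD(6)[OF A(1)] AutD(6)[OF A(2)])
  then show ?thesis
    unfolding mult_alg_Aut[OF A] mult_alg_Aut[OF A(2,1)]
    by (intro extensionalityI[of _ "carrier B"]) (auto simp: compose_def)
qed

lemma exponent_perm_add:
  assumes \<phi>: "\<phi> \<in> carrier Aut" and a: "a \<in> C" "b \<in> C"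
  shows "exponent_perm \<phi> (a + b) = exponent_perm \<phi> a + exponent_perm \<phi> b"
proof -
  obtain l m where lm: "l \<noteq> 0" "\<phi> (single a 1) = single (exponent_perm \<phi> a) l"
    "m \<noteq> 0" "\<phi> (single b 1) = single (exponent_perm \<phi> b) m"
    using exponent_perm(2)[OF \<phi>] a by blast
  have ab: "a + b \<in> C" by (rule cone_add[OF a])
  have ks: "keys (single a (1::'k)) \<subseteq> C" "keys (single b (1::'k)) \<subseteq> C" using a by simp_all
  have "single (a + b) 1 = single 0 (1 / chi a b) \<star> (single a 1 \<star> single b 1)"
    using q_nonzero by (simp add: tmul_single)
  then have "\<phi> (single (a + b) 1) = single 0 (1 / chi a b) \<star> (\<phi> (single a 1) \<star> \<phi> (single b 1))"
    by (simp only: AutD(5)[OF \<phi> keys_cone_tmul[OF ks]] AutD(2)[OF \<phi> ks])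
  then show ?thesis
    using lm q_nonzero
    by (intro exponent_perm_eqI[OF ab, of _ _ "1 / chi a b * (chi (exponent_perm \<phi> a) (exponent_perm \<phi> b) * (l * m))"])
       (auto simp: tmul_single)
qed

lemma exponent_perm_zero:
  assumes "\<phi> \<in> carrier Aut"
  shows "exponent_perm \<phi> 0 = 0"
  using exponent_perm_add[OF assms, of 0 0] by simp

lemma cone_multiple: "a \<in> C \<Longrightarrow> frag_cmul (int k) a \<in> C"
  by (induction k) (simp_all add: frag_cmul_distrib cone_add)

lemma exponent_perm_multiple:
  "\<phi> \<in> carrier Aut \<Longrightarrow> a \<in> C \<Longrightarrow>
     exponent_perm \<phi> (frag_cmul (int k) a) = frag_cmul (int k) (exponent_perm \<phi> a)"
  by (induction k) (simp_all add: frag_cmul_distrib exponent_perm_add cone_multiple exponent_perm_zero)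

lemma unit_multiple_cone: "i \<in> {1..n} \<Longrightarrow> single i (int v) \<in> C"
  by (auto simp: cone_def total_degree_single lookup_single when_def)

lemma exponent_perm_determined:
  assumes \<phi>: "\<phi> \<in> carrier Aut" and \<psi>: "\<psi> \<in> carrier Aut"
    and eq: "\<And>i. i \<in> {1..n} \<Longrightarrow> exponent_perm \<phi> (single i (int v)) = exponent_perm \<psi> (single i (int v))"
  shows "exponent_perm \<phi> = exponent_perm \<psi>"
proof (rule extensionalityI[of _ C])
  fix a assume a: "a \<in> C"
  define c where "c i = nat (lookup a i)" for i
  have *: "exponent_perm \<chi> (\<Sum>i\<in>J. frag_cmul (int (c i)) (single i (int v))) =
      (\<Sum>i\<in>J. frag_cmul (int (c i)) (exponent_perm \<chi> (single i (int v)))) \<and>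
      (\<Sum>i\<in>J. frag_cmul (int (c i)) (single i (int v))) \<in> C"
    if "finite J" "J \<subseteq> {1..n}" "\<chi> \<in> carrier Aut" for J \<chi>
    using that
  proof (induction J rule: finite_induct)
    case (insert i J)
    then have i: "single i (int v) \<in> C" by (intro unit_multiple_cone) simp
    have "J \<subseteq> {1..n}" using insert.prems by simp
    note IH = insert.IH[OF this insert.prems(2)]
    have "frag_cmul (int (c i)) (single i (int v)) + (\<Sum>i\<in>J. frag_cmul (int (c i)) (single i (int v))) \<in> C"
      by (rule cone_add[OF cone_multiple[OF i] conjunct2[OF IH]])
    then show ?case
      unfolding sum.insert[OF insert.hyps] exponent_perm_add[OF insert.prems(2) cone_multiple[OF i] conjunct2[OF IH]]
      using IH by (simp only: exponent_perm_multiple[OF insert.prems(2) i] simp_thms)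
  qed (simp add: exponent_perm_zero)
  have "frag_cmul (int v) a = (\<Sum>i\<in>{1..n}. frag_cmul (int (c i)) (single i (int v)))"
  proof (rule poly_mapping_eqI)
    fix j
    have "lookup (\<Sum>i\<in>{1..n}. frag_cmul (int (c i)) (single i (int v))) j =
        (\<Sum>i\<in>{1..n}. if i = j then lookup a j * int v else 0)"
      unfolding lookup_sum using a by (intro sum.cong refl) (auto simp: lookup_single when_def cone_def c_def)
    also have "\<dots> = int v * lookup a j" using a by (auto simp: cone_def in_keys_iff)
    finally show "lookup (frag_cmul (int v) a) j =
        lookup (\<Sum>i\<in>{1..n}. frag_cmul (int (c i)) (single i (int v))) j" by simp
  qed
  then have "exponent_perm \<phi> (frag_cmul (int v) a) = exponent_perm \<psi> (frag_cmul (int v) a)"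
    using *[OF _ order.refl \<phi>] *[OF _ order.refl \<psi>] eq by simp
  then have "frag_cmul (int v) (exponent_perm \<phi> a) = frag_cmul (int v) (exponent_perm \<psi> a)"
    by (simp only: exponent_perm_multiple[OF \<phi> a] exponent_perm_multiple[OF \<psi> a])
  then have "int v * lookup (exponent_perm \<phi> a) i = int v * lookup (exponent_perm \<psi> a) i" for i
    by (metis lookup_frag_cmul)
  then show "exponent_perm \<phi> a = exponent_perm \<psi> a"
    using v_pos by (intro poly_mapping_eqI) simp
qed (simp_all add: exponent_perm_def)

lemma exponent_perm_bounded:
  assumes \<phi>: "\<phi> \<in> carrier Aut" and i: "i \<in> {1..n}"
  shows "lookup (exponent_perm \<phi> (single i (int v))) j \<le> int N * lookup X_exp j"
proof -
  have "v \<le> N" using v_dvd_N N_pos by (rule dvd_imp_le)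
  then have "frag_cmul (int N) X_exp - single i (int v) \<in> C"
    using N_pos by (intro X_exp_complement unit_multiple_cone i) (simp add: lookup_single when_def)
  then obtain b l b' where b: "b \<in> C" "b' \<in> C" "l \<noteq> 0" "\<phi> (single (single i (int v)) 1) = single b l"
    "b + b' = frag_cmul (int N) X_exp"
    using Aut_monomial_multiple[OF \<phi> unit_multiple_cone[OF i], of _ N] by (metis add.commute diff_add_cancel)
  have "exponent_perm \<phi> (single i (int v)) = b"
    using exponent_perm_eqI[OF unit_multiple_cone[OF i], of \<phi> b l] b(3,4) by simp
  moreover have "lookup b j + lookup b' j = int N * lookup X_exp j"
    using b(5) by (metis lookup_add lookup_frag_cmul)
  moreover have "0 \<le> lookup b' j" using b(2) by (simp add: cone_def)
  ultimately show ?thesis by simp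
qed

lemma finite_box: "finite {b \<in> C. \<forall>j. lookup b j \<le> lookup m j}"
proof -
  define K where "K = Max (insert 0 (lookup m ` {1..n}))"
  have K: "lookup m j \<le> K" if "j \<in> {1..n}" for j using that unfolding K_def by (intro Max_ge) auto
  have "lookup ` {b \<in> C. \<forall>j. lookup b j \<le> lookup m j} \<subseteq>
      {f. \<forall>j. (j \<in> {1..n} \<longrightarrow> f j \<in> {0..K}) \<and> (j \<notin> {1..n} \<longrightarrow> f j = 0)}"
  proof (intro subsetI CollectI, elim imageE, intro allI conjI impI)
    fix f b j assume f: "f = lookup b" and b: "b \<in> {b \<in> C. \<forall>j. lookup b j \<le> lookup m j}"
    show "f j \<in> {0..K}" if "j \<in> {1..n}"
      using b K[OF that] by (auto simp: f cone_def intro: order.trans)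
    show "f j = 0" if "j \<notin> {1..n}"
    proof -
      have "j \<notin> keys b" using b that by (auto simp: cone_def)
      then show ?thesis by (simp add: f in_keys_iff)
    qed
  qed
  moreover have "finite {f :: nat \<Rightarrow> int. \<forall>j. (j \<in> {1..n} \<longrightarrow> f j \<in> {0..K}) \<and> (j \<notin> {1..n} \<longrightarrow> f j = 0)}"
    by (rule finite_set_of_finite_funs) auto
  ultimately have "finite (lookup ` {b \<in> C. \<forall>j. lookup b j \<le> lookup m j})" by (rule finite_subset)
  then show ?thesis by (rule finite_imageD) (rule inj_onI, simp only: poly_mapping_eq_iff)
qed

text \<open>The images of the exponents \<open>v\<close> times a unit vector determine the permutation, and they are
  bounded by a multiple of the invariant exponent \<open>X_exp\<close>.\<close>

lemma finite_exponent_perm: "finite (exponent_perm ` carrier Aut)"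
proof -
  let ?r = "\<lambda>p. \<lambda>i\<in>{1..n}. p (single i (int v))"
  let ?box = "{b \<in> C. \<forall>j. lookup b j \<le> lookup (frag_cmul (int N) X_exp) j}"
  have "?r ` exponent_perm ` carrier Aut \<subseteq> PiE {1..n} (\<lambda>_. ?box)"
    by (auto simp: exponent_perm(1) unit_multiple_cone exponent_perm_bounded)
  moreover have "finite (PiE {1..n} (\<lambda>_. ?box))" by (intro finite_PiE finite_box) simp
  ultimately have "finite (?r ` exponent_perm ` carrier Aut)" by (rule finite_subset)
  then show ?thesis
  proof (rule finite_imageD)
    show "inj_on ?r (exponent_perm ` carrier Aut)"
    proof (rule inj_onI, elim imageE)
      fix p p' \<phi> \<psi>
      assume r: "?r p = ?r p'" and p: "p = exponent_perm \<phi>" "\<phi> \<in> carrier Aut"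
        "p' = exponent_perm \<psi>" "\<psi> \<in> carrier Aut"
      have "p (single i (int v)) = p' (single i (int v))" if "i \<in> {1..n}" for i
        using fun_cong[OF r, of i] that by simp
      then show "p = p'" using exponent_perm_determined p by blast
    qed
  qed
qed

theorem virtually_solvable_Aut: "virtually_solvable (alg_Aut (quantum_veronese n q v))"
  by (rule alg_Aut_virtually_solvableI[OF alg_closed_quantum_veronese[OF v_pos] alg_closed_cone_alg
        veronese_class_value[OF v_pos] exponent_perm_hom finite_exponent_perm kernel_commute])

end

section \<open>Elementary automorphisms\<close>

text \<open>Since \<open>x\<^sup>e\<close> is central and \<open>x\<^sub>i\<close> occurs in it with exponent \<open>-1\<close>, multiplying \<open>x\<^sup>a\<close> by
  at most \<open>a\<^sub>i\<close> factors \<open>1 + l x\<^sup>e\<close> does not leave \<open>B\<close>.\<close>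

locale shear_data = quantum_root n q v N for n :: nat and q :: "'k::field" and v N :: nat +
  fixes i :: nat and e :: "nat \<Rightarrow>\<^sub>0 int"
  assumes i_range: "i \<in> {1..n}" and e_radical: "e \<in> radical" and e_i: "lookup e i = - 1"
    and e_nonneg: "j \<in> {1..n} \<Longrightarrow> j \<noteq> i \<Longrightarrow> 0 \<le> lookup e j"
begin

abbreviation U :: "'k \<Rightarrow> (nat \<Rightarrow>\<^sub>0 int) \<Rightarrow>\<^sub>0 'k" where
  "U l \<equiv> 1 + single e l"

lemma keys_U: "keys (U l) \<subseteq> radical"
proof -
  have "keys (1 :: (nat \<Rightarrow>\<^sub>0 int) \<Rightarrow>\<^sub>0 'k) \<subseteq> radical" by (simp flip: single_one)
  moreover have "keys (single e l) \<subseteq> radical" using e_radical by simp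
  ultimately show ?thesis by (rule order.trans[OF keys_add Un_least])
qed

lemma keys_tpow_U: "keys (tpow (U l) k) \<subseteq> radical"
  by (rule keys_tpow_closed[OF radical_zero radical_add keys_U])

lemma tpow_U_commute: "keys g \<subseteq> \<Lambda> \<Longrightarrow> tpow (U l) k \<star> g = g \<star> tpow (U l) k"
  by (rule radical_commute[OF keys_tpow_U])

lemma shift_cone:
  assumes "a \<in> C" "1 \<le> lookup a i"
  shows "a + e \<in> C"
  unfolding cone_iff
proof (intro conjI ballI)
  show "a + e \<in> \<Lambda>" by (rule lattice_add[OF cone_lattice[OF assms(1)] radical_lattice[OF e_radical]])
  fix j assume j: "j \<in> {1..n}"
  show "0 \<le> lookup (a + e) j"
  proof (cases "j = i")
    case False
    then show ?thesis using e_nonneg[OF j] assms(1) j by (simp add: lookup_add cone_iff)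
  qed (use assms(2) e_i in \<open>simp add: lookup_add\<close>)
qed

text \<open>The expansion of one factor; it replaces the binomial theorem in the inductions below, because
  \<open>a + e\<close> has smaller \<open>i\<close>-th entry.\<close>

lemma tpow_U_step:
  "single a c \<star> tpow (U l) (Suc k) =
     single a c \<star> tpow (U l) k + single 0 (l * chi a e) \<star> (single (a + e) c \<star> tpow (U l) k)"
proof -
  have "single a c \<star> tpow (U l) (Suc k) = (single a c \<star> U l) \<star> tpow (U l) k"
    by (simp only: tpow.simps tmul_assoc)
  also have "single a c \<star> U l = single a c + single 0 (l * chi a e) \<star> single (a + e) c"
    by (simp add: tmul_add_right tmul_single mult_ac)
  finally show ?thesis by (simp only: tmul_add_left tmul_assoc)
qed

lemma keys_monomial_tpow_U:
  "a \<in> C \<Longrightarrow> int k \<le> lookup a i \<Longrightarrow> keys (single a c \<star> tpow (U l) k) \<subseteq> C"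
proof (induction k arbitrary: a)
  case (Suc k)
  then have "a + e \<in> C" "int k \<le> lookup (a + e) i"
    by (auto intro!: shift_cone simp: lookup_add e_i)
  then show ?case
    unfolding tpow_U_step using Suc by (intro keys_cone_add keys_cone_scalar Suc.IH) auto
qed simp

text \<open>The linear extension of \<open>x\<^sup>a \<mapsto> x\<^sup>a (1 + l x\<^sup>e)\<close> to the power \<open>a\<^sub>i\<close>; it is multiplicative, as the
  exponents \<open>a\<^sub>i\<close> add up and \<open>x\<^sup>e\<close> is central.\<close>

definition shear_fun :: "'k \<Rightarrow> ((nat \<Rightarrow>\<^sub>0 int) \<Rightarrow>\<^sub>0 'k) \<Rightarrow> ((nat \<Rightarrow>\<^sub>0 int) \<Rightarrow>\<^sub>0 'k)" where
  "shear_fun l f = (\<Sum>a\<in>keys f. single a (lookup f a) \<star> tpow (U l) (nat (lookup a i)))"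

lemma shear_fun_superset:
  "finite S \<Longrightarrow> keys f \<subseteq> S \<Longrightarrow>
     shear_fun l f = (\<Sum>a\<in>S. single a (lookup f a) \<star> tpow (U l) (nat (lookup a i)))"
  unfolding shear_fun_def by (intro sum.mono_neutral_left) (auto simp: in_keys_iff)

lemma shear_fun_single: "shear_fun l (single a c) = single a c \<star> tpow (U l) (nat (lookup a i))"
  by (subst shear_fun_superset[of "{a}"]) auto

lemma shear_fun_add: "shear_fun l (f + g) = shear_fun l f + shear_fun l g"
proof -
  have S: "finite (keys f \<union> keys g)" by simp
  show ?thesis
    unfolding shear_fun_superset[OF S keys_add] shear_fun_superset[OF S Un_upper1] shear_fun_superset[OF S Un_upper2]
    by (simp only: lookup_add single_add tmul_add_left sum.distrib)
qed

lemma shear_fun_zero [simp]: "shear_fun l 0 = 0"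
  by (simp add: shear_fun_def)

lemma shear_fun_scalar: "shear_fun l (single 0 c \<star> f) = single 0 c \<star> shear_fun l f"
  by (induction f rule: single_sum_induct)
     (simp_all add: shear_fun_single shear_fun_add tmul_add_right tmul_assoc[symmetric])

lemma keys_shear_fun: "keys f \<subseteq> C \<Longrightarrow> keys (shear_fun l f) \<subseteq> C"
  unfolding shear_fun_def
  by (intro order.trans[OF keys_sum] UN_least keys_monomial_tpow_U) (auto simp: cone_def)

lemma shear_fun_mult:
  assumes f: "keys f \<subseteq> C" and g: "keys g \<subseteq> C"
  shows "shear_fun l (f \<star> g) = shear_fun l f \<star> shear_fun l g"
proof (induction f rule: single_sum_induct)
  case (single a c)
  then have a: "a \<in> C" using f by blast
  show ?case
  proof (induction g rule: single_sum_induct)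
    case (single b c')
    then have b: "b \<in> C" using g by blast
    have ab: "nat (lookup (a + b) i) = nat (lookup a i) + nat (lookup b i)"
      using a b by (simp add: lookup_add cone_def nat_add_distrib)
    have "tpow (U l) (nat (lookup a i)) \<star> single b c' = single b c' \<star> tpow (U l) (nat (lookup a i))"
      using b by (intro tpow_U_commute) (simp add: cone_lattice)
    then have "shear_fun l (single a c) \<star> shear_fun l (single b c') =
        single a c \<star> single b c' \<star> (tpow (U l) (nat (lookup a i)) \<star> tpow (U l) (nat (lookup b i)))"
      unfolding shear_fun_single by (metis tmul_assoc)
    also have "\<dots> = shear_fun l (single a c \<star> single b c')"
      by (simp only: tmul_single shear_fun_single ab tpow_add)
    finally show ?case ..
  qed (simp_all add: tmul_add_right shear_fun_add)
qed (simp_all add: tmul_add_left shear_fun_add)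

text \<open>The element \<open>single a c \<star> tpow (U m) k\<close> interpolates between a monomial, for \<open>k = 0\<close>, and its
  image under \<open>shear_fun m\<close>, for the largest \<open>k\<close>; there the formula gives the one-parameter group law.\<close>

lemma shear_fun_monomial_tpow_U:
  "a \<in> C \<Longrightarrow> int k \<le> lookup a i \<Longrightarrow>
     shear_fun l (single a c \<star> tpow (U m) k) =
       single a c \<star> (tpow (U (l + m)) k \<star> tpow (U l) (nat (lookup a i) - k))"
proof (induction k arbitrary: a)
  case 0
  then show ?case by (simp add: shear_fun_single)
next
  case (Suc k)
  have a': "a + e \<in> C" "int k \<le> lookup (a + e) i" "nat (lookup (a + e) i) - k = nat (lookup a i) - Suc k"
    using Suc.prems by (auto intro!: shift_cone simp: lookup_add e_i)
  define r where "r = nat (lookup a i) - Suc k"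
  have r: "nat (lookup a i) - k = Suc r" using Suc.prems by (simp add: r_def)
  let ?V = "tpow (U (l + m)) k" and ?R = "tpow (U l) r"
  have comm: "U x \<star> ?V = ?V \<star> U x" for x
    using radical_commute[OF keys_U, of ?V x] keys_tpow_U[of "l + m" k] radical_lattice by blast
  have "shear_fun l (single a c \<star> tpow (U m) (Suc k)) =
      single a c \<star> (?V \<star> (U l \<star> ?R)) + single 0 (m * chi a e) \<star> (single (a + e) c \<star> (?V \<star> ?R))"
    unfolding tpow_U_step shear_fun_add shear_fun_scalar
    using Suc.IH[OF a'(1,2)] Suc.IH[OF Suc.prems(1)] Suc.prems(2) a'(3) r
    by (simp add: r_def)
  also have "single a c \<star> (?V \<star> (U l \<star> ?R)) = single a c \<star> (U l \<star> (?V \<star> ?R))"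
    by (metis comm tmul_assoc)
  also have "single 0 (m * chi a e) \<star> (single (a + e) c \<star> (?V \<star> ?R)) = single a c \<star> (single e m \<star> (?V \<star> ?R))"
    by (simp only: tmul_assoc[symmetric]) (simp add: tmul_single mult_ac)
  also have "single a c \<star> (U l \<star> (?V \<star> ?R)) + single a c \<star> (single e m \<star> (?V \<star> ?R)) =
      single a c \<star> (U (l + m) \<star> (?V \<star> ?R))"
    by (simp only: single_add tmul_add_left tmul_add_right add.assoc)
  finally show ?case by (simp only: tpow.simps tmul_assoc r_def)
qed

lemma shear_fun_compose:
  assumes "keys f \<subseteq> C"
  shows "shear_fun l (shear_fun m f) = shear_fun (l + m) f"
proof (induction f rule: single_sum_induct)
  case (single a c)
  then have a: "a \<in> C" using assms by blast
  then show ?case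
    unfolding shear_fun_single[of m] by (subst shear_fun_monomial_tpow_U) (auto simp: cone_def shear_fun_single)
qed (simp_all add: shear_fun_add)

lemma shear_fun_0: "shear_fun 0 f = f"
proof -
  have "tpow 1 k = (1 :: (nat \<Rightarrow>\<^sub>0 int) \<Rightarrow>\<^sub>0 'k)" for k by (induction k) simp_all
  then show ?thesis by (simp add: shear_fun_def sum_single_keys)
qed

definition shear :: "'k \<Rightarrow> ((nat \<Rightarrow>\<^sub>0 int) \<Rightarrow>\<^sub>0 'k) \<Rightarrow> ((nat \<Rightarrow>\<^sub>0 int) \<Rightarrow>\<^sub>0 'k)" where
  "shear l = restrict (shear_fun l) (carrier B)"

lemma shear_apply: "keys f \<subseteq> C \<Longrightarrow> shear l f = shear_fun l f"
  by (simp add: shear_def)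

lemma shear_Aut: "shear l \<in> carrier Aut"
proof (rule alg_AutI)
  have "shear_fun l 1 = 1"
    using shear_fun_single[of l 0 1] by simp
  then have "shear_fun l \<in> alg_hom B B"
    by (intro alg_homI) (simp_all add: keys_shear_fun shear_fun_mult shear_fun_add shear_fun_scalar)
  then show "shear l \<in> alg_hom B B"
    unfolding shear_def by (rule alg_hom_restrict[OF alg_closed_cone_alg])
  fix f assume "f \<in> carrier B"
  then have f: "keys f \<subseteq> C" by simp
  show "shear_fun (- l) f \<in> carrier B" using keys_shear_fun[OF f] by simp
  show "shear l (shear_fun (- l) f) = f"
    by (simp add: shear_apply[OF keys_shear_fun[OF f]] shear_fun_compose[OF f] shear_fun_0)
  show "shear_fun (- l) (shear l f) = f"
    by (simp add: shear_apply[OF f] shear_fun_compose[OF f] shear_fun_0)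
qed (simp add: shear_def)

lemma shear_mult: "shear l \<otimes>\<^bsub>Aut\<^esub> shear m = shear (l + m)"
  unfolding mult_alg_Aut[OF shear_Aut shear_Aut]
proof (rule extensionalityI[of _ "carrier B"])
  fix f assume "f \<in> carrier B"
  then have f: "keys f \<subseteq> C" by simp
  show "compose (carrier B) (shear l) (shear m) f = shear (l + m) f"
    using f keys_shear_fun[OF f] by (simp add: compose_eq shear_apply shear_fun_compose)
qed (simp_all add: shear_def)

lemma shear_one: "shear 0 = \<one>\<^bsub>Aut\<^esub>"
  unfolding one_alg_Aut shear_def shear_fun_0 ..

lemma shear_inverse: "inv\<^bsub>Aut\<^esub> (shear l) = shear (- l)"
  by (rule group.inv_equality[OF group_Aut]) (simp_all add: shear_Aut shear_mult shear_one)

end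

subsection \<open>Growth of degrees\<close>

context quantum_root
begin

definition has_degree :: "((nat \<Rightarrow>\<^sub>0 int) \<Rightarrow>\<^sub>0 'k) \<Rightarrow> int \<Rightarrow> bool" where
  "has_degree f x \<longleftrightarrow> (\<exists>a\<in>keys f. total_degree n a = x) \<and> (\<forall>a\<in>keys f. total_degree n a \<le> x)"

definition weighted_degree :: "(nat \<Rightarrow> int) \<Rightarrow> (nat \<Rightarrow>\<^sub>0 int) \<Rightarrow> int" where
  "weighted_degree D a = (\<Sum>j\<in>{1..n}. D j * lookup a j)"

text \<open>The degree of the image of \<open>x\<^sup>a\<close> is a linear function of \<open>a\<close>. The identity has all weights
  \<open>1\<close>.\<close>

definition has_weights :: "(((nat \<Rightarrow>\<^sub>0 int) \<Rightarrow>\<^sub>0 'k) \<Rightarrow> ((nat \<Rightarrow>\<^sub>0 int) \<Rightarrow>\<^sub>0 'k)) \<Rightarrow> (nat \<Rightarrow> int) \<Rightarrow> bool" where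
  "has_weights \<tau> D \<longleftrightarrow>
     (\<forall>j\<in>{1..n}. 0 < D j) \<and> (\<forall>a\<in>C. has_degree (\<tau> (single a 1)) (weighted_degree D a))"

lemma has_degree_add:
  assumes f: "has_degree f x" and g: "has_degree g y" and "x < y"
  shows "has_degree (f + g) y"
proof -
  obtain a where a: "a \<in> keys g" "total_degree n a = y" using g by (auto simp: has_degree_def)
  have "a \<notin> keys f" using f a \<open>x < y\<close> by (auto simp: has_degree_def)
  then have "a \<in> keys (f + g)" using a by (simp add: in_keys_iff lookup_add)
  moreover have "total_degree n b \<le> y" if b: "b \<in> keys (f + g)" for b
  proof -
    have "b \<in> keys f \<union> keys g" using subsetD[OF keys_add b] .
    then show ?thesis using f g \<open>x < y\<close> by (fastforce simp: has_degree_def)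
  qed
  ultimately show ?thesis using a(2) unfolding has_degree_def by blast
qed

lemma has_degree_scalar: "c \<noteq> 0 \<Longrightarrow> has_degree (single 0 c \<star> f) x \<longleftrightarrow> has_degree f x"
  by (simp add: has_degree_def keys_scalar)

lemma has_degree_unique: "has_degree f x \<Longrightarrow> has_degree f y \<Longrightarrow> x = y"
  unfolding has_degree_def by (metis order_antisym)

lemma weighted_degree_add: "weighted_degree D (a + b) = weighted_degree D a + weighted_degree D b"
  by (simp add: weighted_degree_def lookup_add distrib_left sum.distrib)

lemma weighted_degree_upd:
  "i \<in> {1..n} \<Longrightarrow> weighted_degree (D(i := D i + x)) a = weighted_degree D a + lookup a i * x"
proof -
  assume i: "i \<in> {1..n}"
  have "weighted_degree (D(i := D i + x)) a = (\<Sum>j\<in>{1..n}. D j * lookup a j + (if j = i then lookup a i * x else 0))"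
    unfolding weighted_degree_def by (intro sum.cong refl) (simp add: algebra_simps)
  then show ?thesis using i by (simp add: weighted_degree_def sum.distrib)
qed

end

context shear_data
begin

text \<open>When \<open>e\<close> has positive weight, each factor \<open>1 + l x\<^sup>e\<close> contributes its second term to the
  leading part.\<close>

lemma has_degree_tpow_U:
  assumes \<tau>: "\<tau> \<in> carrier Aut" "has_weights \<tau> D" and pos: "0 < weighted_degree D e" and l: "l \<noteq> 0"
  shows "a \<in> C \<Longrightarrow> int k \<le> lookup a i \<Longrightarrow>
    has_degree (\<tau> (single a 1 \<star> tpow (U l) k)) (weighted_degree D a + int k * weighted_degree D e)"
proof (induction k arbitrary: a)
  case 0
  then show ?case using \<tau>(2) by (simp add: has_weights_def)
next
  case (Suc k)
  have a: "a + e \<in> C" "int k \<le> lookup (a + e) i" "int k \<le> lookup a i"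
    using Suc.prems by (auto intro!: shift_cone simp: lookup_add e_i)
  note ks = keys_monomial_tpow_U[OF Suc.prems(1) a(3)] keys_monomial_tpow_U[OF a(1,2)]
  have "\<tau> (single a 1 \<star> tpow (U l) (Suc k)) =
      \<tau> (single a 1 \<star> tpow (U l) k) + single 0 (l * chi a e) \<star> \<tau> (single (a + e) 1 \<star> tpow (U l) k)"
    unfolding tpow_U_step
    by (simp only: AutD(3)[OF \<tau>(1) ks(1) keys_cone_scalar[OF ks(2)]] AutD(5)[OF \<tau>(1) ks(2)])
  moreover have nz: "l * chi a e \<noteq> 0" using l q_nonzero by simp
  have "has_degree (single 0 (l * chi a e) \<star> \<tau> (single (a + e) 1 \<star> tpow (U l) k))
      (weighted_degree D (a + e) + int k * weighted_degree D e)"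
    unfolding has_degree_scalar[OF nz] by (rule Suc.IH[OF a(1,2)])
  moreover have "weighted_degree D a + int k * weighted_degree D e <
      weighted_degree D (a + e) + int k * weighted_degree D e"
    using pos by (simp add: weighted_degree_add)
  ultimately have "has_degree (\<tau> (single a 1 \<star> tpow (U l) (Suc k)))
      (weighted_degree D (a + e) + int k * weighted_degree D e)"
    using has_degree_add[OF Suc.IH[OF Suc.prems(1) a(3)]] by simp
  moreover have "weighted_degree D (a + e) + int k * weighted_degree D e =
      weighted_degree D a + int (Suc k) * weighted_degree D e"
    by (simp add: weighted_degree_add algebra_simps)
  ultimately show ?case by (simp only:)
qed

text \<open>The new weight of \<open>i\<close> is the weighted sum of the entries of \<open>e\<close> other than the \<open>i\<close>-th, and
  the entry at \<open>j\<close> alone makes it at least twice the weight of \<open>j\<close>.\<close>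

lemma has_weights_shear:
  assumes \<tau>: "\<tau> \<in> carrier Aut" "has_weights \<tau> D" and l: "l \<noteq> 0"
    and j: "j \<in> {1..n}" "j \<noteq> i" "2 \<le> lookup e j" and le: "D i \<le> D j"
  shows "\<exists>D'. has_weights (\<tau> \<otimes>\<^bsub>Aut\<^esub> shear l) D' \<and> D' j < D' i"
proof -
  define x where "x = weighted_degree D e"
  have D: "0 < D k" if "k \<in> {1..n}" for k using \<tau>(2) that by (simp add: has_weights_def)
  have "weighted_degree D e = D i * lookup e i + (\<Sum>k\<in>{1..n} - {i}. D k * lookup e k)"
    unfolding weighted_degree_def using i_range by (simp add: sum.remove)
  moreover have "D j * lookup e j \<le> (\<Sum>k\<in>{1..n} - {i}. D k * lookup e k)"
    using j(1,2) D e_nonneg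
    by (intro member_le_sum) (auto intro!: mult_nonneg_nonneg intro: less_imp_le)
  moreover have "D j * 2 \<le> D j * lookup e j" using j(3) D[OF j(1)] by (intro mult_left_mono) auto
  ultimately have x: "2 * D j \<le> D i + x" by (simp add: x_def e_i)
  have x_pos: "0 < x" using x le D[OF j(1)] by linarith
  define D' where "D' = D(i := D i + x)"
  have "has_degree ((\<tau> \<otimes>\<^bsub>Aut\<^esub> shear l) (single a 1)) (weighted_degree D' a)" if a: "a \<in> C" for a
  proof -
    have a_i: "int (nat (lookup a i)) = lookup a i" using a by (simp add: cone_def)
    have "(\<tau> \<otimes>\<^bsub>Aut\<^esub> shear l) (single a 1) = \<tau> (single a 1 \<star> tpow (U l) (nat (lookup a i)))"
      unfolding mult_alg_Aut[OF \<tau>(1) shear_Aut] using a by (simp add: compose_eq shear_apply shear_fun_single)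
    moreover have "has_degree (\<tau> (single a 1 \<star> tpow (U l) (nat (lookup a i))))
        (weighted_degree D a + int (nat (lookup a i)) * x)"
      unfolding x_def using x_pos a_i by (intro has_degree_tpow_U \<tau> l a) (simp_all add: x_def)
    ultimately show ?thesis
      unfolding D'_def weighted_degree_upd[OF i_range] a_i by simp
  qed
  moreover have "\<forall>k\<in>{1..n}. 0 < D' k" using D x_pos by (simp add: D'_def add_pos_pos)
  moreover have "D' j < D' i" using x D[OF j(1)] j(2) by (simp add: D'_def)
  ultimately show ?thesis unfolding has_weights_def by blast
qed

end

section \<open>The Tits alternative\<close>

context quantum_root
begin

lemma has_weights_one: "has_weights \<one>\<^bsub>Aut\<^esub> (\<lambda>_. 1)"
  by (auto simp: has_weights_def has_degree_def one_alg_Aut weighted_degree_def total_degree_def)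

lemma has_weights_one_unique:
  assumes "has_weights \<one>\<^bsub>Aut\<^esub> D" "j \<in> {1..n}"
  shows "D j = 1"
proof -
  have c: "single j (int v) \<in> C"
    using assms(2) by (auto simp: cone_def total_degree_single lookup_single when_def)
  have "has_degree (\<one>\<^bsub>Aut\<^esub> (single (single j (int v)) 1)) (weighted_degree D (single j (int v)))"
    "has_degree (\<one>\<^bsub>Aut\<^esub> (single (single j (int v)) 1)) (weighted_degree (\<lambda>_. 1) (single j (int v)))"
    using assms(1) has_weights_one c unfolding has_weights_def by blast+
  then have "weighted_degree D (single j (int v)) = weighted_degree (\<lambda>_. 1) (single j (int v))"
    by (rule has_degree_unique)
  moreover have "weighted_degree D' (single j (int v)) = D' j * int v" for D'
    using assms(2) by (simp add: weighted_degree_def lookup_single when_def if_distrib cong: if_cong)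
  ultimately show ?thesis using v_pos by simp
qed

text \<open>Let \<open>g l\<close> be the product of the two shears with parameter \<open>l\<close>. A reduced word in \<open>g 1\<close> and
  \<open>g t\<close> becomes an alternating product of shears with parameters among \<open>\<plusminus>1\<close>, \<open>\<plusminus>t\<close> and \<open>\<plusminus>(1 - t)\<close>,
  all nonzero. After a shear of the first kind the weight of \<open>1\<close> exceeds that of \<open>2\<close>, after one of
  the second kind it is the other way round; for the identity they agree.\<close>

lemma contains_free_rank_2_Aut:
  assumes s1: "shear_data n q v N 1 e1" and s2: "shear_data n q v N 2 e2"
    and e12: "2 \<le> lookup e1 2" "2 \<le> lookup e2 1" and t: "t \<noteq> (0::'k)" "t \<noteq> 1"
  shows "contains_free_rank_2 (alg_Aut (quantum_veronese n q v))"
proof -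
  interpret s1: shear_data n q v N 1 e1 by fact
  interpret s2: shear_data n q v N 2 e2 by fact
  interpret G: group Aut by (rule group_Aut)
  have 12: "1 \<in> {1..n}" "2 \<in> {1..n}" using n_ge_2 by auto
  define P1 where "P1 \<tau> \<longleftrightarrow> \<tau> \<in> carrier Aut \<and> (\<exists>D. has_weights \<tau> D \<and> D 2 < D 1)" for \<tau>
  define P2 where "P2 \<tau> \<longleftrightarrow> \<tau> \<in> carrier Aut \<and> (\<exists>D. has_weights \<tau> D \<and> D 1 < D 2)" for \<tau>
  have step1: "P1 (\<tau> \<otimes>\<^bsub>Aut\<^esub> s1.shear l)" if "P2 \<tau> \<or> \<tau> = \<one>\<^bsub>Aut\<^esub>" "l \<noteq> 0" for \<tau> l
  proof -
    have \<tau>: "\<tau> \<in> carrier Aut" using that(1) by (auto simp: P2_def)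
    have "\<exists>D. has_weights \<tau> D \<and> D 1 \<le> D 2"
      using that(1)
    proof
      assume "P2 \<tau>"
      then obtain D where "has_weights \<tau> D" "D 1 < D 2" unfolding P2_def by blast
      then show ?thesis by (intro exI[of _ D]) simp
    next
      assume "\<tau> = \<one>\<^bsub>Aut\<^esub>"
      then show ?thesis using has_weights_one by (intro exI[of _ "\<lambda>_. 1"]) simp
    qed
    then obtain D where D: "has_weights \<tau> D" "D 1 \<le> D 2" by blast
    show ?thesis
      using s1.has_weights_shear[OF \<tau> D(1) that(2) 12(2) _ e12(1) D(2)] \<tau> s1.shear_Aut by (simp add: P1_def)
  qed
  have step2: "P2 (\<tau> \<otimes>\<^bsub>Aut\<^esub> s2.shear l)" if "P1 \<tau> \<or> \<tau> = \<one>\<^bsub>Aut\<^esub>" "l \<noteq> 0" for \<tau> l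
  proof -
    have \<tau>: "\<tau> \<in> carrier Aut" using that(1) by (auto simp: P1_def)
    have "\<exists>D. has_weights \<tau> D \<and> D 2 \<le> D 1"
      using that(1)
    proof
      assume "P1 \<tau>"
      then obtain D where "has_weights \<tau> D" "D 2 < D 1" unfolding P1_def by blast
      then show ?thesis by (intro exI[of _ D]) simp
    next
      assume "\<tau> = \<one>\<^bsub>Aut\<^esub>"
      then show ?thesis using has_weights_one by (intro exI[of _ "\<lambda>_. 1"]) simp
    qed
    then obtain D where D: "has_weights \<tau> D" "D 2 \<le> D 1" by blast
    show ?thesis
      using s2.has_weights_shear[OF \<tau> D(1) that(2) 12(1) _ e12(2) D(2)] \<tau> s2.shear_Aut by (simp add: P2_def)
  qed
  have "D 1 = D 2" if "has_weights \<one>\<^bsub>Aut\<^esub> D" for D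
    using has_weights_one_unique[OF that 12(1)] has_weights_one_unique[OF that 12(2)] by simp
  then have not_one: "\<not> P1 \<one>\<^bsub>Aut\<^esub>" "\<not> P2 \<one>\<^bsub>Aut\<^esub>"
    unfolding P1_def P2_def by (metis less_irrefl)+
  define g where "g l = s1.shear l \<otimes>\<^bsub>Aut\<^esub> s2.shear l" for l
  have g: "g l \<in> carrier Aut" for l by (simp add: g_def s1.shear_Aut s2.shear_Aut)
  have g_inv: "inv\<^bsub>Aut\<^esub> (g l) = s2.shear (- l) \<otimes>\<^bsub>Aut\<^esub> s1.shear (- l)" for l
    by (simp add: g_def G.inv_mult_group s1.shear_Aut s2.shear_Aut s1.shear_inverse s2.shear_inverse)
  note carr = s1.shear_Aut s2.shear_Aut g G.m_closed
  have P1c: "p \<in> carrier Aut" if "P1 p" for p using that by (simp add: P1_def)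
  have P2c: "p \<in> carrier Aut" if "P2 p" for p using that by (simp add: P2_def)
  have g_ne: "g 1 \<noteq> g t"
  proof
    assume eq: "g 1 = g t"
    have "P1 (\<one>\<^bsub>Aut\<^esub> \<otimes>\<^bsub>Aut\<^esub> s1.shear 1)" by (intro step1) simp_all
    then have "P2 (\<one>\<^bsub>Aut\<^esub> \<otimes>\<^bsub>Aut\<^esub> s1.shear 1 \<otimes>\<^bsub>Aut\<^esub> s2.shear (1 - t))"
      using t(2) by (intro step2 disjI1) simp_all
    then have "P1 (\<one>\<^bsub>Aut\<^esub> \<otimes>\<^bsub>Aut\<^esub> s1.shear 1 \<otimes>\<^bsub>Aut\<^esub> s2.shear (1 - t) \<otimes>\<^bsub>Aut\<^esub> s1.shear (- t))"
      using t(1) by (intro step1 disjI1) simp_all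
    moreover have "\<one>\<^bsub>Aut\<^esub> \<otimes>\<^bsub>Aut\<^esub> s1.shear 1 \<otimes>\<^bsub>Aut\<^esub> s2.shear (1 - t) \<otimes>\<^bsub>Aut\<^esub> s1.shear (- t) =
        g 1 \<otimes>\<^bsub>Aut\<^esub> inv\<^bsub>Aut\<^esub> (g t)"
      unfolding g_inv by (simp add: g_def carr G.m_assoc flip: s2.shear_mult[of 1 "- t", simplified])
    ultimately have "P1 (g t \<otimes>\<^bsub>Aut\<^esub> inv\<^bsub>Aut\<^esub> (g t))" using eq by simp
    then show False using not_one(1) g by simp
  qed
  have lam: "\<exists>l. x = g l \<and> l \<noteq> 0" if "x \<in> {g 1, g t}" for x
  proof (cases "x = g 1")
    case True
    then show ?thesis by (intro exI[of _ 1]) simp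
  next
    case False
    then show ?thesis using that t(1) by (intro exI[of _ t]) simp
  qed
  \<comment> \<open>Ping-pong: the last letter of a word records the last two elementary factors of its value.\<close>
  have pingpong: "(snd (last w) \<longrightarrow> (\<exists>p l. P1 p \<and> l \<noteq> 0 \<and> fst (last w) = g l \<and>
          word_eval Aut w = p \<otimes>\<^bsub>Aut\<^esub> s2.shear l)) \<and>
      (\<not> snd (last w) \<longrightarrow> (\<exists>p l. P2 p \<and> l \<noteq> 0 \<and> fst (last w) = g l \<and>
          word_eval Aut w = p \<otimes>\<^bsub>Aut\<^esub> s1.shear (- l)))"
    if "w \<in> reduced_words {g 1, g t}" "w \<noteq> []" for w
    using that
  proof (induction w rule: rev_induct)
    case (snoc x u)
    have ux: "u \<in> reduced_words {g 1, g t}" "fst x \<in> {g 1, g t}"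
      "u \<noteq> [] \<Longrightarrow> \<not> (fst (last u) = fst x \<and> snd (last u) \<noteq> snd x)"
      using reduced_words_snocD[OF snoc.prems(1)] by blast+
    obtain l where l: "fst x = g l" "l \<noteq> 0" using lam[OF ux(2)] by blast
    have set_u: "fst ` set u \<subseteq> carrier Aut" using ux(1) g unfolding reduced_words_def by auto
    have "word_eval Aut (u @ [x]) = word_eval Aut u \<otimes>\<^bsub>Aut\<^esub> word_eval Aut [x]"
      using set_u l(1) g by (intro G.word_eval_append) auto
    also have "word_eval Aut [x] =
        (if snd x then s1.shear l \<otimes>\<^bsub>Aut\<^esub> s2.shear l else s2.shear (- l) \<otimes>\<^bsub>Aut\<^esub> s1.shear (- l))"
    proof (cases "snd x")
      case True
      then have "word_eval Aut [x] = g l" using l(1) g by (cases x) simp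
      then show ?thesis using True by (simp add: g_def)
    next
      case False
      then have "word_eval Aut [x] = inv\<^bsub>Aut\<^esub> (g l)" using l(1) g by (cases x) simp
      then show ?thesis using False by (simp add: g_inv)
    qed
    finally have ev: "word_eval Aut (u @ [x]) = word_eval Aut u \<otimes>\<^bsub>Aut\<^esub>
        (if snd x then s1.shear l \<otimes>\<^bsub>Aut\<^esub> s2.shear l else s2.shear (- l) \<otimes>\<^bsub>Aut\<^esub> s1.shear (- l))" .
    have u_carr: "word_eval Aut u \<in> carrier Aut" by (rule G.word_eval_closed[OF set_u])
    \<comment> \<open>Only the first elementary factor of the new letter interacts with \<open>u\<close>.\<close>
    have "(snd x \<longrightarrow> P1 (word_eval Aut u \<otimes>\<^bsub>Aut\<^esub> s1.shear l)) \<and>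
        (\<not> snd x \<longrightarrow> P2 (word_eval Aut u \<otimes>\<^bsub>Aut\<^esub> s2.shear (- l)))"
    proof (cases "u = []")
      case True
      then show ?thesis using step1[of _ l] step2[of _ "- l"] l(2) by simp
    next
      case False
      note IH = snoc.IH[OF ux(1) False]
      show ?thesis
      proof (cases "snd (last u)")
        case True
        then obtain p m where p: "P1 p" "m \<noteq> 0" "fst (last u) = g m"
          "word_eval Aut u = p \<otimes>\<^bsub>Aut\<^esub> s2.shear m" using IH by blast
        have "P1 (word_eval Aut u \<otimes>\<^bsub>Aut\<^esub> s1.shear l)"
          unfolding p(4) using p(1,2) l(2) by (intro step1 disjI1 step2) auto
        moreover have "P2 (word_eval Aut u \<otimes>\<^bsub>Aut\<^esub> s2.shear (- l))" if "\<not> snd x"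
        proof -
          have "m \<noteq> l" using ux(3)[OF False] True that p(3) l(1) by auto
          then have "P2 (p \<otimes>\<^bsub>Aut\<^esub> s2.shear (m + - l))" using p(1) by (intro step2 disjI1) auto
          then show ?thesis
            unfolding p(4) by (simp only: s2.shear_mult[symmetric] G.m_assoc[OF P1c[OF p(1)] s2.shear_Aut s2.shear_Aut])
        qed
        ultimately show ?thesis by blast
      next
        case b: False
        then obtain p m where p: "P2 p" "m \<noteq> 0" "fst (last u) = g m"
          "word_eval Aut u = p \<otimes>\<^bsub>Aut\<^esub> s1.shear (- m)" using IH by blast
        have "P2 (word_eval Aut u \<otimes>\<^bsub>Aut\<^esub> s2.shear (- l))"
          unfolding p(4) using p(1,2) l(2) by (intro step2 disjI1 step1) auto
        moreover have "P1 (word_eval Aut u \<otimes>\<^bsub>Aut\<^esub> s1.shear l)" if "snd x"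
        proof -
          have "m \<noteq> l" using ux(3)[OF False] b that p(3) l(1) by auto
          then have "P1 (p \<otimes>\<^bsub>Aut\<^esub> s1.shear (- m + l))" using p(1) by (intro step1 disjI1) auto
          then show ?thesis
            unfolding p(4) by (simp only: s1.shear_mult[symmetric] G.m_assoc[OF P2c[OF p(1)] s1.shear_Aut s1.shear_Aut])
        qed
        ultimately show ?thesis by blast
      qed
    qed
    then show ?case
      unfolding ev last_snoc using l
      by (auto simp: G.m_assoc[OF u_carr s1.shear_Aut s2.shear_Aut, symmetric]
            G.m_assoc[OF u_carr s2.shear_Aut s1.shear_Aut, symmetric])
  qed simp
  show ?thesis
  proof (rule alg_Aut_contains_free_rank_2I[OF alg_closed_quantum_veronese[OF v_pos] alg_closed_cone_alg
        veronese_class_value[OF v_pos] g g g_ne])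
    fix w assume w: "w \<in> reduced_words {g 1, g t}" "w \<noteq> []"
    show "word_eval Aut w \<noteq> \<one>\<^bsub>Aut\<^esub>"
    proof (cases "snd (last w)")
      case True
      then obtain p l where "P1 p" "l \<noteq> 0" "word_eval Aut w = p \<otimes>\<^bsub>Aut\<^esub> s2.shear l"
        using pingpong[OF w] by blast
      then show ?thesis using step2[of p l] not_one(2) by metis
    next
      case False
      then obtain p l where "P2 p" "l \<noteq> 0" "word_eval Aut w = p \<otimes>\<^bsub>Aut\<^esub> s1.shear (- l)"
        using pingpong[OF w] by blast
      then show ?thesis using step1[of p "- l"] not_one(1) by (metis neg_equal_0_iff_equal)
    qed
  qed
qed

subsection \<open>The dichotomy\<close>

lemma radical_frag_cmul_root:
  assumes "q powi k = 1" "c \<in> \<Lambda>"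
  shows "frag_cmul k c \<in> radical"
proof -
  have "(q powi m) powi k = 1" for m
    using assms(1) by (metis mult.commute power_int_1_left power_int_mult)
  then show ?thesis using assms(2) by (simp add: radical_def lattice_frag_cmul chi_frag_cmul)
qed

lemma twist_form_unit_right:
  assumes "k \<in> {1..n}"
  shows "twist_form n a (single k 1) = (\<Sum>j\<in>{k<..n}. lookup a j)"
proof -
  have "twist_form n a (single k 1) = (\<Sum>j\<in>{1..n}. if k < j then lookup a j else 0)"
    unfolding twist_form_def
  proof (intro sum.cong refl)
    fix j assume "j \<in> {1..n}"
    have "(\<Sum>i\<in>{1..<j}. lookup a j * lookup (single k 1) i) = (\<Sum>i\<in>{1..<j}. if i = k then lookup a j else 0)"
      by (intro sum.cong refl) (auto simp: lookup_single when_def)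
    then show "(\<Sum>i\<in>{1..<j}. lookup a j * lookup (single k 1) i) = (if k < j then lookup a j else 0)"
      using assms by simp
  qed
  also have "\<dots> = (\<Sum>j\<in>{1..n} \<inter> {j. k < j}. lookup a j)" by (simp add: sum.inter_restrict)
  also have "{1..n} \<inter> {j. k < j} = {k<..n}" by auto
  finally show ?thesis .
qed

lemma twist_form_unit_left:
  assumes "k \<in> {1..n}"
  shows "twist_form n (single k 1) a = (\<Sum>j\<in>{1..<k}. lookup a j)"
proof -
  have "twist_form n (single k 1) a = (\<Sum>j\<in>{1..n}. if j = k then (\<Sum>i\<in>{1..<k}. lookup a i) else 0)"
    unfolding twist_form_def
    by (intro sum.cong refl) (auto simp: lookup_single when_def)
  then show ?thesis using assms by simp
qed

text \<open>The pairing of \<open>e\<close> with the difference of two adjacent unit vectors, which lies in the lattice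
  because its total degree is \<open>0\<close>.\<close>

lemma radical_adjacent:
  assumes e: "e \<in> radical" and k: "k \<in> {1..n}" "Suc k \<in> {1..n}"
  shows "q powi (lookup e k + lookup e (Suc k)) = 1"
proof -
  define b :: "nat \<Rightarrow>\<^sub>0 int" where "b = single k 1 + - single (Suc k) 1"
  have "keys b \<subseteq> {1..n}"
    unfolding b_def by (rule order.trans[OF keys_add Un_least]) (use k in simp_all)
  then have "b \<in> \<Lambda>"
    using k by (simp add: lattice_def b_def total_degree_diff total_degree_single)
  then have "chi e b = chi b e" using e by (simp add: radical_def)
  then have "q powi (twist_form n e b - twist_form n b e) = 1"
    using q_nonzero by (simp add: power_int_diff)
  moreover have "{k<..n} = insert (Suc k) {Suc k<..n}" "{1..<Suc k} = insert k {1..<k}" using k by auto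
  then have "twist_form n e b - twist_form n b e = lookup e k + lookup e (Suc k)"
    by (simp add: b_def twist_form_diff
          twist_form_unit_left[OF k(1)] twist_form_unit_left[OF k(2)]
          twist_form_unit_right[OF k(1)] twist_form_unit_right[OF k(2)])
  ultimately show ?thesis by simp
qed

lemma radical_alternating:
  assumes e: "e \<in> radical" and j: "j \<in> {1..n}"
  shows "q powi lookup e j = q powi lookup e 1 \<or> q powi lookup e j = inverse (q powi lookup e 1)"
  using j
proof (induction j)
  case (Suc j)
  show ?case
  proof (cases "j = 0")
    case False
    then have j: "j \<in> {1..n}" "Suc j \<in> {1..n}" using Suc.prems by auto
    have "q powi lookup e j * q powi lookup e (Suc j) = 1"
      using radical_adjacent[OF e j] q_nonzero by (simp add: power_int_add)
    then have "q powi lookup e (Suc j) = inverse (q powi lookup e j)"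
      by (metis inverse_unique)
    then show ?thesis using Suc.IH[OF j(1)] by auto
  qed (simp add: One_nat_def)
qed simp

text \<open>The \<open>j\<close>-th coordinate of \<open>e\<close> agrees with \<open>1\<close> or \<open>-1\<close> up to some \<open>k\<close> with \<open>q\<close> to the \<open>k\<close> equal
  to \<open>1\<close>; such multiples of differences of unit vectors belong to the radical and can be subtracted.\<close>

lemma radical_unit_coordinate:
  assumes e: "e \<in> radical" "lookup e i = 1" and i: "i \<in> {1..n}" and j: "j \<in> {1..n}"
  shows "\<exists>e'\<in>radical. lookup e' j = - 1 \<and> (\<forall>k\<in>{1..n}. k \<noteq> j \<longrightarrow> 2 \<le> lookup e' k)"
proof -
  have "q powi lookup e j = q powi lookup e i \<or> q powi lookup e j = inverse (q powi lookup e i)"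
    using radical_alternating[OF e(1) i] radical_alternating[OF e(1) j] by auto
  then have "q powi lookup e j = q powi 1 \<or> q powi lookup e j = q powi (- 1)"
    using e(2) by (simp add: power_int_minus)
  then obtain s :: int where s: "s = 1 \<or> s = - 1" "q powi lookup e j = q powi s" by metis
  define k where "k = lookup e j - s"
  have k: "q powi k = 1" using s(2) q_nonzero by (simp add: k_def power_int_diff)
  have "\<exists>e0\<in>radical. lookup e0 j = s"
  proof (cases "i = j")
    case False
    define c :: "nat \<Rightarrow>\<^sub>0 int" where "c = single j 1 + - single i 1"
    have "keys c \<subseteq> {1..n}"
      unfolding c_def by (rule order.trans[OF keys_add Un_least]) (use i j in simp_all)
    then have "c \<in> \<Lambda>"
      using i j by (simp add: lattice_def c_def total_degree_diff total_degree_single)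
    then have "e - frag_cmul k c \<in> radical" by (intro radical_diff e radical_frag_cmul_root k)
    moreover have "lookup (e - frag_cmul k c) j = s"
      using False by (simp add: lookup_minus c_def lookup_add lookup_single k_def)
    ultimately show ?thesis by blast
  next
    case True
    then show ?thesis
      using s(1) e radical_uminus[OF e(1)] by (elim disjE) (auto intro: bexI[of _ e] bexI[of _ "- e"])
  qed
  then obtain e0 where "e0 \<in> radical" "lookup e0 j = s" by blast
  then obtain e1 where e1: "e1 \<in> radical" "lookup e1 j = - 1"
    using s(1) radical_uminus[of e0] by (elim disjE) (auto intro: that[of e0] that[of "- e0"])
  obtain e' where e': "e' \<in> \<Lambda>" "e' - e1 \<in> radical" "\<And>k. k \<in> {1..n} - {j} \<Longrightarrow> 2 \<le> lookup e' k"
    "\<And>k. k \<notin> {1..n} - {j} \<Longrightarrow> lookup e' k = lookup e1 k"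
    using raise[OF radical_lattice[OF e1(1)], of "{1..n} - {j}" 2] by blast
  have "e' \<in> radical" using radical_add[OF e'(2) e1(1)] by simp
  then show ?thesis using e'(3) e'(4)[of j] e1(2) by auto
qed

lemma coordinate_generator:
  assumes i: "i \<in> {1..n}"
  obtains d where "0 < d" "\<And>e. e \<in> radical \<Longrightarrow> d dvd lookup e i" "\<exists>e\<in>radical. lookup e i = d"
proof -
  let ?P = "\<lambda>m :: nat. 0 < m \<and> (\<exists>e\<in>radical. lookup e i = int m)"
  have "frag_cmul (int N) (single i 1) \<in> radical" using i by (intro frag_cmul_N_radical) simp
  then have "?P N" using N_pos by (intro conjI bexI[of _ "frag_cmul (int N) (single i 1)"]) simp_all
  then have P: "?P (LEAST m. ?P m)" by (rule LeastI)
  define m where "m = (LEAST m. ?P m)"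
  obtain e0 where e0: "e0 \<in> radical" "lookup e0 i = int m" "0 < m" using P unfolding m_def by blast
  have "int m dvd lookup e i" if e: "e \<in> radical" for e
  proof (rule ccontr)
    assume "\<not> int m dvd lookup e i"
    then have r: "0 < lookup e i mod int m"
      using e0(3) by (metis dvd_eq_mod_eq_0 of_nat_0_less_iff order_le_less pos_mod_sign)
    define e' where "e' = e - frag_cmul (lookup e i div int m) e0"
    have "e' \<in> radical" unfolding e'_def by (intro radical_diff radical_frag_cmul e e0)
    moreover have "lookup e' i = lookup e i mod int m"
      by (simp add: e'_def lookup_minus e0(2) minus_div_mult_eq_mod)
    ultimately have "?P (nat (lookup e i mod int m))"
      using r by (intro conjI bexI[of _ e']) simp_all
    then have "m \<le> nat (lookup e i mod int m)" unfolding m_def by (rule Least_le)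
    then show False using e0(3) pos_mod_bound[of "int m" "lookup e i"] by linarith
  qed
  then show thesis using that[of "int m"] e0 by auto
qed

theorem tits_alternative_Aut:
  assumes t: "t \<noteq> (0::'k)" "t \<noteq> 1"
  shows "virtually_solvable (alg_Aut (quantum_veronese n q v)) \<or>
    contains_free_rank_2 (alg_Aut (quantum_veronese n q v))"
proof (cases "\<exists>i\<in>{1..n}. \<exists>e\<in>radical. lookup e i = 1")
  case True
  then obtain i e where e: "e \<in> radical" "lookup e i = 1" "i \<in> {1..n}" by blast
  have 12: "1 \<in> {1..n}" "2 \<in> {1..n}" using n_ge_2 by auto
  obtain e1 where e1: "e1 \<in> radical" "lookup e1 1 = - 1" "\<And>k. k \<in> {1..n} \<Longrightarrow> k \<noteq> 1 \<Longrightarrow> 2 \<le> lookup e1 k"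
    using radical_unit_coordinate[OF e 12(1)] by blast
  obtain e2 where e2: "e2 \<in> radical" "lookup e2 2 = - 1" "\<And>k. k \<in> {1..n} \<Longrightarrow> k \<noteq> 2 \<Longrightarrow> 2 \<le> lookup e2 k"
    using radical_unit_coordinate[OF e 12(2)] by blast
  have "shear_data n q v N 1 e1"
    by unfold_locales (use e1 12 in \<open>force+\<close>)
  moreover have "shear_data n q v N 2 e2"
    by unfold_locales (use e2 12 in \<open>force+\<close>)
  ultimately show ?thesis
    using contains_free_rank_2_Aut[OF _ _ e1(3)[OF 12(2)] e2(3)[OF 12(1)] t] by simp
next
  case False
  have "\<exists>d. \<forall>i\<in>{1..n}. 0 < d i \<and> (\<forall>e\<in>radical. d i dvd lookup e i) \<and> (\<exists>e\<in>radical. lookup e i = d i)"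
    by (rule bchoice) (metis coordinate_generator)
  then obtain d where d: "\<And>i. i \<in> {1..n} \<Longrightarrow> 0 < d i"
    "\<And>i e. i \<in> {1..n} \<Longrightarrow> e \<in> radical \<Longrightarrow> d i dvd lookup e i"
    "\<And>i. i \<in> {1..n} \<Longrightarrow> \<exists>e\<in>radical. lookup e i = d i" by blast
  have "2 \<le> d i" if "i \<in> {1..n}" for i
    using d(1)[OF that] d(3)[OF that] False that by (cases "d i = 1") auto
  then interpret rigid n q v N d by unfold_locales (use d in blast)+
  show ?thesis using virtually_solvable_Aut ..
qed

end

theorem theorem0p7:
  assumes "card (UNIV :: 'k::field set) \<noteq> 2"
  shows "(\<forall>n\<ge>2. odd n \<longrightarrow> tits_alternative (veronese_Aut_class TYPE('k) n)) \<and>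
         tits_alternative (veronese_Aut_class TYPE('k) 2)"
proof -
  have "\<exists>t :: 'k. t \<noteq> 0 \<and> t \<noteq> 1"
  proof (rule ccontr)
    assume "\<not> ?thesis"
    then have "(UNIV :: 'k set) = {0, 1}" by auto
    then show False using assms by (metis card_2_iff zero_neq_one)
  qed
  then obtain t :: 'k where t: "t \<noteq> 0" "t \<noteq> 1" by blast
  have "tits_alternative (veronese_Aut_class TYPE('k) n)" if n: "2 \<le> n" for n
    unfolding tits_alternative_def
  proof
    fix G assume "G \<in> veronese_Aut_class TYPE('k) n"
    then obtain q :: 'k and v where G: "G = alg_Aut (quantum_veronese n q v)" "root_of_unity q" "0 < v"
      unfolding veronese_Aut_class_def by blast
    obtain m where m: "0 < m" "q ^ m = 1" using G(2) unfolding root_of_unity_def by blast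
    interpret quantum_root n q v "m * v"
    proof
      show "q \<noteq> 0" using m by (metis power_0_left less_irrefl zero_neq_one)
      show "q ^ (m * v) = 1" using m(2) by (simp add: power_mult)
    qed (use n m G in auto)
    show "virtually_solvable G \<or> contains_free_rank_2 G"
      unfolding G(1) by (rule tits_alternative_Aut[OF t])
  qed
  then show ?thesis by blast
qed

end
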